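(* Let $T$ be a selfadjoint Yang-Baxter-Hecke operator on $\mathcal H\otimes\mathcal H$, $\mathcal H=\ell^2(\mathbb Z)$, with matrix $t$ defined by $T(e_i\otimes e_j)=\sum_{k,l}t_{ij}^{kl}\,e_k\otimes e_l$. Suppose that for all $i,j\in\mathbb Z$ the sum $\sum_{k,l\in\mathbb Z}t_{jl}^{ik}a_k^\dagger a_l$ appearing in the commutation rule $a_ia_j^\dagger-\sum_{k,l\in\mathbb Z}t_{jl}^{ik}a_k^\dagger a_l=\delta_{ij}I$ is finite, and that $[T,U\otimes U]=0$, where $U$ is the right shift $Ue_i=e_{i+1}$. Then the $C^*$-dynamical system $(\mathfrak E_T,\alpha)$ is uniquely mixing with respect to the fixed point subalgebra.
   Context: A Yang-Baxter operator on a Hilbert space $\mathcal H$ is a selfadjoint operator $T$ on $\mathcal H\otimes\mathcal H$ with $T\ge -I$ and $T_1T_2T_1=T_2T_1T_2$ on $\mathcal H^{\otimes 3}$, where $T_1=T\otimes I$, $T_2=I\otimes T$. It is Yang-Baxter-Hecke if in addition there is $q\ge -1$ with $T^2=(q-1)T+qI$ (then $T$ is bounded). On $\mathcal H^{\otimes n}$ let $T_k=I^{\otimes(k-1)}\otimes T\otimes I^{\otimes(n-k-1)}$, $R^{(n)}=I+T_1+T_1T_2+\cdots+T_1T_2\cdots T_{n-1}$, and define $P^{(1)}=I$, $P^{(n+1)}=(I\otimes P^{(n)})R^{(n+1)}$; these are positive operators. The $T$-deformed pre-inner product is $\langle\xi,\eta\rangle_T=\delta_{n,m}\langle\xi,P^{(n)}\eta\rangle$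 for $\xi\in\mathcal H^{\otimes n}$, $\eta\in\mathcal H^{\otimes m}$. $\mathcal H_T^n$ is the Hilbert space completion of $\mathcal H^{\otimes n}$ modulo the kernel of $\langle\cdot,\cdot\rangle_T$, $\mathcal H_T^0=\mathbb C$, and $\mathcal F_T(\mathcal H)=\bigoplus_{n\ge0}\mathcal H_T^n$ with vacuum vector $\Omega=(1,0,0,\dots)$. The creation operator is $a^\dagger(f)\xi=f\otimes\xi$, and the annihilator $a(f)$ is its adjoint for $\langle\cdot,\cdot\rangle_T$, with $a(f)\Omega=0$; both are bounded on each $\mathcal H_T^n$ (but possibly unbounded on the whole Fock space). Put $a_i=a(e_i)$, $a_i^\dagger=a^\dagger(e_i)$ for the canonical basis $\{e_i\}$ of $\ell^2(\mathbb Z)$. "The sum is finite" means that for all $i,j$ only finitely many pairs $(k,l)$ have $t_{jl}^{ik}\neq0$. Let $E_T^n$ be the selfadjoint projection of $\mathcal F_T(\mathcal H)$ onto $\mathcal H_T^n$. $\mathfrak E_T$ is the $C^*$-algebra on $\mathcal F_T(\mathcal H)$ generated by $I$ together with all elements $E_T^m\,a^\sharp(e_{i_1})a^\sharp(e_{i_2})\cdots a^\sharp(e_{i_r})\,E_T^n$, $m,n,r=0,1,2,\dots$, where each $a^\sharp$ is either $a$ or $a^\dagger$. If $[T,U\otimes U]=0$, then $\Omega\mapsto\Omega$ and $U^{\otimes n}$ define a unitary $\mathcal F_T(U)$ on $\mathcal F_T(\mathcal H)$, and $\alpha$ is the restriction to $\mathfrak E_T$ of $\mathcal F_T(U)\,\cdot\,\mathcal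 F_T(U)^*$, so that $a_i$ is sent to $a_{i+1}$ and each $E_T^n$ is fixed. For a unital $C^*$-algebra $\mathfrak A$ with automorphism $\alpha$ and fixed point subalgebra $\mathfrak A^{\mathbb Z}=\{a\in\mathfrak A\mid\alpha(a)=a\}$, the system is uniquely mixing with respect to the fixed point subalgebra if there is a (necessarily unique) $\alpha$-invariant conditional expectation $E^{\mathbb Z}:\mathfrak A\to\mathfrak A^{\mathbb Z}$ such that $\lim_{n\to+\infty}f(\alpha^n(a))=f(E^{\mathbb Z}(a))$ for all $a\in\mathfrak A$, $f\in\mathfrak A^*$. *)

theory Defs
  imports "HOL-Analysis.Analysis"
begin

section \<open>Complex Hilbert spaces and C*-algebras of operators\<close>

text \<open>Inner products are linear in the second argument.  Positive definiteness
  of \<open>cinner\<close> is contained in the norm axiom.\<close>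

class complex_inner = real_normed_vector +
  fixes scaleC :: "complex \<Rightarrow> 'a \<Rightarrow> 'a" (infixr "*\<^sub>C" 75)
    and cinner :: "'a \<Rightarrow> 'a \<Rightarrow> complex"
  assumes scaleC_add_right: "c *\<^sub>C (x + y) = c *\<^sub>C x + c *\<^sub>C y"
    and scaleC_add_left: "(c + d) *\<^sub>C x = c *\<^sub>C x + d *\<^sub>C x"
    and scaleC_scaleC: "c *\<^sub>C d *\<^sub>C x = (c * d) *\<^sub>C x"
    and scaleC_of_real: "complex_of_real r *\<^sub>C x = r *\<^sub>R x"
    and cinner_commute: "cinner x y = cnj (cinner y x)"
    and cinner_add_right: "cinner x (y + z) = cinner x y + cinner x z"
    and cinner_scaleC_right: "cinner x (c *\<^sub>C y) = c * cinner x y"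
    and norm_eq_sqrt_cinner: "norm x = sqrt (Re (cinner x x))"

class complex_hilbert_space = complex_inner + complete_space

text \<open>The library type \<open>'h \<Rightarrow>\<^sub>L 'h\<close> consists of the bounded real-linear maps; the
  bounded operators of the complex Hilbert space are the complex-linear ones.\<close>

definition bounded_operators :: "('h::complex_hilbert_space \<Rightarrow>\<^sub>L 'h) set" where
  "bounded_operators = {A. \<forall>c x. blinfun_apply A (c *\<^sub>C x) = c *\<^sub>C blinfun_apply A x}"

definition scale_op :: "complex \<Rightarrow> ('h::complex_hilbert_space \<Rightarrow>\<^sub>L 'h) \<Rightarrow> ('h \<Rightarrow>\<^sub>L 'h)" where
  "scale_op c A = Blinfun (\<lambda>x. c *\<^sub>C blinfun_apply A x)"

definition adj :: "('h::complex_hilbert_space \<Rightarrow>\<^sub>L 'h) \<Rightarrow> ('h \<Rightarrow>\<^sub>L 'h)" where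
  "adj A = (THE B. B \<in> bounded_operators \<and>
     (\<forall>x y. cinner (blinfun_apply B x) y = cinner x (blinfun_apply A y)))"

definition positive_op :: "('h::complex_hilbert_space \<Rightarrow>\<^sub>L 'h) \<Rightarrow> bool" where
  "positive_op A \<longleftrightarrow> A \<in> bounded_operators \<and>
     (\<forall>x. Im (cinner x (blinfun_apply A x)) = 0 \<and> 0 \<le> Re (cinner x (blinfun_apply A x)))"

definition unitary_op :: "('h::complex_hilbert_space \<Rightarrow>\<^sub>L 'h) \<Rightarrow> bool" where
  "unitary_op W \<longleftrightarrow> W \<in> bounded_operators \<and>
     adj W o\<^sub>L W = id_blinfun \<and> W o\<^sub>L adj W = id_blinfun"

definition cstar_subalgebra :: "('h::complex_hilbert_space \<Rightarrow>\<^sub>L 'h) set \<Rightarrow> bool" where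
  "cstar_subalgebra S \<longleftrightarrow> S \<subseteq> bounded_operators \<and> 0 \<in> S \<and>
     (\<forall>A\<in>S. \<forall>B\<in>S. A + B \<in> S \<and> A o\<^sub>L B \<in> S) \<and>
     (\<forall>A\<in>S. \<forall>c. scale_op c A \<in> S) \<and>
     (\<forall>A\<in>S. adj A \<in> S) \<and>
     closed S"

definition cstar_generated :: "('h::complex_hilbert_space \<Rightarrow>\<^sub>L 'h) set \<Rightarrow> ('h \<Rightarrow>\<^sub>L 'h) set" where
  "cstar_generated G = \<Inter> {S. cstar_subalgebra S \<and> G \<subseteq> S}"


section \<open>Unique mixing with respect to the fixed point subalgebra\<close>

definition linear_on_algebra ::
  "('h::complex_hilbert_space \<Rightarrow>\<^sub>L 'h) set \<Rightarrow> (('h \<Rightarrow>\<^sub>L 'h) \<Rightarrow> ('h \<Rightarrow>\<^sub>L 'h)) \<Rightarrow> bool" where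
  "linear_on_algebra \<AA> \<Phi> \<longleftrightarrow>
     (\<forall>a\<in>\<AA>. \<forall>b\<in>\<AA>. \<Phi> (a + b) = \<Phi> a + \<Phi> b) \<and>
     (\<forall>a\<in>\<AA>. \<forall>c. \<Phi> (scale_op c a) = scale_op c (\<Phi> a))"

definition cstar_dynamical_system ::
  "('h::complex_hilbert_space \<Rightarrow>\<^sub>L 'h) set \<Rightarrow> (('h \<Rightarrow>\<^sub>L 'h) \<Rightarrow> ('h \<Rightarrow>\<^sub>L 'h)) \<Rightarrow> bool" where
  "cstar_dynamical_system \<AA> \<alpha> \<longleftrightarrow>
     cstar_subalgebra \<AA> \<and> id_blinfun \<in> \<AA> \<and>
     bij_betw \<alpha> \<AA> \<AA> \<and> linear_on_algebra \<AA> \<alpha> \<and>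
     (\<forall>a\<in>\<AA>. \<forall>b\<in>\<AA>. \<alpha> (a o\<^sub>L b) = \<alpha> a o\<^sub>L \<alpha> b) \<and>
     (\<forall>a\<in>\<AA>. \<alpha> (adj a) = adj (\<alpha> a))"

definition fixed_points ::
  "('h::complex_hilbert_space \<Rightarrow>\<^sub>L 'h) set \<Rightarrow> (('h \<Rightarrow>\<^sub>L 'h) \<Rightarrow> ('h \<Rightarrow>\<^sub>L 'h)) \<Rightarrow> ('h \<Rightarrow>\<^sub>L 'h) set" where
  "fixed_points \<AA> \<alpha> = {a \<in> \<AA>. \<alpha> a = a}"

definition dual_functional ::
  "('h::complex_hilbert_space \<Rightarrow>\<^sub>L 'h) set \<Rightarrow> (('h \<Rightarrow>\<^sub>L 'h) \<Rightarrow> complex) \<Rightarrow> bool" where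
  "dual_functional \<AA> f \<longleftrightarrow>
     (\<forall>a\<in>\<AA>. \<forall>b\<in>\<AA>. f (a + b) = f a + f b) \<and>
     (\<forall>a\<in>\<AA>. \<forall>c. f (scale_op c a) = c * f a) \<and>
     (\<exists>K. \<forall>a\<in>\<AA>. norm (f a) \<le> K * norm a)"

text \<open>By Tomiyama's theorem the positivity and bimodule clauses already follow from
  contractivity and the projection property; all of them are listed.\<close>

definition conditional_expectation_onto ::
  "('h::complex_hilbert_space \<Rightarrow>\<^sub>L 'h) set \<Rightarrow> ('h \<Rightarrow>\<^sub>L 'h) set \<Rightarrow>
     (('h \<Rightarrow>\<^sub>L 'h) \<Rightarrow> ('h \<Rightarrow>\<^sub>L 'h)) \<Rightarrow> bool" where
  "conditional_expectation_onto \<AA> \<BB> \<E> \<longleftrightarrow>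
     linear_on_algebra \<AA> \<E> \<and>
     \<E> ` \<AA> \<subseteq> \<BB> \<and> (\<forall>b\<in>\<BB>. \<E> b = b) \<and>
     (\<forall>a\<in>\<AA>. norm (\<E> a) \<le> norm a) \<and>
     (\<forall>a\<in>\<AA>. positive_op a \<longrightarrow> positive_op (\<E> a)) \<and>
     (\<forall>a\<in>\<AA>. \<forall>b\<in>\<BB>. \<forall>c\<in>\<BB>. \<E> (b o\<^sub>L a o\<^sub>L c) = b o\<^sub>L \<E> a o\<^sub>L c)"

definition uniquely_mixing_fixed_points ::
  "('h::complex_hilbert_space \<Rightarrow>\<^sub>L 'h) set \<Rightarrow> (('h \<Rightarrow>\<^sub>L 'h) \<Rightarrow> ('h \<Rightarrow>\<^sub>L 'h)) \<Rightarrow> bool" where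
  "uniquely_mixing_fixed_points \<AA> \<alpha> \<longleftrightarrow>
     cstar_dynamical_system \<AA> \<alpha> \<and>
     (\<exists>\<E>. conditional_expectation_onto \<AA> (fixed_points \<AA> \<alpha>) \<E> \<and>
          (\<forall>a\<in>\<AA>. \<E> (\<alpha> a) = \<E> a) \<and>
          (\<forall>f. dual_functional \<AA> f \<longrightarrow>
             (\<forall>a\<in>\<AA>. (\<lambda>n. f ((\<alpha> ^^ n) a)) \<longlonglongrightarrow> f (\<E> a))))"


section \<open>Tensor powers of l2(Z) and Yang-Baxter-Hecke operators\<close>

text \<open>The n-th Hilbert space tensor power of l2(Z) is identified with l2(Z^n): its
  elements are the square-summable functions on integer lists that are supported on
  lists of length n, and the basis vector
  \<open>e i\<^sub>1 \<otimes> \<dots> \<otimes> e i\<^sub>n\<close> is \<open>basis [i\<^sub>1, \<dots>, i\<^sub>n]\<close>.\<close>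

type_synonym tensor = "int list \<Rightarrow> complex"

definition tensor_power :: "nat \<Rightarrow> tensor set" where
  "tensor_power n = {\<xi>. (\<forall>xs. length xs \<noteq> n \<longrightarrow> \<xi> xs = 0) \<and>
                        (\<lambda>xs. (cmod (\<xi> xs))\<^sup>2) summable_on UNIV}"

definition basis :: "int list \<Rightarrow> tensor" where
  "basis xs = (\<lambda>ys. if ys = xs then 1 else 0)"

definition tensor_inner :: "tensor \<Rightarrow> tensor \<Rightarrow> complex" where
  "tensor_inner \<xi> \<eta> = (\<Sum>\<^sub>\<infinity>xs. cnj (\<xi> xs) * \<eta> xs)"

text \<open>The amplification \<open>T\<^sub>k = I \<otimes> \<dots> \<otimes> T \<otimes> \<dots> \<otimes> I\<close> applies T to the
  factors k and k + 1 (counted from 1), with all other coordinates frozen.\<close>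

definition leg :: "(tensor \<Rightarrow> tensor) \<Rightarrow> nat \<Rightarrow> tensor \<Rightarrow> tensor" where
  "leg T k \<xi> = (\<lambda>xs. if 1 \<le> k \<and> k + 1 \<le> length xs
     then T (\<lambda>ys. if length ys = 2 then \<xi> (take (k - 1) xs @ ys @ drop (k + 1) xs) else 0)
            (take 2 (drop (k - 1) xs))
     else 0)"

text \<open>\<open>id_tensor A\<close> is \<open>I \<otimes> A\<close>, and \<open>leg_product T k\<close> is \<open>T\<^sub>1 T\<^sub>2 \<dots> T\<^sub>k\<close>.\<close>

definition id_tensor :: "(tensor \<Rightarrow> tensor) \<Rightarrow> tensor \<Rightarrow> tensor" where
  "id_tensor A \<xi> = (\<lambda>xs. case xs of [] \<Rightarrow> 0 | i # ys \<Rightarrow> A (\<lambda>zs. \<xi> (i # zs)) ys)"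

primrec leg_product :: "(tensor \<Rightarrow> tensor) \<Rightarrow> nat \<Rightarrow> tensor \<Rightarrow> tensor" where
  "leg_product T 0 = id"
| "leg_product T (Suc k) = leg_product T k \<circ> leg T (Suc k)"

definition R_op :: "(tensor \<Rightarrow> tensor) \<Rightarrow> nat \<Rightarrow> tensor \<Rightarrow> tensor" where
  "R_op T n \<xi> = (\<lambda>xs. \<Sum>k<n. leg_product T k \<xi> xs)"

text \<open>Starting the recursion at 0 gives \<open>P\<^sup>(\<^sup>1\<^sup>) = I\<close> on the first tensor power.\<close>

primrec P_op :: "(tensor \<Rightarrow> tensor) \<Rightarrow> nat \<Rightarrow> tensor \<Rightarrow> tensor" where
  "P_op T 0 = id"
| "P_op T (Suc n) = id_tensor (P_op T n) \<circ> R_op T (Suc n)"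

text \<open>A selfadjoint T with \<open>T\<^sup>2 = (q - 1) T + q I\<close> is bounded, hence everywhere
  defined; conversely an everywhere defined T satisfying the conditions below is bounded,
  so boundedness is not listed.\<close>

definition selfadjoint_on_pairs :: "(tensor \<Rightarrow> tensor) \<Rightarrow> bool" where
  "selfadjoint_on_pairs T \<longleftrightarrow>
     (\<forall>\<xi>\<in>tensor_power 2. T \<xi> \<in> tensor_power 2) \<and>
     (\<forall>\<xi>\<in>tensor_power 2. \<forall>\<eta>\<in>tensor_power 2.
        T (\<lambda>xs. \<xi> xs + \<eta> xs) = (\<lambda>xs. T \<xi> xs + T \<eta> xs)) \<and>
     (\<forall>\<xi>\<in>tensor_power 2. \<forall>c. T (\<lambda>xs. c * \<xi> xs) = (\<lambda>xs. c * T \<xi> xs)) \<and>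
     (\<forall>\<xi>\<in>tensor_power 2. \<forall>\<eta>\<in>tensor_power 2.
        tensor_inner (T \<xi>) \<eta> = tensor_inner \<xi> (T \<eta>))"

definition yang_baxter_operator :: "(tensor \<Rightarrow> tensor) \<Rightarrow> bool" where
  "yang_baxter_operator T \<longleftrightarrow>
     selfadjoint_on_pairs T \<and>
     (\<forall>\<xi>\<in>tensor_power 2. - Re (tensor_inner \<xi> \<xi>) \<le> Re (tensor_inner \<xi> (T \<xi>))) \<and>
     (\<forall>\<xi>\<in>tensor_power 3.
        leg T 1 (leg T 2 (leg T 1 \<xi>)) = leg T 2 (leg T 1 (leg T 2 \<xi>)))"

definition yang_baxter_hecke_operator :: "(tensor \<Rightarrow> tensor) \<Rightarrow> bool" where
  "yang_baxter_hecke_operator T \<longleftrightarrow>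
     yang_baxter_operator T \<and>
     (\<exists>q\<ge>-1. \<forall>\<xi>\<in>tensor_power 2.
        T (T \<xi>) = (\<lambda>xs. complex_of_real (q - 1) * T \<xi> xs + complex_of_real q * \<xi> xs))"

text \<open>\<open>t_coeff T i j k l\<close> is \<open>t\<^sub>i\<^sub>j\<^sup>k\<^sup>l\<close>, the coefficient of \<open>e k \<otimes> e l\<close> in
  \<open>T (e i \<otimes> e j)\<close>.\<close>

definition t_coeff :: "(tensor \<Rightarrow> tensor) \<Rightarrow> int \<Rightarrow> int \<Rightarrow> int \<Rightarrow> int \<Rightarrow> complex" where
  "t_coeff T i j k l = T (basis [i, j]) [k, l]"

text \<open>The n-th tensor power of the right shift \<open>U (e i) = e (i + 1)\<close>, for all n at once.\<close>

definition shift :: "tensor \<Rightarrow> tensor" where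
  "shift \<xi> = (\<lambda>xs. \<xi> (map (\<lambda>i. i - 1) xs))"


section \<open>The T-deformed Fock space\<close>

text \<open>The Fock space is determined up to a unique unitary by the canonical map J that sends
  a tensor of some degree n to its class: J is linear on each tensor power,
  turns the T-deformed pre-inner product into the inner product (so that its kernel is
  divided out and different degrees are orthogonal), and the closed span of its image is
  everything. (Existence amounts to positivity of the operators \<open>P_op T n\<close>.) The
  completion of the n-th tensor power is then the closure of its image.\<close>

definition deformed_fock_space ::
  "(tensor \<Rightarrow> tensor) \<Rightarrow> (tensor \<Rightarrow> 'h::complex_hilbert_space) \<Rightarrow> bool" where
  "deformed_fock_space T J \<longleftrightarrow>
     (\<forall>n. \<forall>\<xi>\<in>tensor_power n. \<forall>\<eta>\<in>tensor_power n. J (\<lambda>xs. \<xi> xs + \<eta> xs) = J \<xi> + J \<eta>) \<and>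
     (\<forall>n. \<forall>\<xi>\<in>tensor_power n. \<forall>c. J (\<lambda>xs. c * \<xi> xs) = c *\<^sub>C J \<xi>) \<and>
     (\<forall>m n. \<forall>\<xi>\<in>tensor_power m. \<forall>\<eta>\<in>tensor_power n.
        cinner (J \<xi>) (J \<eta>) = (if m = n then tensor_inner \<xi> (P_op T n \<eta>) else 0)) \<and>
     closure (span (\<Union>n. J ` tensor_power n)) = UNIV"

definition particle_space :: "(tensor \<Rightarrow> 'h::complex_hilbert_space) \<Rightarrow> nat \<Rightarrow> 'h set" where
  "particle_space J n = closure (J ` tensor_power n)"

definition finite_particle_space :: "(tensor \<Rightarrow> 'h::complex_hilbert_space) \<Rightarrow> 'h set" where
  "finite_particle_space J = span (\<Union>n. particle_space J n)"

definition particle_projection :: "(tensor \<Rightarrow> 'h::complex_hilbert_space) \<Rightarrow> nat \<Rightarrow> 'h \<Rightarrow>\<^sub>L 'h" where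
  "particle_projection J n = (THE p. p \<in> bounded_operators \<and> p o\<^sub>L p = p \<and> adj p = p \<and>
     range (blinfun_apply p) = particle_space J n)"

definition tensor_left :: "(int \<Rightarrow> complex) \<Rightarrow> tensor \<Rightarrow> tensor" where
  "tensor_left f \<xi> = (\<lambda>xs. case xs of [] \<Rightarrow> 0 | i # ys \<Rightarrow> f i * \<xi> ys)"

text \<open>Creation and annihilation operators live on the finite particle vectors, as they need
  not be bounded on the whole Fock space; they are set to 0 elsewhere. The vacuum is
  annihilated because it is orthogonal to the range of every creation operator.\<close>

definition creation :: "(tensor \<Rightarrow> 'h::complex_hilbert_space) \<Rightarrow> (int \<Rightarrow> complex) \<Rightarrow> 'h \<Rightarrow> 'h" where
  "creation J f = (THE A.
     (\<forall>x. x \<notin> finite_particle_space J \<longrightarrow> A x = 0) \<and>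
     (\<forall>x\<in>finite_particle_space J. \<forall>y\<in>finite_particle_space J. A (x + y) = A x + A y) \<and>
     (\<forall>x\<in>finite_particle_space J. \<forall>c. A (c *\<^sub>C x) = c *\<^sub>C A x) \<and>
     (\<forall>n. continuous_on (particle_space J n) A) \<and>
     (\<forall>n. \<forall>\<xi>\<in>tensor_power n. A (J \<xi>) = J (tensor_left f \<xi>)))"

definition annihilation :: "(tensor \<Rightarrow> 'h::complex_hilbert_space) \<Rightarrow> (int \<Rightarrow> complex) \<Rightarrow> 'h \<Rightarrow> 'h" where
  "annihilation J f = (THE B.
     (\<forall>x. x \<notin> finite_particle_space J \<longrightarrow> B x = 0) \<and>
     (\<forall>x\<in>finite_particle_space J. B x \<in> finite_particle_space J) \<and>
     (\<forall>x\<in>finite_particle_space J. \<forall>y\<in>finite_particle_space J.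
        cinner (B x) y = cinner x (creation J f y)))"

definition unit_vector :: "int \<Rightarrow> int \<Rightarrow> complex" where
  "unit_vector i = (\<lambda>k. if k = i then 1 else 0)"

datatype ladder = Create int | Annihilate int

primrec ladder_op :: "(tensor \<Rightarrow> 'h::complex_hilbert_space) \<Rightarrow> ladder \<Rightarrow> 'h \<Rightarrow> 'h" where
  "ladder_op J (Create i) = creation J (unit_vector i)"
| "ladder_op J (Annihilate i) = annihilation J (unit_vector i)"

primrec ladder_word :: "(tensor \<Rightarrow> 'h::complex_hilbert_space) \<Rightarrow> ladder list \<Rightarrow> 'h \<Rightarrow> 'h" where
  "ladder_word J [] = id"
| "ladder_word J (w # ws) = ladder_op J w \<circ> ladder_word J ws"

definition cutoff_word ::
  "(tensor \<Rightarrow> 'h::complex_hilbert_space) \<Rightarrow> nat \<Rightarrow> ladder list \<Rightarrow> nat \<Rightarrow> 'h \<Rightarrow>\<^sub>L 'h" where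
  "cutoff_word J m ws n = Blinfun (\<lambda>x. blinfun_apply (particle_projection J m)
     (ladder_word J ws (blinfun_apply (particle_projection J n) x)))"

definition fock_algebra :: "(tensor \<Rightarrow> 'h::complex_hilbert_space) \<Rightarrow> ('h \<Rightarrow>\<^sub>L 'h) set" where
  "fock_algebra J = cstar_generated (insert id_blinfun {cutoff_word J m ws n |m ws n. True})"

definition fock_shift :: "(tensor \<Rightarrow> 'h::complex_hilbert_space) \<Rightarrow> 'h \<Rightarrow>\<^sub>L 'h" where
  "fock_shift J = (THE W. unitary_op W \<and>
     (\<forall>n. \<forall>\<xi>\<in>tensor_power n. blinfun_apply W (J \<xi>) = J (shift \<xi>)))"

definition shift_automorphism ::
  "(tensor \<Rightarrow> 'h::complex_hilbert_space) \<Rightarrow> ('h \<Rightarrow>\<^sub>L 'h) \<Rightarrow> ('h \<Rightarrow>\<^sub>L 'h)" where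
  "shift_automorphism J A = fock_shift J o\<^sub>L A o\<^sub>L adj (fock_shift J)"

end

theory Submission
  imports Defs
begin

text \<open>The commutation rule, whose sums are finite, turns every cut-off word into a linear combination of
  words that begin with a creator, words that end with an annihilator, and the fixed projections
  \<open>E n\<close>. On a fixed particle space, vectors \<open>e\<^sub>i \<otimes> \<eta>\<^sub>i\<close> with different i are
  orthogonal up to a constant, because \<open>P\<^sup>(\<^sup>n\<^sup>+\<^sup>1\<^sup>)\<close> is bounded by a multiple of
  \<open>I \<otimes> P\<^sup>(\<^sup>n\<^sup>)\<close>. Hence sums of N translates of a word of the first two kinds, with coefficients of
  modulus at most 1, have norm of order \<open>sqrt N\<close>, which forces these words to mix weakly to 0. The
  elements with a weak limit that is fixed form a norm closed subspace, hence the whole algebra,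
  and taking the weak limit is the conditional expectation.\<close>

section \<open>Hilbert space preliminaries\<close>

text \<open>Creation operators may be unbounded on the whole Fock space, so all estimates are made
  for the blocks between neighbouring particle spaces; \<open>creation\<close>,
  \<open>annihilation\<close>, \<open>particle_projection\<close> and \<open>fock_shift\<close>,
  which are definite descriptions, are first identified with explicit operators. Positivity of
  \<open>P_op T n\<close> is read off from the given \<open>J\<close>. The comparison with I
  \<otimes> \<open>P_op T n\<close> rests on \<open>P_op T (Suc n)\<close> being the product of that
  operator with \<open>R_op T (Suc n)\<close>: since the product is hermitian, the second factor is
  symmetric for the semidefinite form of the first, and a symmetric operator that is bounded in the
  ambient norm is bounded for the form. The growth sqrt N comes from a row estimate: the squared
  norm of a sum of \<open>cre n i (z i)\<close> over distinct \<open>i\<close> is at most a constant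
  times the sum of the squared norms of the \<open>z i\<close>. It holds for arbitrary finite index
  sets, not only for initial segments of an orbit, and this yields convergence along the orbit
  itself rather than of averages. Finiteness of the sums keeps normal ordering purely
  algebraic.\<close>

instance complex_hilbert_space \<subseteq> banach ..

lemma cinner_add_left: "cinner (x + y) z = cinner x z + cinner y z"
  by (metis cinner_commute cinner_add_right complex_cnj_add)

lemma cinner_scaleC_left: "cinner (c *\<^sub>C x) y = cnj c * cinner x y"
  by (metis cinner_commute cinner_scaleC_right complex_cnj_mult complex_cnj_cnj)

lemma cinner_scaleR_right: "cinner x (r *\<^sub>R y) = of_real r * cinner x y"
  by (metis cinner_scaleC_right scaleC_of_real)

lemma cinner_scaleR_left: "cinner (r *\<^sub>R x) y = of_real r * cinner x y"
  by (metis cinner_scaleC_left scaleC_of_real complex_cnj_complex_of_real)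

lemma cinner_zero_right [simp]: "cinner x 0 = 0"
  using cinner_scaleR_right[of x 0 0] by simp

lemma cinner_zero_left [simp]: "cinner 0 x = 0"
  using cinner_scaleR_left[of 0 0 x] by simp

lemma cinner_minus_right: "cinner x (- y) = - cinner x y"
  using cinner_scaleR_right[of x "-1" y] by simp

lemma cinner_minus_left: "cinner (- x) y = - cinner x y"
  using cinner_scaleR_left[of "-1" x y] by simp

lemma cinner_diff_right: "cinner x (y - z) = cinner x y - cinner x z"
  using cinner_add_right[of x y "- z"] by (simp add: cinner_minus_right)

lemma cinner_diff_left: "cinner (x - y) z = cinner x z - cinner y z"
  using cinner_add_left[of x "- y" z] by (simp add: cinner_minus_left)

lemma cinner_sum_right: "cinner x (\<Sum>i\<in>I. f i) = (\<Sum>i\<in>I. cinner x (f i))"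
  by (induction I rule: infinite_finite_induct) (simp_all add: cinner_add_right)

lemma cinner_sum_left: "cinner (\<Sum>i\<in>I. f i) x = (\<Sum>i\<in>I. cinner (f i) x)"
  by (induction I rule: infinite_finite_induct) (simp_all add: cinner_add_left)

lemmas cinner_simps = cinner_add_left cinner_add_right cinner_diff_left cinner_diff_right
  cinner_scaleC_left cinner_scaleC_right cinner_scaleR_left cinner_scaleR_right
  cinner_minus_left cinner_minus_right

text \<open>The real square root is odd, so the nonnegative norm in
  \<open>norm_eq_sqrt_cinner\<close> forces the argument of the root to be nonnegative; this is how
  positivity is recovered from the norm axiom.\<close>

lemma Re_cinner_self: "Re (cinner x x) = (norm x)\<^sup>2"
proof -
  have "0 \<le> sqrt (Re (cinner x x))"
    by (metis norm_eq_sqrt_cinner norm_ge_zero)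
  then show ?thesis by (simp add: norm_eq_sqrt_cinner)
qed

lemma cinner_self: "cinner x x = of_real ((norm x)\<^sup>2)"
proof -
  have "Im (cinner x x) = 0"
    using arg_cong[OF cinner_commute[of x x], of Im] by simp
  then show ?thesis by (simp add: complex_eq_iff Re_cinner_self)
qed

lemma cinner_eq_zero_iff [simp]: "cinner x x = 0 \<longleftrightarrow> x = 0"
  by (simp add: cinner_self)

lemma scaleC_zero_left [simp]: "0 *\<^sub>C x = 0"
  using scaleC_of_real[of 0 x] by simp

lemma scaleC_zero_right [simp]: "c *\<^sub>C 0 = 0"
  using scaleC_add_right[of c 0 0] by simp

lemma scaleC_one [simp]: "1 *\<^sub>C x = x"
  using scaleC_of_real[of 1 x] by simp

lemma scaleC_minus_right: "c *\<^sub>C (- x) = - (c *\<^sub>C x)"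
  using scaleC_add_right[of c x "- x"] by (simp add: eq_neg_iff_add_eq_0 add.commute)

lemma scaleC_diff_right: "c *\<^sub>C (x - y) = c *\<^sub>C x - c *\<^sub>C y"
  using scaleC_add_right[of c x "- y"] by (simp add: scaleC_minus_right)

lemma scaleC_scaleR: "c *\<^sub>C (r *\<^sub>R x) = r *\<^sub>R (c *\<^sub>C x)"
  by (metis mult.commute scaleC_of_real scaleC_scaleC)

lemma scaleC_sum_right: "c *\<^sub>C (\<Sum>i\<in>I. f i) = (\<Sum>i\<in>I. c *\<^sub>C f i)"
  by (induction I rule: infinite_finite_induct) (simp_all add: scaleC_add_right)

lemma norm_scaleC: "norm (c *\<^sub>C x) = cmod c * norm x"
proof -
  have "(norm (c *\<^sub>C x))\<^sup>2 = (cmod c * norm x)\<^sup>2"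
    unfolding Re_cinner_self[symmetric] cinner_scaleC_left cinner_scaleC_right
    by (simp add: cinner_self power_mult_distrib cmod_power2) (simp add: power2_eq_square algebra_simps)
  then show ?thesis by (simp add: power2_eq_iff_nonneg)
qed

lemma bounded_linear_scaleC: "bounded_linear (\<lambda>x. c *\<^sub>C x)"
  by (rule bounded_linear_intro[where K = "cmod c"])
    (simp_all add: scaleC_add_right scaleC_scaleR norm_scaleC mult.commute)

lemma Re_cinner_commute: "Re (cinner x y) = Re (cinner y x)"
  by (simp add: cinner_commute[of x y])

section \<open>Norm identities and the Cauchy-Schwarz inequality\<close>

lemma norm_diff_squared:
  "(norm (x - y))\<^sup>2 = (norm x)\<^sup>2 - 2 * Re (cinner x y) + (norm y)\<^sup>2"
proof -
  show ?thesis
    unfolding Re_cinner_self[symmetric] by (simp add: cinner_simps Re_cinner_commute[of y x])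
qed

lemma norm_add_squared:
  "(norm (x + y))\<^sup>2 = (norm x)\<^sup>2 + 2 * Re (cinner x y) + (norm y)\<^sup>2"
  using norm_diff_squared[of x "- y"] by (simp add: cinner_minus_right)

text \<open>Common core of three arguments: Cauchy-Schwarz in the Hilbert space, orthogonality of
  the error to a nearest point, and Cauchy-Schwarz for a semidefinite form. The case
  \<open>c = 0\<close> is included, where the bound says \<open>b = 0\<close>.\<close>

lemma discriminant_bound:
  fixes a b c :: real
  assumes "\<And>t. 0 \<le> a + 2 * t * b + t\<^sup>2 * c"
  shows "b\<^sup>2 \<le> a * c"
proof (cases "c = 0")
  case True
  have "b = 0"
  proof (rule ccontr)
    assume "b \<noteq> 0"
    \<comment> \<open>At this point the affine function takes the value -1.\<close>
    then show False using assms[of "- (a + 1) / (2 * b)"] True by (simp add: field_simps)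
  qed
  then show ?thesis using True by simp
next
  case False
  have "0 \<le> c"
  proof (rule ccontr)
    assume "\<not> 0 \<le> c"
    then have c: "c < 0" by simp
    \<comment> \<open>Chosen so that \<open>t\<^sup>2 * c\<close> equals \<open>- t\<close> times
      \<open>- c + \<bar>a\<bar> + 2 * \<bar>b\<bar>\<close>, which beats
      \<open>a + 2 * t * b\<close> because \<open>t \<ge> 1\<close>.\<close>
    define t where "t = 1 + \<bar>a\<bar> / (- c) + 2 * \<bar>b\<bar> / (- c)"
    have "\<bar>a\<bar> / (- c) \<ge> 0" "2 * \<bar>b\<bar> / (- c) \<ge> 0"
      using c by (intro divide_nonneg_pos; simp)+
    then have t: "t \<ge> 1" by (simp add: t_def)
    have tc: "t * (- c) = - c + \<bar>a\<bar> + 2 * \<bar>b\<bar>"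
      using c by (simp add: t_def field_simps)
    have "t\<^sup>2 * c = - t * (- c + \<bar>a\<bar> + 2 * \<bar>b\<bar>)"
      unfolding tc[symmetric] by (simp add: power2_eq_square)
    moreover have "t * (- c) > 0" "t * \<bar>a\<bar> \<ge> \<bar>a\<bar>" "t * b \<le> t * \<bar>b\<bar>"
      using t c by (auto intro: mult_left_mono simp: mult_le_cancel_right1 mult_less_0_iff)
    ultimately have "a + 2 * t * b + t\<^sup>2 * c < 0"
      by (simp add: algebra_simps)
    then show False using assms[of t] by simp
  qed
  then have "c > 0" using False by simp
  \<comment> \<open>The vertex of the parabola.\<close>
  then show ?thesis using assms[of "- b / c"]
    by (simp add: field_simps power2_eq_square)
qed

lemma Re_cinner_le: "(Re (cinner x y))\<^sup>2 \<le> (norm x)\<^sup>2 * (norm y)\<^sup>2"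
proof (rule discriminant_bound)
  fix t :: real
  have "0 \<le> (norm (x + t *\<^sub>R y))\<^sup>2" by simp
  then show "0 \<le> (norm x)\<^sup>2 + 2 * t * Re (cinner x y) + t\<^sup>2 * (norm y)\<^sup>2"
    by (simp add: norm_add_squared cinner_simps power_mult_distrib)
qed

lemma cnj_sgn_mult: "cnj (sgn z) * z = of_real (cmod z)"
  using complex_norm_square[of z]
  by (cases "z = 0") (simp_all add: sgn_div_norm scaleR_conv_of_real power2_eq_square field_simps)

lemma cauchy_schwarz: "cmod (cinner x y) \<le> norm x * norm y"
proof (cases "cinner x y = 0")
  case False
  \<comment> \<open>This phase rotates the inner product onto the nonnegative real axis, where the
    bound for real parts is the full bound.\<close>
  define u where "u = cnj (sgn (cinner x y))"
  have u: "cmod u = 1" using False by (simp add: u_def norm_sgn)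
  have "cinner x (u *\<^sub>C y) = of_real (cmod (cinner x y))"
    using False by (simp add: cinner_simps u_def complex_sgn_def sgn_div_norm
        complex_norm_square[symmetric] power2_eq_square scaleR_conv_of_real field_simps)
  then have "(cmod (cinner x y))\<^sup>2 \<le> (norm x * norm y)\<^sup>2"
    using Re_cinner_le[of x "u *\<^sub>C y"] u by (simp add: norm_scaleC power_mult_distrib)
  then show ?thesis by (simp add: power2_le_iff_abs_le)
qed simp

lemma bounded_linear_cinner_right: "bounded_linear (cinner x)"
  by (rule bounded_linear_intro[where K = "norm x"])
    (simp_all add: cinner_simps scaleR_conv_of_real cauchy_schwarz mult.commute[of "norm _" "norm x"])

lemma bounded_linear_cinner_left: "bounded_linear (\<lambda>x. cinner x y)"
  by (rule bounded_linear_intro[where K = "norm y"])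
    (simp_all add: cinner_simps scaleR_conv_of_real cauchy_schwarz)

lemmas continuous_on_cinner_left [continuous_intros] =
  bounded_linear.continuous_on[OF bounded_linear_cinner_left]
lemmas continuous_on_scaleC [continuous_intros] =
  bounded_linear.continuous_on[OF bounded_linear_scaleC]

lemma cinner_ext: "(\<And>z. cinner z x = cinner z y) \<Longrightarrow> x = y"
  by (metis cinner_diff_right cinner_eq_zero_iff right_minus_eq)

subsection \<open>Orthogonal projections and the Riesz representation\<close>

definition complex_subspace :: "'h::complex_inner set \<Rightarrow> bool" where
  "complex_subspace M \<longleftrightarrow> subspace M \<and> (\<forall>c. \<forall>x\<in>M. c *\<^sub>C x \<in> M)"

lemma closed_invariant_closure:
  assumes "continuous_on UNIV f" "f ` S \<subseteq> closure S"
  shows "f ` closure S \<subseteq> closure S"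
proof -
  have "closed (f -` closure S)"
    using assms(1) by (simp add: closed_vimage)
  then have "closure S \<subseteq> f -` closure S"
    using assms(2) by (intro closure_minimal) auto
  then show ?thesis by auto
qed

lemma subspace_closure:
  fixes S :: "'a::real_normed_vector set"
  assumes "subspace S" shows "subspace (closure S)"
  unfolding subspace_def
proof (intro conjI ballI allI)
  show "0 \<in> closure S" using assms closure_subset subspace_0 by blast
next
  fix x y assume "x \<in> closure S" "y \<in> closure S"
  then obtain s t where "\<And>n. s n \<in> S" "s \<longlonglongrightarrow> x" "\<And>n. t n \<in> S" "t \<longlonglongrightarrow> y"
    unfolding closure_sequential by blast
  then have "\<And>n. s n + t n \<in> S" "(\<lambda>n. s n + t n) \<longlonglongrightarrow> x + y"
    using assms by (auto intro: subspace_add tendsto_add)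
  then show "x + y \<in> closure S" unfolding closure_sequential by (intro exI[of _ "\<lambda>n. s n + t n"]) auto
next
  fix c :: real and x assume x: "x \<in> closure S"
  have "(\<lambda>x. c *\<^sub>R x) ` closure S \<subseteq> closure S"
    by (rule closed_invariant_closure)
      (use assms closure_subset[of S] in \<open>auto intro!: continuous_intros intro: subspace_scale\<close>)
  then show "c *\<^sub>R x \<in> closure S" using x by blast
qed

lemma complex_subspace_closure:
  assumes "complex_subspace M" shows "complex_subspace (closure M)"
proof -
  have "c *\<^sub>C x \<in> closure M" if "x \<in> closure M" for c x
  proof -
    have "(\<lambda>x. c *\<^sub>C x) ` closure M \<subseteq> closure M"
      by (rule closed_invariant_closure)
        (use assms closure_subset in \<open>auto simp: complex_subspace_def intro!: continuous_intros\<close>)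
    then show ?thesis using that by blast
  qed
  then show ?thesis
    using assms closed_subspace by (auto simp: complex_subspace_def subspace_closure)
qed

lemma closest_point_exists:
  fixes M :: "'h::complex_hilbert_space set"
  assumes "subspace M" "closed M"
  obtains y where "y \<in> M" "\<And>z. z \<in> M \<Longrightarrow> (norm (x - y))\<^sup>2 \<le> (norm (x - z))\<^sup>2"
proof -
  define S where "S = (\<lambda>z. (norm (x - z))\<^sup>2) ` M"
  have ne: "S \<noteq> {}" using subspace_0[OF assms(1)] by (auto simp: S_def)
  have bdd: "bdd_below S" by (auto simp: S_def intro!: bdd_belowI[of _ 0])
  define D where "D = Inf S"
  have D: "D \<le> (norm (x - z))\<^sup>2" if "z \<in> M" for z
    unfolding D_def by (rule cInf_lower) (use that bdd in \<open>auto simp: S_def\<close>)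
  have "\<exists>y. y \<in> M \<and> (norm (x - y))\<^sup>2 < D + inverse (Suc n)" for n
  proof -
    have "Inf S < D + inverse (Suc n)" by (simp add: D_def)
    from cInf_lessD[OF ne this] show ?thesis by (auto simp: S_def)
  qed
  then obtain y where y: "\<And>n. y n \<in> M" "\<And>n. (norm (x - y n))\<^sup>2 < D + inverse (Suc n)"
    using choice[of "\<lambda>n y. y \<in> M \<and> (norm (x - y))\<^sup>2 < D + inverse (Suc n)"] by blast
  \<comment> \<open>Parallelogram law: the midpoint of two near-minimizers lies in \<open>M\<close>,
    so its distance is at least the infimum, which leaves little room for their difference.\<close>
  have par: "(norm (y m - y n))\<^sup>2 \<le> 2 * inverse (Suc m) + 2 * inverse (Suc n)" for m n
  proof -
    let ?u = "x - y m" and ?v = "x - y n"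
    have mid: "(1/2) *\<^sub>R (y m + y n) \<in> M"
      using y assms(1) by (simp add: subspace_add subspace_scale)
    have *: "?u + ?v = 2 *\<^sub>R (x - (1/2) *\<^sub>R (y m + y n))" by (simp add: scaleR_diff_right scaleR_2)
    have "(norm (?u + ?v))\<^sup>2 = 4 * (norm (x - (1/2) *\<^sub>R (y m + y n)))\<^sup>2"
      unfolding * by (simp add: power_mult_distrib)
    then have "4 * D \<le> (norm (?u + ?v))\<^sup>2" using D[OF mid] by simp
    moreover have "(norm (?u + ?v))\<^sup>2 + (norm (?u - ?v))\<^sup>2 = 2 * (norm ?u)\<^sup>2 + 2 * (norm ?v)\<^sup>2"
      unfolding norm_add_squared[of ?u ?v] norm_diff_squared[of ?u ?v] by simp
    moreover have "norm (?u - ?v) = norm (y m - y n)"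
      using norm_minus_commute[of "y m" "y n"] by simp
    ultimately show ?thesis using y(2)[of m] y(2)[of n] by simp
  qed
  have "Cauchy y"
  proof (rule CauchyI)
    fix e :: real assume e: "0 < e"
    obtain N where N: "inverse (real (Suc N)) < e\<^sup>2 / 4"
      using reals_Archimedean[of "e\<^sup>2 / 4"] e by auto
    have "norm (y m - y n) < e" if "m \<ge> N" "n \<ge> N" for m n
    proof -
      have "inverse (real (Suc m)) \<le> inverse (real (Suc N))" "inverse (real (Suc n)) \<le> inverse (real (Suc N))"
        using that by auto
      then have "(norm (y m - y n))\<^sup>2 < e\<^sup>2" using par[of m n] N by linarith
      then show ?thesis using e by (simp add: power_less_imp_less_base)
    qed
    then show "\<exists>M. \<forall>m\<ge>M. \<forall>n\<ge>M. norm (y m - y n) < e" by blast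
  qed
  then obtain l where l: "y \<longlonglongrightarrow> l" unfolding Cauchy_convergent_iff convergent_def by blast
  show thesis
  proof
    show "l \<in> M" by (rule closed_sequentially[OF assms(2) y(1) l])
    fix z assume z: "z \<in> M"
    have "(\<lambda>n. (norm (x - y n))\<^sup>2) \<longlonglongrightarrow> (norm (x - l))\<^sup>2"
      by (intro tendsto_intros l)
    moreover have "(\<lambda>n. D + inverse (real (Suc n))) \<longlonglongrightarrow> D + 0"
      by (intro tendsto_intros LIMSEQ_inverse_real_of_nat)
    ultimately have "(norm (x - l))\<^sup>2 \<le> D + 0"
      by (rule LIMSEQ_le) (use y(2) in \<open>auto intro: less_imp_le\<close>)
    then show "(norm (x - l))\<^sup>2 \<le> (norm (x - z))\<^sup>2" using D[OF z] by linarith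
  qed
qed

lemma orthogonal_decomposition:
  fixes M :: "'h::complex_hilbert_space set"
  assumes "complex_subspace M" "closed M"
  shows "\<exists>!y. y \<in> M \<and> (\<forall>z\<in>M. cinner z (x - y) = 0)"
proof -
  have sub: "subspace M" using assms by (simp add: complex_subspace_def)
  obtain y where y: "y \<in> M" "\<And>z. z \<in> M \<Longrightarrow> (norm (x - y))\<^sup>2 \<le> (norm (x - z))\<^sup>2"
    using closest_point_exists[OF sub assms(2)] by blast
  have Re0: "Re (cinner z (x - y)) = 0" if "z \<in> M" for z
  proof -
    have "(Re (cinner (x - y) z))\<^sup>2 \<le> 0 * (norm z)\<^sup>2"
    proof (rule discriminant_bound)
      fix t :: real
      have "y - t *\<^sub>R z \<in> M" using that y sub by (simp add: subspace_diff subspace_scale)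
      from y(2)[OF this] have "(norm (x - y))\<^sup>2 \<le> (norm ((x - y) + t *\<^sub>R z))\<^sup>2"
        by (simp add: algebra_simps)
      then show "0 \<le> 0 + 2 * t * Re (cinner (x - y) z) + t\<^sup>2 * (norm z)\<^sup>2"
        by (simp add: norm_add_squared cinner_simps power_mult_distrib)
    qed
    then have "Re (cinner (x - y) z) = 0" by simp
    then show ?thesis by (simp add: Re_cinner_commute[of z])
  qed
  have orth: "cinner z (x - y) = 0" if "z \<in> M" for z
  proof -
    \<comment> \<open>Varying \<open>y\<close> along real multiples of \<open>z\<close> controls
      only real parts; the imaginary part is the real part for the vector multiplied by the
      imaginary unit.\<close>
    have "\<i> *\<^sub>C z \<in> M" using that assms by (simp add: complex_subspace_def)
    from Re0[OF this] have "Im (cinner z (x - y)) = 0" by (simp add: cinner_scaleC_left)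
    then show ?thesis using Re0[OF that] by (simp add: complex_eq_iff)
  qed
  show ?thesis
  proof (rule ex1I[of _ y])
    fix y' assume y': "y' \<in> M \<and> (\<forall>z\<in>M. cinner z (x - y') = 0)"
    have "y - y' \<in> M" using y y' sub by (simp add: subspace_diff)
    then have "cinner (y - y') ((x - y') - (x - y)) = 0"
      using orth y' by (simp only: cinner_diff_right) simp
    then show "y' = y" by simp
  qed (use y orth in auto)
qed

definition orthogonal_projection :: "'h::complex_hilbert_space set \<Rightarrow> 'h \<Rightarrow> 'h" where
  "orthogonal_projection M x = (THE y. y \<in> M \<and> (\<forall>z\<in>M. cinner z (x - y) = 0))"

context
  fixes M :: "'h::complex_hilbert_space set"
  assumes M: "complex_subspace M" "closed M"
begin

lemma orthogonal_projection_mem: "orthogonal_projection M x \<in> M"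
  and orthogonal_projection_orth: "z \<in> M \<Longrightarrow> cinner z (x - orthogonal_projection M x) = 0"
  using theI'[OF orthogonal_decomposition[OF M, of x]] by (auto simp: orthogonal_projection_def)

lemma orthogonal_projection_eqI:
  "y \<in> M \<Longrightarrow> (\<And>z. z \<in> M \<Longrightarrow> cinner z (x - y) = 0) \<Longrightarrow> orthogonal_projection M x = y"
  unfolding orthogonal_projection_def
  by (rule the1_equality[OF orthogonal_decomposition[OF M]]) auto

lemma orthogonal_projection_norm: "norm (orthogonal_projection M x) \<le> norm x"
proof -
  let ?p = "orthogonal_projection M x"
  have "(norm x)\<^sup>2 = (norm (?p + (x - ?p)))\<^sup>2" by simp
  also have "\<dots> = (norm ?p)\<^sup>2 + (norm (x - ?p))\<^sup>2"
    unfolding norm_add_squared using orthogonal_projection_orth[OF orthogonal_projection_mem, of x x] by simp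
  finally have "(norm ?p)\<^sup>2 \<le> (norm x)\<^sup>2" by simp
  then show ?thesis by (rule power2_le_imp_le) simp
qed

lemma orthogonal_projection_add:
  "orthogonal_projection M (x + y) = orthogonal_projection M x + orthogonal_projection M y"
proof (rule orthogonal_projection_eqI)
  show "orthogonal_projection M x + orthogonal_projection M y \<in> M"
    using M orthogonal_projection_mem by (auto simp: complex_subspace_def intro: subspace_add)
  fix z assume "z \<in> M"
  from orthogonal_projection_orth[OF this, of x] orthogonal_projection_orth[OF this, of y]
  show "cinner z (x + y - (orthogonal_projection M x + orthogonal_projection M y)) = 0"
    by (simp add: cinner_simps)
qed

lemma orthogonal_projection_scaleC:
  "orthogonal_projection M (c *\<^sub>C x) = c *\<^sub>C orthogonal_projection M x"
proof (rule orthogonal_projection_eqI)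
  show "c *\<^sub>C orthogonal_projection M x \<in> M"
    using M orthogonal_projection_mem by (auto simp: complex_subspace_def)
  fix z assume "z \<in> M"
  from orthogonal_projection_orth[OF this, of x]
  show "cinner z (c *\<^sub>C x - c *\<^sub>C orthogonal_projection M x) = 0"
    by (simp add: cinner_simps)
qed

lemma orthogonal_projection_ident: "x \<in> M \<Longrightarrow> orthogonal_projection M x = x"
  by (rule orthogonal_projection_eqI) auto

lemma bounded_linear_orthogonal_projection: "bounded_linear (orthogonal_projection M)"
proof (rule bounded_linear_intro[where K = 1])
  show "orthogonal_projection M (r *\<^sub>R x) = r *\<^sub>R orthogonal_projection M x" for r x
    by (metis orthogonal_projection_scaleC scaleC_of_real)
qed (simp_all add: orthogonal_projection_add orthogonal_projection_norm)

end

lemma riesz_representation: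
  fixes \<phi> :: "'h::complex_hilbert_space \<Rightarrow> complex"
  assumes "bounded_linear \<phi>" and hom: "\<And>c x. \<phi> (c *\<^sub>C x) = c * \<phi> x"
  obtains v where "\<And>x. \<phi> x = cinner v x"
proof (cases "\<forall>x. \<phi> x = 0")
  case True
  then show thesis by (intro that[of 0]) simp
next
  case False
  then obtain x where x: "\<phi> x \<noteq> 0" by blast
  interpret bounded_linear \<phi> by fact
  define M where "M = {x. \<phi> x = 0}"
  have cl: "closed M"
    unfolding M_def by (intro closed_Collect_eq continuous_intros continuous_on)
  have sub: "complex_subspace M"
    by (auto simp: M_def complex_subspace_def subspace_def hom zero add scale)
  define w where "w = x - orthogonal_projection M x"
  have \<phi>w: "\<phi> w = \<phi> x"
    using orthogonal_projection_mem[OF sub cl, of x] by (simp add: w_def diff M_def)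
  then have w0: "w \<noteq> 0" using x zero by auto
  \<comment> \<open>\<open>w\<close> is orthogonal to the kernel. The factor is conjugated because
    \<open>cinner\<close> is antilinear on the left, and normalised so that
    \<open>cinner v w = \<phi> w\<close>.\<close>
  define v where "v = (cnj (\<phi> w) / of_real ((norm w)\<^sup>2)) *\<^sub>C w"
  show thesis
  proof
    fix y
    define u where "u = y - (\<phi> y / \<phi> w) *\<^sub>C w"
    have "\<phi> u = 0" using x by (simp add: u_def diff hom \<phi>w)
    then have "cinner u w = 0"
      unfolding w_def using orthogonal_projection_orth[OF sub cl] by (simp add: M_def)
    then have "cinner w u = 0" using cinner_commute[of w u] by simp
    then have "cinner w y = (\<phi> y / \<phi> w) * of_real ((norm w)\<^sup>2)"
      by (simp add: u_def cinner_simps cinner_self)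
    then show "\<phi> y = cinner v y"
      using x w0 by (simp add: v_def cinner_simps \<phi>w)
  qed
qed

subsection \<open>Adjoints\<close>

lemma bounded_operators_scaleC: "A \<in> bounded_operators \<Longrightarrow> blinfun_apply A (c *\<^sub>C x) = c *\<^sub>C A x"
  by (simp add: bounded_operators_def)

lemma norm_adjoint_vector_le:
  assumes "\<And>y. cinner u y = cinner x (blinfun_apply A y)"
  shows "norm u \<le> norm A * norm x"
proof -
  have "(norm u)\<^sup>2 = cmod (cinner x (A u))"
    unfolding assms[symmetric] cinner_self norm_of_real by simp
  also have "\<dots> \<le> norm x * norm (A u)" by (rule cauchy_schwarz)
  also have "\<dots> \<le> norm x * (norm A * norm u)"
    by (intro mult_left_mono norm_blinfun) auto
  finally have "norm u * norm u \<le> (norm A * norm x) * norm u"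
    by (simp add: power2_eq_square algebra_simps)
  then show ?thesis
    by (cases "norm u = 0") (simp_all add: mult_le_cancel_right)
qed

text \<open>Backs the definite description in \<open>adj\<close>: for each \<open>x\<close> the
  value is the Riesz vector of \<open>\<lambda>y. cinner x (A y)\<close>, and testing against all
  vectors gives uniqueness.\<close>

lemma adj_ex1:
  fixes A :: "'h::complex_hilbert_space \<Rightarrow>\<^sub>L 'h"
  assumes A: "A \<in> bounded_operators"
  shows "\<exists>!B. B \<in> bounded_operators \<and> (\<forall>x y. cinner (blinfun_apply B x) y = cinner x (A y))"
proof -
  have "\<exists>v. \<forall>y. cinner x (A y) = cinner v y" for x
  proof (rule riesz_representation)
    show "bounded_linear (\<lambda>y. cinner x (A y))"
      by (intro bounded_linear_compose[OF bounded_linear_cinner_right] blinfun.bounded_linear_right)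
    show "cinner x (A (c *\<^sub>C y)) = c * cinner x (A y)" for c y
      by (simp add: bounded_operators_scaleC[OF A] cinner_scaleC_right)
  qed blast
  then obtain b where b: "\<And>x y. cinner (b x) y = cinner x (A y)" by metis
  have ext: "u = v" if "\<And>y. cinner u y = cinner v y" for u v :: 'h
    by (rule cinner_ext) (metis that cinner_commute)
  have bl: "bounded_linear b"
  proof (rule bounded_linear_intro[where K = "norm A"])
    show "b (x + y) = b x + b y" for x y by (rule ext) (simp add: cinner_simps b)
    show "b (r *\<^sub>R x) = r *\<^sub>R b x" for r x by (rule ext) (simp add: cinner_simps b)
    show "norm (b x) \<le> norm x * norm A" for x
      using norm_adjoint_vector_le[of "b x" x A] b by (simp add: mult.commute)
  qed
  show ?thesis
  proof (rule ex1I[of _ "Blinfun b"])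
    have "b (c *\<^sub>C x) = c *\<^sub>C b x" for c x by (rule ext) (simp add: cinner_simps b)
    then show "Blinfun b \<in> bounded_operators \<and> (\<forall>x y. cinner (Blinfun b x) y = cinner x (A y))"
      by (simp add: bounded_operators_def bounded_linear_Blinfun_apply[OF bl] b)
    show "B = Blinfun b"
      if "B \<in> bounded_operators \<and> (\<forall>x y. cinner (blinfun_apply B x) y = cinner x (A y))" for B
      by (rule blinfun_eqI, rule ext) (simp add: that bounded_linear_Blinfun_apply[OF bl] b)
  qed
qed

lemma adj_in: "A \<in> bounded_operators \<Longrightarrow> adj A \<in> bounded_operators"
  and adj_left: "A \<in> bounded_operators \<Longrightarrow> cinner (adj A x) y = cinner x (A y)"
  using theI'[OF adj_ex1] by (auto simp: adj_def)

lemma adj_right: "A \<in> bounded_operators \<Longrightarrow> cinner x (adj A y) = cinner (A x) y"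
  by (metis adj_left cinner_commute)

lemma adj_eqI:
  "A \<in> bounded_operators \<Longrightarrow> B \<in> bounded_operators \<Longrightarrow>
    (\<And>x y. cinner (blinfun_apply B x) y = cinner x (A y)) \<Longrightarrow> adj A = B"
  unfolding adj_def by (rule the1_equality[OF adj_ex1]) auto

section \<open>Algebraic operations on bounded operators\<close>

lemma zero_in_bounded_operators: "0 \<in> bounded_operators"
  and id_in_bounded_operators: "id_blinfun \<in> bounded_operators"
  by (simp_all add: bounded_operators_def blinfun.bilinear_simps)

lemma add_in_bounded_operators:
  "A \<in> bounded_operators \<Longrightarrow> B \<in> bounded_operators \<Longrightarrow> A + B \<in> bounded_operators"
  and diff_in_bounded_operators:
  "A \<in> bounded_operators \<Longrightarrow> B \<in> bounded_operators \<Longrightarrow> A - B \<in> bounded_operators"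
  and comp_in_bounded_operators:
  "A \<in> bounded_operators \<Longrightarrow> B \<in> bounded_operators \<Longrightarrow> A o\<^sub>L B \<in> bounded_operators"
  by (simp_all add: bounded_operators_def blinfun.bilinear_simps scaleC_add_right scaleC_diff_right)

lemma scale_op_apply [simp]: "blinfun_apply (scale_op c A) x = c *\<^sub>C A x"
proof -
  have "bounded_linear (\<lambda>x. c *\<^sub>C A x)"
    by (rule bounded_linear_compose[OF bounded_linear_scaleC blinfun.bounded_linear_right])
  then show ?thesis by (simp add: scale_op_def bounded_linear_Blinfun_apply)
qed

lemma scale_op_in_bounded_operators: "A \<in> bounded_operators \<Longrightarrow> scale_op c A \<in> bounded_operators"
  by (simp add: bounded_operators_def scaleC_scaleC mult.commute)

lemma scale_op_add: "scale_op c (A + B) = scale_op c A + scale_op c B"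
  and scale_op_scaleR: "scale_op c (r *\<^sub>R A) = r *\<^sub>R scale_op c A"
  and scale_op_of_real: "scale_op (of_real r) A = r *\<^sub>R A"
  and scale_op_scale_op: "scale_op c (scale_op d A) = scale_op (c * d) A"
  and scale_op_zero [simp]: "scale_op 0 A = 0" "scale_op c 0 = 0"
  and scale_op_one [simp]: "scale_op 1 A = A"
  and scale_op_comp_left: "scale_op c A o\<^sub>L B = scale_op c (A o\<^sub>L B)"
  by (rule blinfun_eqI; simp add: blinfun.bilinear_simps scaleC_add_right scaleC_scaleR
      scaleC_of_real scaleC_scaleC)+

lemma scale_op_comp_right: "A \<in> bounded_operators \<Longrightarrow> A o\<^sub>L scale_op c B = scale_op c (A o\<^sub>L B)"
  by (rule blinfun_eqI) (simp add: bounded_operators_scaleC)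

lemma norm_scale_op: "norm (scale_op c A) \<le> cmod c * norm A"
  by (rule norm_blinfun_bound)
    (simp_all add: norm_scaleC mult_left_mono norm_blinfun mult.assoc)

lemma bounded_linear_scale_op: "bounded_linear (scale_op c)"
  by (rule bounded_linear_intro[where K = "cmod c"])
    (simp_all add: scale_op_add scale_op_scaleR norm_scale_op mult.commute[of "norm _" "cmod c"])

lemma adj_adj: "A \<in> bounded_operators \<Longrightarrow> adj (adj A) = A"
  by (rule adj_eqI) (simp_all add: adj_in adj_right)

lemma adj_zero: "adj 0 = 0"
  by (rule adj_eqI) (simp_all add: zero_in_bounded_operators)

lemma adj_id: "adj id_blinfun = id_blinfun"
  by (rule adj_eqI) (simp_all add: id_in_bounded_operators)

lemma adj_add:
  "A \<in> bounded_operators \<Longrightarrow> B \<in> bounded_operators \<Longrightarrow> adj (A + B) = adj A + adj B"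
  by (rule adj_eqI)
    (simp_all add: add_in_bounded_operators adj_in blinfun.bilinear_simps cinner_simps adj_left)

lemma adj_scale_op: "A \<in> bounded_operators \<Longrightarrow> adj (scale_op c A) = scale_op (cnj c) (adj A)"
  by (rule adj_eqI) (simp_all add: scale_op_in_bounded_operators adj_in cinner_simps adj_left)

lemma adj_comp:
  "A \<in> bounded_operators \<Longrightarrow> B \<in> bounded_operators \<Longrightarrow> adj (A o\<^sub>L B) = adj B o\<^sub>L adj A"
  by (rule adj_eqI) (simp_all add: comp_in_bounded_operators adj_in adj_left)

lemma norm_adj_le: "A \<in> bounded_operators \<Longrightarrow> norm (adj A) \<le> norm A"
  by (rule norm_blinfun_bound) (simp_all add: norm_adjoint_vector_le adj_left)

lemma norm_adj: "A \<in> bounded_operators \<Longrightarrow> norm (adj A) = norm A"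
  by (metis adj_adj adj_in antisym norm_adj_le)

lemma closed_bounded_operators: "closed bounded_operators"
proof -
  have "bounded_operators = (\<Inter>c. \<Inter>x. {A :: 'a \<Rightarrow>\<^sub>L 'a. A (c *\<^sub>C x) = c *\<^sub>C A x})"
    by (auto simp: bounded_operators_def)
  also have "closed \<dots>"
  proof (intro closed_INT ballI)
    show "closed {A :: 'a \<Rightarrow>\<^sub>L 'a. A (c *\<^sub>C x) = c *\<^sub>C A x}" for c x
      by (intro closed_Collect_eq continuous_intros)
  qed
  finally show ?thesis .
qed

text \<open>Operators on the Fock space are prescribed only on the vectors \<open>J \<xi>\<close>,
  and \<open>J\<close> may have a kernel, so the data are a relation \<open>G\<close>; the norm
  bound makes it single-valued. Its closure is defined on the closure of the domain, and composing
  with the orthogonal projection extends it by 0 to the complement.\<close>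

lemma bounded_operator_extension:
  fixes G :: "('h::complex_hilbert_space \<times> 'h) set"
  assumes sub: "subspace G"
    and cG: "\<And>c x y. (x, y) \<in> G \<Longrightarrow> (c *\<^sub>C x, c *\<^sub>C y) \<in> G"
    and bound: "\<And>x y. (x, y) \<in> G \<Longrightarrow> norm y \<le> C * norm x" and "0 \<le> C"
  shows "\<exists>A\<in>bounded_operators. (\<forall>(x, y)\<in>G. blinfun_apply A x = y) \<and>
    (\<forall>z. (\<forall>x\<in>fst ` G. cinner x z = 0) \<longrightarrow> A z = 0)"
proof -
  define M where "M = closure (fst ` G)"
  have "complex_subspace (fst ` G)"
    unfolding complex_subspace_def
  proof (intro conjI allI ballI)
    show "subspace (fst ` G)" by (rule linear_subspace_image[OF linear_fst sub])
    show "c *\<^sub>C x \<in> fst ` G" if "x \<in> fst ` G" for c x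
    proof -
      obtain y where "(x, y) \<in> G" using \<open>x \<in> fst ` G\<close> by auto
      from cG[OF this, of c] show ?thesis by (rule image_eqI[rotated]) simp
    qed
  qed
  then have M: "complex_subspace M" "closed M"
    by (simp_all add: M_def complex_subspace_closure)
  let ?p = "orthogonal_projection M" and ?G = "closure G"
  have subG: "subspace ?G" by (simp add: sub subspace_closure)
  have cG': "(c *\<^sub>C x, c *\<^sub>C y) \<in> ?G" if "(x, y) \<in> ?G" for c x y
  proof -
    have "(\<lambda>p. (c *\<^sub>C fst p, c *\<^sub>C snd p)) ` ?G \<subseteq> ?G"
      by (rule closed_invariant_closure)
        (use cG closure_subset[of G] in \<open>auto intro!: continuous_intros\<close>)
    from subsetD[OF this imageI[OF that]] show ?thesis by simp
  qed
  have bound': "norm y \<le> C * norm x" if "(x, y) \<in> ?G" for x y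
  proof -
    have "closed {p :: 'h \<times> 'h. norm (snd p) \<le> C * norm (fst p)}"
      by (intro closed_Collect_le continuous_intros)
    then have "?G \<subseteq> {p. norm (snd p) \<le> C * norm (fst p)}"
      using bound by (intro closure_minimal) auto
    then show ?thesis using that by auto
  qed
  \<comment> \<open>The bound applied to the pair \<open>(0, y - y')\<close>.\<close>
  have uniq: "y = y'" if "(x, y) \<in> ?G" "(x, y') \<in> ?G" for x y y'
    using bound'[of 0 "y - y'"] subspace_diff[OF subG that] by simp
  have ex: "\<exists>y. (x, y) \<in> ?G" if "x \<in> M" for x
  proof -
    have "\<exists>s. (\<forall>n. s n \<in> fst ` G) \<and> s \<longlonglongrightarrow> x"
      using that by (simp only: M_def closure_sequential)
    then obtain s where s: "\<forall>n. s n \<in> fst ` G" "s \<longlonglongrightarrow> x"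
      by blast
    then have "\<forall>n. \<exists>y. (s n, y) \<in> G" by force
    then obtain t where t: "\<And>n. (s n, t n) \<in> G" by metis
    have st: "norm (t m - t n) \<le> C * norm (s m - s n)" for m n
      using bound[of "s m - s n" "t m - t n"] subspace_diff[OF sub t t, of m n] by simp
    have "Cauchy t"
    proof (rule CauchyI)
      fix e :: real assume e: "0 < e"
      \<comment> \<open>\<open>C + 1\<close> avoids division by 0 when \<open>C = 0\<close>.\<close>
      have "0 < e / (C + 1)" using e \<open>0 \<le> C\<close> by simp
      then obtain N where N: "\<And>m n. m \<ge> N \<Longrightarrow> n \<ge> N \<Longrightarrow> norm (s m - s n) < e / (C + 1)"
        using s(2) LIMSEQ_imp_Cauchy CauchyD by meson
      have "norm (t m - t n) < e" if "m \<ge> N" "n \<ge> N" for m n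
      proof -
        have "norm (t m - t n) \<le> (C + 1) * norm (s m - s n)"
          by (rule order_trans[OF st mult_right_mono]) simp_all
        also have "\<dots> < e" using N[OF that] \<open>0 \<le> C\<close> by (simp add: field_simps)
        finally show ?thesis .
      qed
      then show "\<exists>M. \<forall>m\<ge>M. \<forall>n\<ge>M. norm (t m - t n) < e" by blast
    qed
    then obtain y where "t \<longlonglongrightarrow> y" unfolding Cauchy_convergent_iff convergent_def by blast
    then have "(\<lambda>n. (s n, t n)) \<longlonglongrightarrow> (x, y)" using s(2) tendsto_Pair by blast
    then have "(x, y) \<in> ?G" using t unfolding closure_sequential by (intro exI[of _ "\<lambda>n. (s n, t n)"]) auto
    then show ?thesis by blast
  qed
  have "\<exists>y. (?p x, y) \<in> ?G" for x by (rule ex) (rule orthogonal_projection_mem[OF M])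
  then obtain a where a: "\<And>x. (?p x, a x) \<in> ?G" by metis
  have a_bound: "norm (a x) \<le> C * norm x" for x
    using bound'[OF a, of x] orthogonal_projection_norm[OF M, of x] \<open>0 \<le> C\<close>
    by (meson mult_left_mono order_trans)
  have ac: "a (c *\<^sub>C x) = c *\<^sub>C a x" for c x
    by (rule uniq[OF a]) (simp add: orthogonal_projection_scaleC[OF M] cG' a)
  have bl: "bounded_linear a"
  proof (rule bounded_linear_intro[where K = C])
    show "a (x + y) = a x + a y" for x y
      by (rule uniq[OF a]) (use subspace_add[OF subG a a, of x y] in
          \<open>simp add: orthogonal_projection_add[OF M]\<close>)
    show "a (r *\<^sub>R x) = r *\<^sub>R a x" for r x using ac[of "of_real r" x] by (simp add: scaleC_of_real)
    show "norm (a x) \<le> norm x * C" for x using a_bound[of x] by (simp add: mult.commute)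
  qed
  note [simp] = bounded_linear_Blinfun_apply[OF bl]
  show ?thesis
  proof (intro bexI[of _ "Blinfun a"] conjI allI impI ballI)
    show "Blinfun a \<in> bounded_operators" by (simp add: bounded_operators_def ac)
    have "Blinfun a x = y" if "(x, y) \<in> G" for x y
    proof -
      have "x \<in> M" using that closure_subset[of "fst ` G"] unfolding M_def
        by (metis fst_conv imageI subsetD)
      then have "(x, a x) \<in> ?G" using a[of x] by (simp add: orthogonal_projection_ident[OF M])
      then have "a x = y" using uniq subsetD[OF closure_subset that] by blast
      then show ?thesis by simp
    qed
    then show "case p of (x, y) \<Rightarrow> Blinfun a x = y" if "p \<in> G" for p
      using that by auto
    show "Blinfun a z = 0" if z: "\<forall>x\<in>fst ` G. cinner x z = 0" for z
    proof -
      have "closed {x. cinner x z = 0}" by (intro closed_Collect_eq continuous_intros)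
      then have "M \<subseteq> {x. cinner x z = 0}"
        unfolding M_def using z by (intro closure_minimal) auto
      then have "?p z = 0"
        using M by (intro orthogonal_projection_eqI) (auto simp: complex_subspace_def subspace_0)
      then have "(0, a z) \<in> ?G" using a[of z] by simp
      from bound'[OF this] show ?thesis by simp
    qed
  qed
qed

section \<open>Square-summable tensors\<close>

text \<open>Tensors form sets of functions without a norm of their own; every estimate is stated for
  this squared l2 norm, so constants are squares of the usual operator bounds.\<close>

definition norm_sq :: "tensor \<Rightarrow> real" where
  "norm_sq \<xi> = (\<Sum>\<^sub>\<infinity>xs. (cmod (\<xi> xs))\<^sup>2)"

definition head_slice :: "int \<Rightarrow> tensor \<Rightarrow> tensor" where
  "head_slice i \<xi> = (\<lambda>ys. \<xi> (i # ys))"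

lemma tensor_power_supp: "\<xi> \<in> tensor_power n \<Longrightarrow> length xs \<noteq> n \<Longrightarrow> \<xi> xs = 0"
  and tensor_power_summable: "\<xi> \<in> tensor_power n \<Longrightarrow> (\<lambda>xs. (cmod (\<xi> xs))\<^sup>2) summable_on UNIV"
  by (auto simp: tensor_power_def)

lemma tensor_powerI:
  "(\<And>xs. length xs \<noteq> n \<Longrightarrow> \<xi> xs = 0) \<Longrightarrow> (\<lambda>xs. (cmod (\<xi> xs))\<^sup>2) summable_on UNIV \<Longrightarrow>
    \<xi> \<in> tensor_power n"
  by (auto simp: tensor_power_def)

lemma norm_sq_nonneg: "0 \<le> norm_sq \<xi>"
  unfolding norm_sq_def by (rule infsum_nonneg) simp

lemma cmod_add_squared_le: "(cmod (a + b))\<^sup>2 \<le> 2 * (cmod a)\<^sup>2 + 2 * (cmod b)\<^sup>2"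
proof -
  have "(cmod (a + b))\<^sup>2 \<le> (cmod a + cmod b)\<^sup>2" by (simp add: norm_triangle_ineq power_mono)
  also have "\<dots> \<le> 2 * (cmod a)\<^sup>2 + 2 * (cmod b)\<^sup>2"
    using zero_le_power2[of "cmod a - cmod b"] by (simp add: power2_sum power2_diff)
  finally show ?thesis .
qed

text \<open>Arithmetic-geometric mean in place of Cauchy-Schwarz: it gives both summability of the
  inner product series and the crude bound \<open>tensor_inner_le\<close> on which the later growth
  estimates rest.\<close>

lemma cmod_mult_le: "cmod (cnj a * b) \<le> (cmod a)\<^sup>2 / 2 + (cmod b)\<^sup>2 / 2"
  using zero_le_power2[of "cmod a - cmod b"] by (simp add: norm_mult power2_diff)

lemma tensor_power_zero: "(\<lambda>_. 0) \<in> tensor_power n"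
  by (simp add: tensor_power_def)

lemma
  assumes "\<xi> \<in> tensor_power n" "\<eta> \<in> tensor_power n"
  shows tensor_power_add: "(\<lambda>xs. \<xi> xs + \<eta> xs) \<in> tensor_power n"
    and norm_sq_add: "norm_sq (\<lambda>xs. \<xi> xs + \<eta> xs) \<le> 2 * norm_sq \<xi> + 2 * norm_sq \<eta>"
proof -
  note sm = tensor_power_summable[OF assms(1)] tensor_power_summable[OF assms(2)]
  have s: "(\<lambda>xs. 2 * (cmod (\<xi> xs))\<^sup>2 + 2 * (cmod (\<eta> xs))\<^sup>2) summable_on UNIV"
    by (intro summable_on_add summable_on_cmult_right sm)
  have s': "(\<lambda>xs. (cmod (\<xi> xs + \<eta> xs))\<^sup>2) summable_on UNIV"
    by (rule summable_on_comparison_test[OF s]) (simp_all add: cmod_add_squared_le)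
  show "(\<lambda>xs. \<xi> xs + \<eta> xs) \<in> tensor_power n"
    using assms s' by (auto simp: tensor_power_def)
  have "norm_sq (\<lambda>xs. \<xi> xs + \<eta> xs) \<le> (\<Sum>\<^sub>\<infinity>xs. 2 * (cmod (\<xi> xs))\<^sup>2 + 2 * (cmod (\<eta> xs))\<^sup>2)"
    unfolding norm_sq_def by (rule infsum_mono[OF s' s]) (rule cmod_add_squared_le)
  also have "\<dots> = 2 * norm_sq \<xi> + 2 * norm_sq \<eta>"
    unfolding norm_sq_def by (simp add: infsum_add infsum_cmult_right sm summable_on_cmult_right)
  finally show "norm_sq (\<lambda>xs. \<xi> xs + \<eta> xs) \<le> 2 * norm_sq \<xi> + 2 * norm_sq \<eta>" .
qed

lemma
  shows tensor_power_scale: "\<xi> \<in> tensor_power n \<Longrightarrow> (\<lambda>xs. c * \<xi> xs) \<in> tensor_power n"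
    and norm_sq_scale: "norm_sq (\<lambda>xs. c * \<xi> xs) = (cmod c)\<^sup>2 * norm_sq \<xi>"
  by (auto simp: tensor_power_def norm_sq_def norm_mult power_mult_distrib infsum_cmult_right'
      intro: summable_on_cmult_right)

lemma tensor_power_sum:
  "(\<And>i. i \<in> I \<Longrightarrow> \<xi> i \<in> tensor_power n) \<Longrightarrow> (\<lambda>xs. \<Sum>i\<in>I. \<xi> i xs) \<in> tensor_power n"
  by (induction I rule: infinite_finite_induct) (auto simp: tensor_power_zero intro: tensor_power_add)

lemma tensor_inner_summable:
  assumes "\<xi> \<in> tensor_power m" "\<eta> \<in> tensor_power n"
  shows "(\<lambda>xs. cnj (\<xi> xs) * \<eta> xs) summable_on UNIV"
    and "(\<lambda>xs. cmod (cnj (\<xi> xs) * \<eta> xs)) summable_on UNIV"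
proof -
  have "(\<lambda>xs. (cmod (\<xi> xs))\<^sup>2 / 2 + (cmod (\<eta> xs))\<^sup>2 / 2) summable_on UNIV"
    unfolding divide_inverse
    by (intro summable_on_add summable_on_cmult_left tensor_power_summable[OF assms(1)]
        tensor_power_summable[OF assms(2)])
  then show "(\<lambda>xs. cmod (cnj (\<xi> xs) * \<eta> xs)) summable_on UNIV"
    by (rule Infinite_Sum.abs_summable_on_comparison_test') (rule cmod_mult_le)
  then show "(\<lambda>xs. cnj (\<xi> xs) * \<eta> xs) summable_on UNIV"
    by (rule abs_summable_summable)
qed

lemma tensor_inner_add_right:
  "\<xi> \<in> tensor_power n \<Longrightarrow> \<eta> \<in> tensor_power n \<Longrightarrow> \<zeta> \<in> tensor_power n \<Longrightarrow>
    tensor_inner \<xi> (\<lambda>xs. \<eta> xs + \<zeta> xs) = tensor_inner \<xi> \<eta> + tensor_inner \<xi> \<zeta>"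
  unfolding tensor_inner_def distrib_left by (rule infsum_add; rule tensor_inner_summable)

lemma tensor_inner_add_left:
  "\<xi> \<in> tensor_power n \<Longrightarrow> \<eta> \<in> tensor_power n \<Longrightarrow> \<zeta> \<in> tensor_power n \<Longrightarrow>
    tensor_inner (\<lambda>xs. \<eta> xs + \<zeta> xs) \<xi> = tensor_inner \<eta> \<xi> + tensor_inner \<zeta> \<xi>"
  unfolding tensor_inner_def complex_cnj_add distrib_right
  by (rule infsum_add; rule tensor_inner_summable)

lemma tensor_inner_scale_right: "tensor_inner \<xi> (\<lambda>xs. c * \<eta> xs) = c * tensor_inner \<xi> \<eta>"
  unfolding tensor_inner_def mult.left_commute[of _ c] by (rule infsum_cmult_right')

lemma tensor_inner_scale_left: "tensor_inner (\<lambda>xs. c * \<xi> xs) \<eta> = cnj c * tensor_inner \<xi> \<eta>"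
  unfolding tensor_inner_def complex_cnj_mult mult.assoc by (rule infsum_cmult_right')

lemma tensor_inner_commute: "tensor_inner \<xi> \<eta> = cnj (tensor_inner \<eta> \<xi>)"
  unfolding tensor_inner_def infsum_cnj[symmetric] by (simp add: mult.commute)

lemma tensor_inner_zero [simp]: "tensor_inner (\<lambda>_. 0) \<xi> = 0" "tensor_inner \<xi> (\<lambda>_. 0) = 0"
  by (simp_all add: tensor_inner_def)

lemma tensor_inner_self:
  assumes "\<xi> \<in> tensor_power n" shows "tensor_inner \<xi> \<xi> = of_real (norm_sq \<xi>)"
proof -
  have "tensor_inner \<xi> \<xi> = (\<Sum>\<^sub>\<infinity>xs. of_real ((cmod (\<xi> xs))\<^sup>2))"
    unfolding tensor_inner_def by (simp only: complex_norm_square mult.commute)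
  also have "\<dots> = of_real (norm_sq \<xi>)"
    unfolding norm_sq_def
    by (intro infsumI has_sum_of_real has_sum_infsum tensor_power_summable[OF assms])
  finally show ?thesis .
qed

lemma tensor_inner_le:
  assumes "\<xi> \<in> tensor_power m" "\<eta> \<in> tensor_power n"
  shows "cmod (tensor_inner \<xi> \<eta>) \<le> norm_sq \<xi> / 2 + norm_sq \<eta> / 2"
proof -
  note sm = tensor_power_summable[OF assms(1)] tensor_power_summable[OF assms(2)]
  have s: "(\<lambda>xs. (cmod (\<xi> xs))\<^sup>2 / 2) summable_on UNIV" "(\<lambda>xs. (cmod (\<eta> xs))\<^sup>2 / 2) summable_on UNIV"
    unfolding divide_inverse by (intro summable_on_cmult_left sm)+
  have "cmod (tensor_inner \<xi> \<eta>) \<le> (\<Sum>\<^sub>\<infinity>xs. cmod (cnj (\<xi> xs) * \<eta> xs))"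
    unfolding tensor_inner_def by (rule norm_infsum_bound[OF tensor_inner_summable(2)[OF assms]])
  also have "\<dots> \<le> (\<Sum>\<^sub>\<infinity>xs. (cmod (\<xi> xs))\<^sup>2 / 2 + (cmod (\<eta> xs))\<^sup>2 / 2)"
    by (rule infsum_mono[OF tensor_inner_summable(2)[OF assms] summable_on_add[OF s]]) (rule cmod_mult_le)
  also have "\<dots> = norm_sq \<xi> / 2 + norm_sq \<eta> / 2"
    unfolding infsum_add[OF s] norm_sq_def by (simp only: divide_inverse infsum_cmult_left')
  finally show ?thesis .
qed

lemma basis_in_tensor_power: "basis xs \<in> tensor_power (length xs)"
proof (rule tensor_powerI)
  have "finite {ys \<in> UNIV. (cmod (basis xs ys))\<^sup>2 \<noteq> 0}"
    by (rule finite_subset[of _ "{xs}"]) (auto simp: basis_def split: if_splits)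
  from finite_nonzero_values_imp_summable_on[OF this]
  show "(\<lambda>ys. (cmod (basis xs ys))\<^sup>2) summable_on UNIV" .
qed (auto simp: basis_def)

lemma tensor_inner_basis: "tensor_inner (basis xs) \<xi> = \<xi> xs"
proof -
  have "tensor_inner (basis xs) \<xi> = (\<Sum>\<^sub>\<infinity>ys\<in>{xs}. \<xi> ys)"
    unfolding tensor_inner_def by (rule infsum_cong_neutral) (auto simp: basis_def)
  then show ?thesis by simp
qed

subsection \<open>Slices\<close>

text \<open>Fubini for a sum cut into slices: the first argument of \<open>\<phi>\<close> is frozen,
  the second runs through the slice. The instances cut a list after its first letter or after its
  first two.\<close>

lemma infsum_slices:
  fixes F :: "'a \<Rightarrow> 'b::banach"
  assumes F: "F summable_on UNIV" and inj: "inj_on \<phi> (I \<times> K)"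
    and out: "\<And>x. x \<notin> \<phi> ` (I \<times> K) \<Longrightarrow> F x = 0"
  shows "i \<in> I \<Longrightarrow> (\<lambda>k. F (\<phi> (i, k))) summable_on K"
    and "(\<lambda>i. \<Sum>\<^sub>\<infinity>k\<in>K. F (\<phi> (i, k))) summable_on I"
    and "infsum F UNIV = (\<Sum>\<^sub>\<infinity>i\<in>I. \<Sum>\<^sub>\<infinity>k\<in>K. F (\<phi> (i, k)))"
proof -
  have "F summable_on \<phi> ` (I \<times> K)" using F summable_on_subset_banach by blast
  then have s: "(F \<circ> \<phi>) summable_on (I \<times> K)" by (simp add: summable_on_reindex[OF inj])
  then have s': "(\<lambda>(i, k). F (\<phi> (i, k))) summable_on (I \<times> K)" by (simp add: o_def case_prod_unfold)
  show "(\<lambda>k. F (\<phi> (i, k))) summable_on K" if "i \<in> I"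
  proof -
    have "inj_on (\<lambda>k. \<phi> (i, k)) K" using inj that by (auto simp: inj_on_def)
    from summable_on_reindex[OF this, of F] show ?thesis
      using F summable_on_subset_banach by (auto simp: o_def)
  qed
  show "(\<lambda>i. \<Sum>\<^sub>\<infinity>k\<in>K. F (\<phi> (i, k))) summable_on I"
    using summable_on_Sigma_banach[OF s'] by simp
  have "infsum F UNIV = infsum F (\<phi> ` (I \<times> K))"
    by (rule infsum_cong_neutral) (auto intro: out)
  also have "\<dots> = infsum (F \<circ> \<phi>) (I \<times> K)" by (rule infsum_reindex[OF inj])
  also have "\<dots> = (\<Sum>\<^sub>\<infinity>i\<in>I. \<Sum>\<^sub>\<infinity>k\<in>K. F (\<phi> (i, k)))"
    using infsum_Sigma_banach[OF s] by (simp add: o_def)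
  finally show "infsum F UNIV = (\<Sum>\<^sub>\<infinity>i\<in>I. \<Sum>\<^sub>\<infinity>k\<in>K. F (\<phi> (i, k)))" .
qed

text \<open>Tonelli, the converse direction: nonnegativity lets summability be assembled from the
  slices.\<close>

lemma summable_from_slices:
  fixes F :: "'a \<Rightarrow> real"
  assumes nn: "\<And>x. 0 \<le> F x" and inj: "inj_on \<phi> (I \<times> K)"
    and out: "\<And>x. x \<notin> \<phi> ` (I \<times> K) \<Longrightarrow> F x = 0"
    and sl: "\<And>i. i \<in> I \<Longrightarrow> (\<lambda>k. F (\<phi> (i, k))) summable_on K"
    and le: "\<And>i. i \<in> I \<Longrightarrow> (\<Sum>\<^sub>\<infinity>k\<in>K. F (\<phi> (i, k))) \<le> g i" and g: "g summable_on I"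
  shows "F summable_on UNIV" and "infsum F UNIV \<le> infsum g I"
proof -
  have s: "(\<lambda>i. \<Sum>\<^sub>\<infinity>k\<in>K. F (\<phi> (i, k))) summable_on I"
    by (rule summable_on_comparison_test[OF g le]) (auto intro: infsum_nonneg nn)
  have "(F \<circ> \<phi>) summable_on (I \<times> K)"
    by (rule summable_on_SigmaI[OF _ s]) (auto intro!: has_sum_infsum sl nn)
  then have "F summable_on (\<phi> ` (I \<times> K))" by (simp add: summable_on_reindex[OF inj])
  moreover have "F summable_on (\<phi> ` (I \<times> K)) \<longleftrightarrow> F summable_on UNIV"
    by (rule summable_on_cong_neutral) (auto intro: out)
  ultimately show F: "F summable_on UNIV" by simp
  have "infsum F UNIV = (\<Sum>\<^sub>\<infinity>i\<in>I. \<Sum>\<^sub>\<infinity>k\<in>K. F (\<phi> (i, k)))"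
    by (rule infsum_slices(3)[OF F inj out])
  also have "\<dots> \<le> infsum g I" by (rule infsum_mono[OF s g le])
  finally show "infsum F UNIV \<le> infsum g I" .
qed

text \<open>For an operator acting inside each slice, a bound uniform in the slice is a bound for
  the whole; this produces the boundedness of I \<otimes> A and of T_1.\<close>

lemma norm_sq_from_slices:
  assumes \<xi>: "\<xi> \<in> tensor_power m" and inj: "inj_on \<phi> (I \<times> K)"
    and out: "\<And>x. x \<notin> \<phi> ` (I \<times> K) \<Longrightarrow> \<xi> x = 0" "\<And>x. x \<notin> \<phi> ` (I \<times> K) \<Longrightarrow> \<eta> x = 0"
    and sl: "\<And>i. i \<in> I \<Longrightarrow> (\<lambda>k. (cmod (\<eta> (\<phi> (i, k))))\<^sup>2) summable_on K"
    and le: "\<And>i. i \<in> I \<Longrightarrow>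
      (\<Sum>\<^sub>\<infinity>k\<in>K. (cmod (\<eta> (\<phi> (i, k))))\<^sup>2) \<le> C * (\<Sum>\<^sub>\<infinity>k\<in>K. (cmod (\<xi> (\<phi> (i, k))))\<^sup>2)"
  shows "(\<lambda>xs. (cmod (\<eta> xs))\<^sup>2) summable_on UNIV" and "norm_sq \<eta> \<le> C * norm_sq \<xi>"
proof -
  have o: "\<And>x. x \<notin> \<phi> ` (I \<times> K) \<Longrightarrow> (cmod (\<xi> x))\<^sup>2 = 0" using out(1) by simp
  have o': "\<And>x. x \<notin> \<phi> ` (I \<times> K) \<Longrightarrow> (cmod (\<eta> x))\<^sup>2 = 0" using out(2) by simp
  note sx = infsum_slices[OF tensor_power_summable[OF \<xi>] inj o, simplified]
  have s: "(\<lambda>i. C * (\<Sum>\<^sub>\<infinity>k\<in>K. (cmod (\<xi> (\<phi> (i, k))))\<^sup>2)) summable_on I"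
    by (intro summable_on_cmult_right sx(2))
  note r = summable_from_slices[where F = "\<lambda>xs. (cmod (\<eta> xs))\<^sup>2", OF _ inj o' sl le s, simplified]
  show "(\<lambda>xs. (cmod (\<eta> xs))\<^sup>2) summable_on UNIV" by (rule r(1))
  have "norm_sq \<eta> \<le> (\<Sum>\<^sub>\<infinity>i\<in>I. C * (\<Sum>\<^sub>\<infinity>k\<in>K. (cmod (\<xi> (\<phi> (i, k))))\<^sup>2))"
    unfolding norm_sq_def by (rule r(2))
  also have "\<dots> = C * norm_sq \<xi>"
    unfolding norm_sq_def sx(3) by (rule infsum_cmult_right')
  finally show "norm_sq \<eta> \<le> C * norm_sq \<xi>" .
qed

lemma inj_cons: "inj_on (\<lambda>(i, ys). i # ys) (UNIV \<times> UNIV)"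
  by (auto simp: inj_on_def)

lemma not_cons: "x \<notin> (\<lambda>(i, ys). i # ys) ` (UNIV \<times> UNIV) \<Longrightarrow> x = []"
  by (cases x) auto

lemma head_slice_in:
  assumes "\<xi> \<in> tensor_power (Suc n)" shows "head_slice i \<xi> \<in> tensor_power n"
proof (rule tensor_powerI)
  show "head_slice i \<xi> xs = 0" if "length xs \<noteq> n" for xs
    using tensor_power_supp[OF assms] that by (simp add: head_slice_def)
  have "x \<notin> (\<lambda>(i, ys). i # ys) ` (UNIV \<times> UNIV) \<Longrightarrow> (cmod (\<xi> x))\<^sup>2 = 0" for x
    using not_cons[of x] tensor_power_supp[OF assms, of x] by simp
  from infsum_slices(1)[OF tensor_power_summable[OF assms] inj_cons this, of i]
  show "(\<lambda>xs. (cmod (head_slice i \<xi> xs))\<^sup>2) summable_on UNIV"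
    by (simp add: head_slice_def)
qed

lemma tensor_inner_head_slices:
  assumes "\<xi> \<in> tensor_power (Suc m)" "\<eta> \<in> tensor_power n"
  shows "tensor_inner \<xi> \<eta> = (\<Sum>\<^sub>\<infinity>i. tensor_inner (head_slice i \<xi>) (head_slice i \<eta>))"
    and "(\<lambda>i. tensor_inner (head_slice i \<xi>) (head_slice i \<eta>)) summable_on UNIV"
proof -
  have o: "x \<notin> (\<lambda>(i, ys). i # ys) ` (UNIV \<times> UNIV) \<Longrightarrow> cnj (\<xi> x) * \<eta> x = 0" for x
    using not_cons[of x] tensor_power_supp[OF assms(1), of x] by simp
  note r = infsum_slices[OF tensor_inner_summable(1)[OF assms] inj_cons o]
  show "tensor_inner \<xi> \<eta> = (\<Sum>\<^sub>\<infinity>i. tensor_inner (head_slice i \<xi>) (head_slice i \<eta>))"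
    using r(3) by (simp add: tensor_inner_def head_slice_def)
  show "(\<lambda>i. tensor_inner (head_slice i \<xi>) (head_slice i \<eta>)) summable_on UNIV"
    using r(2) by (simp add: tensor_inner_def head_slice_def)
qed

subsection \<open>Bounded operators on tensor powers\<close>

definition tensor_bounded :: "nat \<Rightarrow> (tensor \<Rightarrow> tensor) \<Rightarrow> bool" where
  "tensor_bounded n A \<longleftrightarrow>
     (\<forall>\<xi>\<in>tensor_power n. A \<xi> \<in> tensor_power n) \<and>
     (\<forall>\<xi>\<in>tensor_power n. \<forall>\<eta>\<in>tensor_power n. A (\<lambda>xs. \<xi> xs + \<eta> xs) = (\<lambda>xs. A \<xi> xs + A \<eta> xs)) \<and>
     (\<forall>\<xi>\<in>tensor_power n. \<forall>c. A (\<lambda>xs. c * \<xi> xs) = (\<lambda>xs. c * A \<xi> xs)) \<and>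
     (\<exists>C\<ge>0. \<forall>\<xi>\<in>tensor_power n. norm_sq (A \<xi>) \<le> C * norm_sq \<xi>)"

lemma tensor_boundedD:
  assumes "tensor_bounded n A"
  shows "\<xi> \<in> tensor_power n \<Longrightarrow> A \<xi> \<in> tensor_power n"
    and "\<xi> \<in> tensor_power n \<Longrightarrow> \<eta> \<in> tensor_power n \<Longrightarrow> A (\<lambda>xs. \<xi> xs + \<eta> xs) = (\<lambda>xs. A \<xi> xs + A \<eta> xs)"
    and "\<xi> \<in> tensor_power n \<Longrightarrow> A (\<lambda>xs. c * \<xi> xs) = (\<lambda>xs. c * A \<xi> xs)"
    and "\<exists>C\<ge>0. \<forall>\<xi>\<in>tensor_power n. norm_sq (A \<xi>) \<le> C * norm_sq \<xi>"
    and "A (\<lambda>_. 0) = (\<lambda>_. 0)"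
proof -
  show z: "\<xi> \<in> tensor_power n \<Longrightarrow> A (\<lambda>xs. c * \<xi> xs) = (\<lambda>xs. c * A \<xi> xs)" for \<xi> c
    using assms by (simp add: tensor_bounded_def)
  show "A (\<lambda>_. 0) = (\<lambda>_. 0)"
    using z[OF tensor_power_zero, of 0] by simp
qed (use assms in \<open>simp_all add: tensor_bounded_def\<close>)

lemma tensor_bounded_sum:
  assumes "tensor_bounded n A" "\<And>i. i \<in> I \<Longrightarrow> \<xi> i \<in> tensor_power n"
  shows "A (\<lambda>xs. \<Sum>i\<in>I. \<xi> i xs) = (\<lambda>xs. \<Sum>i\<in>I. A (\<xi> i) xs)"
  using assms(2)
proof (induction I rule: infinite_finite_induct)
  case (insert i I)
  then have "A (\<lambda>xs. \<xi> i xs + (\<Sum>i\<in>I. \<xi> i xs)) = (\<lambda>xs. A (\<xi> i) xs + A (\<lambda>xs. \<Sum>i\<in>I. \<xi> i xs) xs)"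
    by (intro tensor_boundedD(2)[OF assms(1)] tensor_power_sum) auto
  then show ?case using insert by simp
qed (simp_all add: tensor_boundedD(5)[OF assms(1)])

lemma tensor_bounded_cong:
  "tensor_bounded n A \<Longrightarrow> (\<And>\<xi>. \<xi> \<in> tensor_power n \<Longrightarrow> B \<xi> = A \<xi>) \<Longrightarrow> tensor_bounded n B"
  unfolding tensor_bounded_def by (simp add: tensor_power_add tensor_power_scale)

lemma tensor_bounded_id: "tensor_bounded n id"
  unfolding tensor_bounded_def by (auto intro: exI[of _ 1])

lemma tensor_bounded_zero: "tensor_bounded n (\<lambda>_ _. 0)"
  unfolding tensor_bounded_def by (auto simp: tensor_power_zero norm_sq_def)

lemma tensor_bounded_comp:
  assumes "tensor_bounded n A" "tensor_bounded n B"
  shows "tensor_bounded n (A \<circ> B)"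
proof -
  obtain C where C: "C \<ge> 0" "\<And>\<xi>. \<xi> \<in> tensor_power n \<Longrightarrow> norm_sq (A \<xi>) \<le> C * norm_sq \<xi>"
    using tensor_boundedD(4)[OF assms(1)] by blast
  obtain D where D: "D \<ge> 0" "\<And>\<xi>. \<xi> \<in> tensor_power n \<Longrightarrow> norm_sq (B \<xi>) \<le> D * norm_sq \<xi>"
    using tensor_boundedD(4)[OF assms(2)] by blast
  have "norm_sq (A (B \<xi>)) \<le> C * D * norm_sq \<xi>" if "\<xi> \<in> tensor_power n" for \<xi>
  proof -
    have "norm_sq (A (B \<xi>)) \<le> C * norm_sq (B \<xi>)" by (rule C(2)[OF tensor_boundedD(1)[OF assms(2) that]])
    also have "\<dots> \<le> C * (D * norm_sq \<xi>)" by (intro mult_left_mono D C that)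
    finally show ?thesis by (simp add: mult.assoc)
  qed
  then have "\<exists>C\<ge>0. \<forall>\<xi>\<in>tensor_power n. norm_sq ((A \<circ> B) \<xi>) \<le> C * norm_sq \<xi>"
    using C(1) D(1) by (intro exI[of _ "C * D"]) simp
  then show ?thesis
    unfolding tensor_bounded_def
    by (simp add: tensor_boundedD[OF assms(1)] tensor_boundedD[OF assms(2)])
qed

lemma tensor_bounded_add:
  assumes "tensor_bounded n A" "tensor_bounded n B"
  shows "tensor_bounded n (\<lambda>\<xi> xs. A \<xi> xs + B \<xi> xs)"
proof -
  obtain C where C: "C \<ge> 0" "\<And>\<xi>. \<xi> \<in> tensor_power n \<Longrightarrow> norm_sq (A \<xi>) \<le> C * norm_sq \<xi>"
    using tensor_boundedD(4)[OF assms(1)] by blast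
  obtain D where D: "D \<ge> 0" "\<And>\<xi>. \<xi> \<in> tensor_power n \<Longrightarrow> norm_sq (B \<xi>) \<le> D * norm_sq \<xi>"
    using tensor_boundedD(4)[OF assms(2)] by blast
  have "norm_sq (\<lambda>xs. A \<xi> xs + B \<xi> xs) \<le> (2 * C + 2 * D) * norm_sq \<xi>" if "\<xi> \<in> tensor_power n" for \<xi>
  proof -
    have "norm_sq (\<lambda>xs. A \<xi> xs + B \<xi> xs) \<le> 2 * norm_sq (A \<xi>) + 2 * norm_sq (B \<xi>)"
      by (intro norm_sq_add[where n = n] tensor_boundedD(1)[OF assms(1)] tensor_boundedD(1)[OF assms(2)] that)
    then show ?thesis using C(2)[OF that] D(2)[OF that] by (simp add: algebra_simps)
  qed
  then have "\<exists>C\<ge>0. \<forall>\<xi>\<in>tensor_power n. norm_sq (\<lambda>xs. A \<xi> xs + B \<xi> xs) \<le> C * norm_sq \<xi>"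
    using C(1) D(1) by (intro exI[of _ "2 * C + 2 * D"]) simp
  then show ?thesis
    unfolding tensor_bounded_def
    by (simp add: tensor_boundedD[OF assms(1)] tensor_boundedD[OF assms(2)] tensor_power_add algebra_simps)
qed

section \<open>The amplification I \<otimes> A\<close>

lemma id_tensor_apply:
  "id_tensor A \<xi> [] = 0" "id_tensor A \<xi> (i # ys) = A (head_slice i \<xi>) ys"
  by (simp_all add: id_tensor_def head_slice_def)

lemma head_slice_id_tensor: "head_slice i (id_tensor A \<xi>) = A (head_slice i \<xi>)"
  by (simp add: head_slice_def id_tensor_def)

lemma tensor_bounded_id_tensor:
  assumes A: "tensor_bounded n A" shows "tensor_bounded (Suc n) (id_tensor A)"
proof -
  obtain C where C: "C \<ge> 0" "\<And>\<xi>. \<xi> \<in> tensor_power n \<Longrightarrow> norm_sq (A \<xi>) \<le> C * norm_sq \<xi>"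
    using tensor_boundedD(4)[OF A] by blast
  have main: "(\<lambda>xs. (cmod (id_tensor A \<xi> xs))\<^sup>2) summable_on UNIV \<and> norm_sq (id_tensor A \<xi>) \<le> C * norm_sq \<xi>"
    if \<xi>: "\<xi> \<in> tensor_power (Suc n)" for \<xi>
  proof -
    have o: "x \<notin> (\<lambda>(i, ys). i # ys) ` (UNIV \<times> UNIV) \<Longrightarrow> \<xi> x = 0" for x
      using not_cons[of x] tensor_power_supp[OF \<xi>, of x] by simp
    have o': "x \<notin> (\<lambda>(i, ys). i # ys) ` (UNIV \<times> UNIV) \<Longrightarrow> id_tensor A \<xi> x = 0" for x
      using not_cons[of x] by (auto simp: id_tensor_apply)
    have sl: "A (head_slice i \<xi>) \<in> tensor_power n" for i
      by (rule tensor_boundedD(1)[OF A head_slice_in[OF \<xi>]])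
    have *: "(\<lambda>k. (cmod (id_tensor A \<xi> (case (i, k) of (i, ys) \<Rightarrow> i # ys)))\<^sup>2) summable_on UNIV" for i
      using tensor_power_summable[OF sl[of i]] by (simp add: id_tensor_apply)
    have **: "(\<Sum>\<^sub>\<infinity>k. (cmod (id_tensor A \<xi> (case (i, k) of (i, ys) \<Rightarrow> i # ys)))\<^sup>2)
        \<le> C * (\<Sum>\<^sub>\<infinity>k. (cmod (\<xi> (case (i, k) of (i, ys) \<Rightarrow> i # ys)))\<^sup>2)" for i
      using C(2)[OF head_slice_in[OF \<xi>], of i] by (simp add: norm_sq_def id_tensor_apply head_slice_def)
    show ?thesis
      using norm_sq_from_slices[OF \<xi> inj_cons o o' * **] by blast
  qed
  have "id_tensor A \<xi> \<in> tensor_power (Suc n)" if \<xi>: "\<xi> \<in> tensor_power (Suc n)" for \<xi>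
  proof (rule tensor_powerI)
    show "id_tensor A \<xi> xs = 0" if "length xs \<noteq> Suc n" for xs
    proof (cases xs)
      case (Cons i ys)
      then show ?thesis
        using tensor_power_supp[OF tensor_boundedD(1)[OF A head_slice_in[OF \<xi>]]] that
        by (simp add: id_tensor_apply)
    qed (simp add: id_tensor_apply)
  qed (use main \<xi> in blast)
  moreover have "id_tensor A (\<lambda>xs. \<xi> xs + \<eta> xs) = (\<lambda>xs. id_tensor A \<xi> xs + id_tensor A \<eta> xs)"
    if "\<xi> \<in> tensor_power (Suc n)" "\<eta> \<in> tensor_power (Suc n)" for \<xi> \<eta>
    using tensor_boundedD(2)[OF A head_slice_in[OF that(1)] head_slice_in[OF that(2)]]
    by (auto simp: id_tensor_def fun_eq_iff head_slice_def split: list.split)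
  moreover have "id_tensor A (\<lambda>xs. c * \<xi> xs) = (\<lambda>xs. c * id_tensor A \<xi> xs)"
    if "\<xi> \<in> tensor_power (Suc n)" for \<xi> c
    using tensor_boundedD(3)[OF A head_slice_in[OF that]]
    by (auto simp: id_tensor_def fun_eq_iff head_slice_def split: list.split)
  moreover have "\<exists>C\<ge>0. \<forall>\<xi>\<in>tensor_power (Suc n). norm_sq (id_tensor A \<xi>) \<le> C * norm_sq \<xi>"
    using C(1) main by blast
  ultimately show ?thesis by (simp add: tensor_bounded_def)
qed

section \<open>The first leg T_1\<close>

definition pair_slice :: "int list \<Rightarrow> tensor \<Rightarrow> tensor" where
  "pair_slice v \<xi> = (\<lambda>ys. if length ys = 2 then \<xi> (ys @ v) else 0)"

lemma leg_one: "leg T (Suc 0) \<xi> xs = (if 2 \<le> length xs then T (pair_slice (drop 2 xs) \<xi>) (take 2 xs) else 0)"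
  by (simp add: leg_def pair_slice_def numeral_2_eq_2 cong: if_cong)

lemma inj_append_pair: "inj_on (\<lambda>(v, ys). ys @ v) (UNIV \<times> {ys. length ys = 2})"
  by (auto simp: inj_on_def)

lemma not_append_pair: "x \<notin> (\<lambda>(v, ys). ys @ v) ` (UNIV \<times> {ys. length ys = 2}) \<Longrightarrow> length x < 2"
proof (rule ccontr)
  assume x: "x \<notin> (\<lambda>(v, ys). ys @ v) ` (UNIV \<times> {ys. length ys = 2})" "\<not> length x < 2"
  then have "x \<in> (\<lambda>(v, ys). ys @ v) ` (UNIV \<times> {ys. length ys = 2})"
    by (intro image_eqI[of _ _ "(drop 2 x, take 2 x)"]) auto
  then show False using x by blast
qed

lemma pair_slice_in:
  assumes "2 \<le> n" "\<xi> \<in> tensor_power n" shows "pair_slice v \<xi> \<in> tensor_power 2"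
proof (rule tensor_powerI)
  have "x \<notin> (\<lambda>(v, ys). ys @ v) ` (UNIV \<times> {ys. length ys = 2}) \<Longrightarrow> (cmod (\<xi> x))\<^sup>2 = 0" for x
    using not_append_pair[of x] tensor_power_supp[OF assms(2), of x] assms(1) by simp
  from infsum_slices(1)[OF tensor_power_summable[OF assms(2)] inj_append_pair this, of v]
  have "(\<lambda>ys. (cmod (\<xi> (ys @ v)))\<^sup>2) summable_on {ys. length ys = 2}" by simp
  also have "?this \<longleftrightarrow> (\<lambda>xs. (cmod (pair_slice v \<xi> xs))\<^sup>2) summable_on UNIV"
    by (rule summable_on_cong_neutral) (auto simp: pair_slice_def)
  finally show "(\<lambda>xs. (cmod (pair_slice v \<xi> xs))\<^sup>2) summable_on UNIV" .
qed (simp add: pair_slice_def)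

lemma infsum_pairs:
  "\<xi> \<in> tensor_power 2 \<Longrightarrow> (\<Sum>\<^sub>\<infinity>ys\<in>{ys. length ys = 2}. (cmod (\<xi> ys))\<^sup>2) = norm_sq \<xi>"
  unfolding norm_sq_def by (rule infsum_cong_neutral) (auto dest: tensor_power_supp)

text \<open>Freezing everything after the second letter reduces T_1 to T on each pair slice, with
  one common constant. Only the first leg is treated in this way; the others arise from it by
  tensoring with the identity, see \<open>leg_Suc_Suc\<close>.\<close>

lemma tensor_bounded_leg_one:
  assumes T: "tensor_bounded 2 T" and "2 \<le> n" shows "tensor_bounded n (leg T (Suc 0))"
proof -
  obtain C where C: "C \<ge> 0" "\<And>\<xi>. \<xi> \<in> tensor_power 2 \<Longrightarrow> norm_sq (T \<xi>) \<le> C * norm_sq \<xi>"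
    using tensor_boundedD(4)[OF T] by blast
  have main: "(\<lambda>xs. (cmod (leg T (Suc 0) \<xi> xs))\<^sup>2) summable_on UNIV \<and>
      norm_sq (leg T (Suc 0) \<xi>) \<le> C * norm_sq \<xi>"
    if \<xi>: "\<xi> \<in> tensor_power n" for \<xi>
  proof -
    let ?K = "{ys :: int list. length ys = 2}"
    have o: "x \<notin> (\<lambda>(v, ys). ys @ v) ` (UNIV \<times> ?K) \<Longrightarrow> \<xi> x = 0" for x
      using not_append_pair[of x] tensor_power_supp[OF \<xi>, of x] assms(2) by simp
    have o': "x \<notin> (\<lambda>(v, ys). ys @ v) ` (UNIV \<times> ?K) \<Longrightarrow> leg T (Suc 0) \<xi> x = 0" for x
      using not_append_pair[of x] by (simp add: leg_one)
    have sl: "T (pair_slice v \<xi>) \<in> tensor_power 2" for v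
      by (rule tensor_boundedD(1)[OF T pair_slice_in[OF assms(2) \<xi>]])
    have *: "(\<lambda>k. (cmod (leg T (Suc 0) \<xi> (case (v, k) of (v, ys) \<Rightarrow> ys @ v)))\<^sup>2) summable_on ?K" for v
    proof -
      have "(\<lambda>k. (cmod (T (pair_slice v \<xi>) k))\<^sup>2) summable_on ?K"
        by (rule summable_on_subset_banach[OF tensor_power_summable[OF sl[of v]]]) simp
      also have "?this \<longleftrightarrow> ?thesis" by (rule summable_on_cong) (simp add: leg_one)
      finally show ?thesis .
    qed
    have **: "(\<Sum>\<^sub>\<infinity>k\<in>?K. (cmod (leg T (Suc 0) \<xi> (case (v, k) of (v, ys) \<Rightarrow> ys @ v)))\<^sup>2)
        \<le> C * (\<Sum>\<^sub>\<infinity>k\<in>?K. (cmod (\<xi> (case (v, k) of (v, ys) \<Rightarrow> ys @ v)))\<^sup>2)" for v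
    proof -
      have "(\<Sum>\<^sub>\<infinity>k\<in>?K. (cmod (leg T (Suc 0) \<xi> (case (v, k) of (v, ys) \<Rightarrow> ys @ v)))\<^sup>2) =
          norm_sq (T (pair_slice v \<xi>))"
        unfolding infsum_pairs[OF sl, symmetric] by (rule infsum_cong) (simp add: leg_one)
      moreover have "(\<Sum>\<^sub>\<infinity>k\<in>?K. (cmod (\<xi> (case (v, k) of (v, ys) \<Rightarrow> ys @ v)))\<^sup>2) = norm_sq (pair_slice v \<xi>)"
        unfolding infsum_pairs[OF pair_slice_in[OF assms(2) \<xi>], symmetric]
        by (rule infsum_cong) (simp add: pair_slice_def)
      ultimately show ?thesis using C(2)[OF pair_slice_in[OF assms(2) \<xi>], of v] by simp
    qed
    show ?thesis
      using norm_sq_from_slices[OF \<xi> inj_append_pair o o' * **] by blast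
  qed
  have "leg T (Suc 0) \<xi> \<in> tensor_power n" if \<xi>: "\<xi> \<in> tensor_power n" for \<xi>
  proof (rule tensor_powerI)
    show "leg T (Suc 0) \<xi> xs = 0" if "length xs \<noteq> n" for xs
    proof (cases "2 \<le> length xs")
      case True
      then have "pair_slice (drop 2 xs) \<xi> = (\<lambda>_. 0)"
        using tensor_power_supp[OF \<xi>] that by (auto simp: pair_slice_def fun_eq_iff)
      then show ?thesis by (simp add: leg_one tensor_boundedD(5)[OF T])
    qed (simp add: leg_one)
  qed (use main \<xi> in blast)
  moreover have "leg T (Suc 0) (\<lambda>xs. \<xi> xs + \<eta> xs) = (\<lambda>xs. leg T (Suc 0) \<xi> xs + leg T (Suc 0) \<eta> xs)"
    if "\<xi> \<in> tensor_power n" "\<eta> \<in> tensor_power n" for \<xi> \<eta>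
  proof -
    have "pair_slice v (\<lambda>xs. \<xi> xs + \<eta> xs) = (\<lambda>ys. pair_slice v \<xi> ys + pair_slice v \<eta> ys)" for v
      by (auto simp: pair_slice_def)
    then show ?thesis
      by (intro ext) (simp add: leg_one tensor_boundedD(2)[OF T] pair_slice_in[OF assms(2)] that)
  qed
  moreover have "leg T (Suc 0) (\<lambda>xs. c * \<xi> xs) = (\<lambda>xs. c * leg T (Suc 0) \<xi> xs)"
    if "\<xi> \<in> tensor_power n" for \<xi> c
  proof -
    have "pair_slice v (\<lambda>xs. c * \<xi> xs) = (\<lambda>ys. c * pair_slice v \<xi> ys)" for v
      by (auto simp: pair_slice_def)
    then show ?thesis
      by (intro ext) (simp add: leg_one tensor_boundedD(3)[OF T] pair_slice_in[OF assms(2)] that)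
  qed
  moreover have "\<exists>C\<ge>0. \<forall>\<xi>\<in>tensor_power n. norm_sq (leg T (Suc 0) \<xi>) \<le> C * norm_sq \<xi>"
    using C(1) main by blast
  ultimately show ?thesis by (simp add: tensor_bounded_def)
qed

subsection \<open>The operators R and P\<close>

lemma leg_Suc_Suc: "leg T (Suc (Suc k)) \<xi> = id_tensor (leg T (Suc k)) \<xi>"
  by (rule ext) (auto simp: leg_def id_tensor_def split: list.split cong: if_cong)

lemma id_tensor_comp: "id_tensor A (id_tensor B \<xi>) = id_tensor (A \<circ> B) \<xi>"
  by (rule ext) (auto simp: id_tensor_def split: list.split)

text \<open>\<open>leg_product\<close> adds factors on the right, while induction on the degree has
  to peel T_1 off on the left. The condition on the empty list is there because
  \<open>id_tensor\<close> always returns 0 on it.\<close>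

lemma leg_product_Suc:
  "\<xi> [] = 0 \<Longrightarrow> leg_product T (Suc k) \<xi> = leg T (Suc 0) (id_tensor (leg_product T k) \<xi>)"
proof (induction k arbitrary: \<xi>)
  case 0
  then have *: "id_tensor id \<xi> = \<xi>" by (auto simp: id_tensor_def fun_eq_iff split: list.split)
  show ?case unfolding leg_product.simps(1) * by simp
next
  case (Suc k)
  have "leg T (Suc (Suc k)) \<xi> [] = 0" by (simp add: leg_def)
  note IH = Suc.IH[of "leg T (Suc (Suc k)) \<xi>", OF this]
  have "leg_product T (Suc (Suc k)) \<xi> = leg_product T (Suc k) (leg T (Suc (Suc k)) \<xi>)" by simp
  also have "\<dots> = leg T (Suc 0) (id_tensor (leg_product T k \<circ> leg T (Suc k)) \<xi>)"
    unfolding IH by (simp only: leg_Suc_Suc id_tensor_comp)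
  also have "leg_product T k \<circ> leg T (Suc k) = leg_product T (Suc k)"
    by (simp only: leg_product.simps(2))
  finally show ?case .
qed

context
  fixes T :: "tensor \<Rightarrow> tensor"
  assumes T: "tensor_bounded 2 T"
begin

lemma tensor_bounded_leg_product: "k < n \<Longrightarrow> tensor_bounded n (leg_product T k)"
proof (induction n arbitrary: k)
  case (Suc m)
  show ?case
  proof (cases k)
    case (Suc j)
    then have "tensor_bounded (Suc m) (leg T (Suc 0) \<circ> id_tensor (leg_product T j))"
      using Suc.IH[of j] Suc.prems
      by (intro tensor_bounded_comp tensor_bounded_leg_one[OF T] tensor_bounded_id_tensor) auto
    moreover have "leg_product T k \<xi> = (leg T (Suc 0) \<circ> id_tensor (leg_product T j)) \<xi>"
      if "\<xi> \<in> tensor_power (Suc m)" for \<xi>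
      using leg_product_Suc[of \<xi> T j] tensor_power_supp[OF that, of "[]"] Suc by simp
    ultimately show ?thesis by (rule tensor_bounded_cong)
  qed (simp add: tensor_bounded_id[unfolded id_def])
qed simp

text \<open>Degree one is exceptional, since T_1 has no second factor to act on and
  \<open>tensor_bounded_leg_one\<close> does not apply; there \<open>R_op T 0\<close> is an empty
  sum and the composite vanishes.\<close>

lemma tensor_bounded_leg_R:
  "tensor_bounded n (R_op T n) \<Longrightarrow> tensor_bounded (Suc n) (leg T (Suc 0) \<circ> id_tensor (R_op T n))"
proof (cases n)
  case 0
  have "R_op T n \<xi> = (\<lambda>_. 0)" for \<xi> using 0 by (simp add: R_op_def)
  then have "pair_slice v (id_tensor (R_op T n) \<xi>) = (\<lambda>_. 0)" for v \<xi>
    by (auto simp: pair_slice_def id_tensor_def fun_eq_iff split: list.split)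
  then have "(leg T (Suc 0) \<circ> id_tensor (R_op T n)) \<xi> = (\<lambda>_. 0)" for \<xi>
    by (intro ext) (simp add: leg_one tensor_boundedD(5)[OF T])
  then show "tensor_bounded (Suc n) (leg T (Suc 0) \<circ> id_tensor (R_op T n))"
    by (intro tensor_bounded_cong[OF tensor_bounded_zero])
next
  case (Suc m)
  assume "tensor_bounded n (R_op T n)"
  then show ?thesis
    using Suc by (intro tensor_bounded_comp tensor_bounded_leg_one[OF T] tensor_bounded_id_tensor) auto
qed

text \<open>Factoring T_1 out of every summand but the first turns the sum into a recursion in the
  degree; boundedness, shift covariance and the commutation rule are all proved through it. It
  starts from \<open>R_op T 0\<close>, the empty sum.\<close>

lemma R_op_Suc:
  assumes \<xi>: "\<xi> \<in> tensor_power (Suc n)"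
  shows "R_op T (Suc n) \<xi> = (\<lambda>xs. \<xi> xs + leg T (Suc 0) (id_tensor (R_op T n) \<xi>) xs)"
proof (cases n)
  case 0
  have "R_op T n \<xi> = (\<lambda>_. 0)" for \<xi> using 0 by (simp add: R_op_def)
  then have "pair_slice v (id_tensor (R_op T n) \<xi>) = (\<lambda>_. 0)" for v
    by (auto simp: pair_slice_def id_tensor_def fun_eq_iff split: list.split)
  then show ?thesis
    by (intro ext) (simp add: leg_one tensor_boundedD(5)[OF T], simp add: 0 R_op_def)
next
  case (Suc m)
  have b: "tensor_bounded (Suc n) (leg T (Suc 0))"
    using Suc by (intro tensor_bounded_leg_one[OF T]) simp
  have 0: "\<xi> [] = 0" using tensor_power_supp[OF \<xi>, of "[]"] by simp
  have mem: "id_tensor (leg_product T k) \<xi> \<in> tensor_power (Suc n)" if "k < n" for k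
    using tensor_boundedD(1)[OF tensor_bounded_id_tensor[OF tensor_bounded_leg_product[OF that]] \<xi>] .
  have "id_tensor (R_op T n) \<xi> = (\<lambda>xs. \<Sum>k<n. id_tensor (leg_product T k) \<xi> xs)"
    by (auto simp: id_tensor_def R_op_def fun_eq_iff split: list.split)
  then have "leg T (Suc 0) (id_tensor (R_op T n) \<xi>) =
      (\<lambda>xs. \<Sum>k<n. leg T (Suc 0) (id_tensor (leg_product T k) \<xi>) xs)"
    using tensor_bounded_sum[OF b, of "{..<n}" "\<lambda>k. id_tensor (leg_product T k) \<xi>"] mem by simp
  then show ?thesis
    unfolding R_op_def sum.lessThan_Suc_shift by (simp add: leg_product_Suc[of \<xi>, OF 0] del: leg_product.simps(2))
qed

lemma tensor_bounded_R_op: "tensor_bounded n (R_op T n)"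
proof (induction n)
  case 0
  show ?case by (rule tensor_bounded_cong[OF tensor_bounded_zero]) (simp add: R_op_def)
next
  case (Suc n)
  show ?case
    by (rule tensor_bounded_cong[OF tensor_bounded_add[OF tensor_bounded_id tensor_bounded_leg_R[OF Suc]]])
      (simp add: R_op_Suc)
qed

lemma tensor_bounded_P_op: "tensor_bounded n (P_op T n)"
proof (induction n)
  case (Suc n)
  then show ?case
    unfolding P_op.simps by (intro tensor_bounded_comp tensor_bounded_id_tensor tensor_bounded_R_op)
qed (simp add: tensor_bounded_id[unfolded id_def])

end

section \<open>Hermitian and positive forms on tensor powers\<close>

lemma hermitian_id_tensor:
  assumes A: "tensor_bounded n A"
    and herm: "\<And>\<xi> \<eta>. \<xi> \<in> tensor_power n \<Longrightarrow> \<eta> \<in> tensor_power n \<Longrightarrow>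
      tensor_inner (A \<xi>) \<eta> = tensor_inner \<xi> (A \<eta>)"
    and \<xi>: "\<xi> \<in> tensor_power (Suc n)" and \<eta>: "\<eta> \<in> tensor_power (Suc n)"
  shows "tensor_inner (id_tensor A \<xi>) \<eta> = tensor_inner \<xi> (id_tensor A \<eta>)"
proof -
  note m = tensor_boundedD(1)[OF tensor_bounded_id_tensor[OF A]]
  show ?thesis
    unfolding tensor_inner_head_slices(1)[OF m[OF \<xi>] \<eta>] tensor_inner_head_slices(1)[OF \<xi> m[OF \<eta>]]
    by (simp add: head_slice_id_tensor herm head_slice_in[OF \<xi>] head_slice_in[OF \<eta>])
qed

lemma positive_id_tensor:
  assumes A: "tensor_bounded n A"
    and pos: "\<And>\<xi>. \<xi> \<in> tensor_power n \<Longrightarrow> 0 \<le> Re (tensor_inner \<xi> (A \<xi>))"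
    and \<xi>: "\<xi> \<in> tensor_power (Suc n)"
  shows "0 \<le> Re (tensor_inner \<xi> (id_tensor A \<xi>))"
proof -
  note m = tensor_boundedD(1)[OF tensor_bounded_id_tensor[OF A] \<xi>]
  have "Re (tensor_inner \<xi> (id_tensor A \<xi>)) =
      (\<Sum>\<^sub>\<infinity>i. Re (tensor_inner (head_slice i \<xi>) (A (head_slice i \<xi>))))"
    unfolding tensor_inner_head_slices(1)[OF \<xi> m] head_slice_id_tensor
    using infsum_Re[OF tensor_inner_head_slices(2)[OF \<xi> m]] by (simp add: head_slice_id_tensor)
  also have "\<dots> \<ge> 0" by (rule infsum_nonneg) (rule pos[OF head_slice_in[OF \<xi>]])
  finally show ?thesis .
qed

text \<open>Repeated squaring along \<open>k = 2 ^ j\<close> shows that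
  \<open>s (2 ^ j) / s 0\<close> is at least the \<open>2 ^ j\<close>-th power of
  \<open>s 1 / s 0\<close>; against the growth \<open>K * M ^ k\<close> the constant
  \<open>K\<close> is lost in the limit, and the ratio cannot exceed \<open>M\<close>.\<close>

lemma log_convex_bound:
  fixes s :: "nat \<Rightarrow> real"
  assumes s0: "0 \<le> s 0" and conv: "\<And>k. (s k)\<^sup>2 \<le> s 0 * s (2 * k)"
    and growth: "\<And>k. s k \<le> K * M ^ k" and M: "0 < M"
  shows "s 1 \<le> M * s 0"
proof (rule ccontr)
  assume "\<not> s 1 \<le> M * s 0"
  then have s1: "M * s 0 < s 1" by simp
  then have "0 < s 1" using s0 M by (meson less_le_trans mult_nonneg_nonneg not_less order.strict_implies_order)
  then have "0 < (s 1)\<^sup>2" by simp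
  then have "0 < s 0 * s (2 * 1)" using conv[of 1] by linarith
  then have p0: "0 < s 0" using s0 by (cases "s 0 = 0") auto
  define r where "r = s 1 / s 0"
  have r: "0 < r" "M < r" using p0 s1 \<open>0 < s 1\<close> by (simp_all add: r_def field_simps)
  have pw: "r ^ (2 ^ j) \<le> s (2 ^ j) / s 0" for j
  proof (induction j)
    case (Suc j)
    have "(r ^ (2 ^ j))\<^sup>2 \<le> (s (2 ^ j) / s 0)\<^sup>2"
      using Suc r by (intro power_mono) auto
    also have "\<dots> \<le> s (2 ^ Suc j) / s 0"
      using conv[of "2 ^ j"] p0 by (simp add: power_divide power2_eq_square field_simps)
    finally show ?case by (simp add: power_mult[symmetric] mult.commute)
  qed (simp add: r_def)
  have "1 < r / M" using r M by simp
  then obtain j where j: "K / s 0 < (r / M) ^ j" using real_arch_pow by blast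
  \<comment> \<open>The powers of \<open>r / M\<close> are unbounded; as \<open>j < 2 ^ j\<close>,
    this passes to the exponents that are powers of two.\<close>
  have "(r / M) ^ j \<le> (r / M) ^ (2 ^ j)"
    using \<open>1 < r / M\<close> less_imp_le[OF less_exp[of j]] by (intro power_increasing) auto
  also have "\<dots> = r ^ (2 ^ j) / M ^ (2 ^ j)" by (simp add: power_divide)
  also have "\<dots> \<le> (s (2 ^ j) / s 0) / M ^ (2 ^ j)"
    using pw[of j] M by (intro divide_right_mono) auto
  also have "\<dots> \<le> K / s 0"
    using growth[of "2 ^ j"] p0 M by (simp add: field_simps)
  finally show False using j by simp
qed

text \<open>This is Lax's theorem on operators that are symmetric for a second, semidefinite inner
  product; it replaces operator monotonicity of the square root in bounding \<open>A R\<close> by \<open>A\<close>.\<close>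

lemma form_bound:
  assumes A: "tensor_bounded n A" and R: "tensor_bounded n R"
    and hermA: "\<And>\<xi> \<eta>. \<xi> \<in> tensor_power n \<Longrightarrow> \<eta> \<in> tensor_power n \<Longrightarrow>
      tensor_inner (A \<xi>) \<eta> = tensor_inner \<xi> (A \<eta>)"
    and posA: "\<And>\<xi>. \<xi> \<in> tensor_power n \<Longrightarrow> 0 \<le> Re (tensor_inner \<xi> (A \<xi>))"
    and hermAR: "\<And>\<xi> \<eta>. \<xi> \<in> tensor_power n \<Longrightarrow> \<eta> \<in> tensor_power n \<Longrightarrow>
      tensor_inner (A (R \<xi>)) \<eta> = tensor_inner \<xi> (A (R \<eta>))"
  obtains C where "0 \<le> C" "\<And>\<xi>. \<xi> \<in> tensor_power n \<Longrightarrow>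
    Re (tensor_inner \<xi> (A (R \<xi>))) \<le> C * Re (tensor_inner \<xi> (A \<xi>))"
proof -
  obtain CA where CA: "CA \<ge> 0" "\<And>\<xi>. \<xi> \<in> tensor_power n \<Longrightarrow> norm_sq (A \<xi>) \<le> CA * norm_sq \<xi>"
    using tensor_boundedD(4)[OF A] by blast
  obtain M0 where M0: "M0 \<ge> 0" "\<And>\<xi>. \<xi> \<in> tensor_power n \<Longrightarrow> norm_sq (R \<xi>) \<le> M0 * norm_sq \<xi>"
    using tensor_boundedD(4)[OF R] by blast
  \<comment> \<open>\<open>M \<ge> 1\<close> keeps \<open>M ^ k \<ge> 1\<close>, so that the term
    \<open>norm_sq \<xi> / 2\<close> in the estimate of \<open>s k\<close> is absorbed in the
    geometric bound.\<close>
  define M where "M = M0 + 1"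
  have M: "1 \<le> M" "\<And>\<xi>. \<xi> \<in> tensor_power n \<Longrightarrow> norm_sq (R \<xi>) \<le> M * norm_sq \<xi>"
    using M0 norm_sq_nonneg by (auto simp: M_def distrib_right intro: add_increasing2)
  note mA = tensor_boundedD(1)[OF A] and mR = tensor_boundedD(1)[OF R]
  \<comment> \<open>Cauchy-Schwarz for the form of \<open>A\<close>; the discriminant bound also
    covers vectors on which the form vanishes.\<close>
  have cs: "(Re (tensor_inner \<xi> (A \<eta>)))\<^sup>2 \<le> Re (tensor_inner \<xi> (A \<xi>)) * Re (tensor_inner \<eta> (A \<eta>))"
    if \<xi>: "\<xi> \<in> tensor_power n" and \<eta>: "\<eta> \<in> tensor_power n" for \<xi> \<eta>
  proof (rule discriminant_bound)
    fix t :: real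
    let ?c = "complex_of_real t"
    have m: "(\<lambda>xs. ?c * \<eta> xs) \<in> tensor_power n" "(\<lambda>xs. ?c * A \<eta> xs) \<in> tensor_power n"
      using \<eta> mA by (simp_all add: tensor_power_scale)
    have m': "(\<lambda>xs. A \<xi> xs + ?c * A \<eta> xs) \<in> tensor_power n"
      using \<xi> mA m by (simp add: tensor_power_add)
    have "tensor_inner \<eta> (A \<xi>) = cnj (tensor_inner \<xi> (A \<eta>))"
      using hermA[OF \<xi> \<eta>] tensor_inner_commute[of \<eta> "A \<xi>"] by simp
    moreover have "0 \<le> Re (tensor_inner (\<lambda>xs. \<xi> xs + ?c * \<eta> xs) (A (\<lambda>xs. \<xi> xs + ?c * \<eta> xs)))"
      by (rule posA[OF tensor_power_add[OF \<xi> m(1)]])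
    moreover have "A (\<lambda>xs. \<xi> xs + ?c * \<eta> xs) = (\<lambda>xs. A \<xi> xs + ?c * A \<eta> xs)"
      using tensor_boundedD(2)[OF A \<xi> m(1)] tensor_boundedD(3)[OF A \<eta>, of ?c] by simp
    ultimately show "0 \<le> Re (tensor_inner \<xi> (A \<xi>)) + 2 * t * Re (tensor_inner \<xi> (A \<eta>)) +
        t\<^sup>2 * Re (tensor_inner \<eta> (A \<eta>))"
      by (simp add: tensor_inner_add_left[OF m' \<xi> m(1)] tensor_inner_add_right[OF \<xi> mA[OF \<xi>] m(2)]
          tensor_inner_add_right[OF \<eta> mA[OF \<xi>] m(2)] tensor_inner_scale_left tensor_inner_scale_right
          power2_eq_square algebra_simps)
  qed
  have "Re (tensor_inner \<xi> (A (R \<xi>))) \<le> M * Re (tensor_inner \<xi> (A \<xi>))"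
    if \<xi>: "\<xi> \<in> tensor_power n" for \<xi>
  proof -
    have mk: "(R ^^ k) \<eta> \<in> tensor_power n" if "\<eta> \<in> tensor_power n" for k \<eta>
      using that by (induction k) (auto intro: mR)
    \<comment> \<open>\<open>hermAR\<close> says that \<open>R\<close> is symmetric for the form of
      \<open>A\<close>, and the powers of \<open>R\<close> inherit this.\<close>
    have sym: "tensor_inner ((R ^^ k) \<eta>) (A \<zeta>) = tensor_inner \<eta> (A ((R ^^ k) \<zeta>))"
      if "\<eta> \<in> tensor_power n" "\<zeta> \<in> tensor_power n" for k \<eta> \<zeta>
      using that
    proof (induction k arbitrary: \<zeta>)
      case (Suc k)
      have "tensor_inner ((R ^^ Suc k) \<eta>) (A \<zeta>) = tensor_inner (A (R ((R ^^ k) \<eta>))) \<zeta>"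
        using hermA[OF mk[of \<eta> "Suc k"], of \<zeta>] Suc.prems by simp
      also have "\<dots> = tensor_inner ((R ^^ k) \<eta>) (A (R \<zeta>))"
        by (rule hermAR) (use Suc.prems mk in auto)
      also have "\<dots> = tensor_inner \<eta> (A ((R ^^ k) (R \<zeta>)))"
        by (rule Suc.IH) (use Suc.prems mR in auto)
      finally show ?case by (simp add: funpow_swap1)
    qed simp
    define s where "s k = Re (tensor_inner \<xi> (A ((R ^^ k) \<xi>)))" for k
    have nk: "norm_sq ((R ^^ k) \<xi>) \<le> M ^ k * norm_sq \<xi>" for k
    proof (induction k)
      case (Suc k)
      have "norm_sq ((R ^^ Suc k) \<xi>) \<le> M * norm_sq ((R ^^ k) \<xi>)" using M(2) mk[OF \<xi>] by simp
      also have "\<dots> \<le> M * (M ^ k * norm_sq \<xi>)" using Suc M(1) by (intro mult_left_mono) auto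
      finally show ?case by (simp add: mult.assoc)
    qed simp
    have "s 1 \<le> M * s 0"
    proof (rule log_convex_bound)
      show "0 \<le> s 0" using posA[OF \<xi>] by (simp add: s_def)
      show "0 < M" using M(1) by simp
      show "(s k)\<^sup>2 \<le> s 0 * s (2 * k)" for k
      proof -
        have "tensor_inner ((R ^^ k) \<xi>) (A ((R ^^ k) \<xi>)) = tensor_inner \<xi> (A ((R ^^ (2 * k)) \<xi>))"
          using sym[OF \<xi> mk[OF \<xi>], of k k] by (simp add: mult_2 funpow_add)
        then show ?thesis using cs[OF \<xi> mk[OF \<xi>], of k] by (simp add: s_def)
      qed
      \<comment> \<open>\<open>tensor_inner_le\<close> bounds the form by squared norms, which grow
        geometrically under \<open>R\<close>. The factor depends on \<open>\<xi>\<close>, but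
        \<open>log_convex_bound\<close> discards it.\<close>
      show "s k \<le> ((1 + CA) * norm_sq \<xi>) * M ^ k" for k
      proof -
        have "s k \<le> norm_sq \<xi> / 2 + norm_sq (A ((R ^^ k) \<xi>)) / 2"
          unfolding s_def using tensor_inner_le[OF \<xi> mA[OF mk[OF \<xi>]]] complex_Re_le_cmod order_trans by blast
        moreover have "norm_sq (A ((R ^^ k) \<xi>)) \<le> CA * (M ^ k * norm_sq \<xi>)"
          by (rule order_trans[OF CA(2)[OF mk[OF \<xi>]] mult_left_mono[OF nk CA(1)]])
        moreover have "norm_sq \<xi> * 1 \<le> norm_sq \<xi> * M ^ k"
          using M(1) norm_sq_nonneg by (intro mult_left_mono one_le_power) auto
        moreover have "0 \<le> norm_sq \<xi>" "0 \<le> CA * (M ^ k * norm_sq \<xi>)"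
          using CA(1) M(1) norm_sq_nonneg by auto
        ultimately show ?thesis by (simp add: algebra_simps)
      qed
    qed
    then show ?thesis by (simp add: s_def)
  qed
  then show thesis using that[of M] M(1) by simp
qed

text \<open>Selfadjointness turns the squared norm of \<open>T \<xi>\<close> into
  \<open>tensor_inner \<xi> (T (T \<xi>))\<close>, and the Hecke relation makes this linear in
  \<open>T \<xi>\<close>. Half of the squared norm is then absorbed on the left, which doubles
  \<open>\<bar>q\<bar>\<close> in the constant
  \<open>(q - 1)\<^sup>2 + 2 * \<bar>q\<bar>\<close>.\<close>

lemma hecke_bounded:
  assumes "yang_baxter_hecke_operator T" shows "tensor_bounded 2 T"
proof -
  obtain q where q: "\<And>\<xi>. \<xi> \<in> tensor_power 2 \<Longrightarrow>
      T (T \<xi>) = (\<lambda>xs. complex_of_real (q - 1) * T \<xi> xs + complex_of_real q * \<xi> xs)"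
    using assms by (auto simp: yang_baxter_hecke_operator_def)
  have sa: "selfadjoint_on_pairs T"
    using assms by (simp add: yang_baxter_hecke_operator_def yang_baxter_operator_def)
  have m: "\<And>\<xi>. \<xi> \<in> tensor_power 2 \<Longrightarrow> T \<xi> \<in> tensor_power 2"
    using sa by (simp add: selfadjoint_on_pairs_def)
  have "norm_sq (T \<xi>) \<le> ((q - 1)\<^sup>2 + 2 * \<bar>q\<bar>) * norm_sq \<xi>" if \<xi>: "\<xi> \<in> tensor_power 2" for \<xi>
  proof -
    have "of_real (norm_sq (T \<xi>)) = tensor_inner \<xi> (T (T \<xi>))"
      unfolding tensor_inner_self[OF m[OF \<xi>], symmetric]
      using sa m \<xi> by (simp add: selfadjoint_on_pairs_def)
    also have "\<dots> = tensor_inner \<xi> (\<lambda>xs. of_real (q - 1) * T \<xi> xs) + of_real q * of_real (norm_sq \<xi>)"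
      unfolding q[OF \<xi>]
      by (subst tensor_inner_add_right[where n = 2])
        (use \<xi> m in \<open>auto intro!: tensor_power_scale simp: tensor_inner_scale_right tensor_inner_self[OF \<xi>]\<close>)
    also have "tensor_inner \<xi> (\<lambda>xs. of_real (q - 1) * T \<xi> xs) =
        tensor_inner (\<lambda>xs. of_real (q - 1) * \<xi> xs) (T \<xi>)"
      by (simp add: tensor_inner_scale_right tensor_inner_scale_left)
    finally have "norm_sq (T \<xi>) = Re (tensor_inner (\<lambda>xs. of_real (q - 1) * \<xi> xs) (T \<xi>)) + q * norm_sq \<xi>"
      by (metis Re_complex_of_real of_real_mult plus_complex.sel(1))
    moreover have "Re (tensor_inner (\<lambda>xs. of_real (q - 1) * \<xi> xs) (T \<xi>)) \<le>
        norm_sq (\<lambda>xs. of_real (q - 1) * \<xi> xs) / 2 + norm_sq (T \<xi>) / 2"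
      by (rule order_trans[OF complex_Re_le_cmod tensor_inner_le[OF tensor_power_scale[OF \<xi>] m[OF \<xi>]]])
    moreover have "norm_sq (\<lambda>xs. of_real (q - 1) * \<xi> xs) = (q - 1)\<^sup>2 * norm_sq \<xi>"
      by (simp only: norm_sq_scale norm_of_real power2_abs)
    moreover have "q * norm_sq \<xi> \<le> \<bar>q\<bar> * norm_sq \<xi>"
      by (rule mult_right_mono) (simp_all add: norm_sq_nonneg)
    ultimately show ?thesis unfolding distrib_right by linarith
  qed
  then have "\<exists>C\<ge>0. \<forall>\<xi>\<in>tensor_power 2. norm_sq (T \<xi>) \<le> C * norm_sq \<xi>"
    by (intro exI[of _ "(q - 1)\<^sup>2 + 2 * \<bar>q\<bar>"]) auto
  then show ?thesis
    using sa unfolding tensor_bounded_def selfadjoint_on_pairs_def by blast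
qed

subsection \<open>Creation and the shift on tensors\<close>

abbreviation prepend :: "int \<Rightarrow> tensor \<Rightarrow> tensor" where
  "prepend i \<equiv> tensor_left (unit_vector i)"

lemma prepend_apply [simp]: "prepend i \<xi> [] = 0" "prepend i \<xi> (j # ys) = (if i = j then \<xi> ys else 0)"
  by (auto simp: tensor_left_def unit_vector_def)

lemma head_slice_prepend: "head_slice j (prepend i \<xi>) = (if i = j then \<xi> else (\<lambda>_. 0))"
  by (auto simp: head_slice_def)

lemma prepend_linear:
  "prepend i (\<lambda>xs. \<xi> xs + \<eta> xs) = (\<lambda>xs. prepend i \<xi> xs + prepend i \<eta> xs)"
  "prepend i (\<lambda>xs. c * \<xi> xs) = (\<lambda>xs. c * prepend i \<xi> xs)"
  by (auto simp: tensor_left_def fun_eq_iff algebra_simps split: list.split)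

lemma prepend_in:
  assumes "\<xi> \<in> tensor_power n" shows "prepend i \<xi> \<in> tensor_power (Suc n)"
proof (rule tensor_powerI)
  show "prepend i \<xi> xs = 0" if "length xs \<noteq> Suc n" for xs
    using tensor_power_supp[OF assms] that by (cases xs) auto
  have inj: "inj_on ((#) i) UNIV" by simp
  have "((\<lambda>xs. (cmod (prepend i \<xi> xs))\<^sup>2) \<circ> (#) i) summable_on UNIV"
    using tensor_power_summable[OF assms] by (simp add: o_def)
  then have "(\<lambda>xs. (cmod (prepend i \<xi> xs))\<^sup>2) summable_on range ((#) i)"
    by (simp only: summable_on_reindex[OF inj])
  also have "?this \<longleftrightarrow> (\<lambda>xs. (cmod (prepend i \<xi> xs))\<^sup>2) summable_on UNIV"
  proof (rule summable_on_cong_neutral)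
    fix x assume "x \<in> UNIV - range ((#) i)"
    then show "(cmod (prepend i \<xi> x))\<^sup>2 = 0" by (cases x) auto
  qed auto
  finally show "(\<lambda>xs. (cmod (prepend i \<xi> xs))\<^sup>2) summable_on UNIV" .
qed

lemma tensor_inner_prepend:
  assumes "\<xi> \<in> tensor_power (Suc n)" "\<eta> \<in> tensor_power n"
  shows "tensor_inner \<xi> (prepend i \<eta>) = tensor_inner (head_slice i \<xi>) \<eta>"
proof -
  have "tensor_inner \<xi> (prepend i \<eta>) =
      (\<Sum>\<^sub>\<infinity>j. tensor_inner (head_slice j \<xi>) (head_slice j (prepend i \<eta>)))"
    by (rule tensor_inner_head_slices(1)[OF assms(1) prepend_in[OF assms(2)]])
  also have "\<dots> = (\<Sum>\<^sub>\<infinity>j\<in>{i}. tensor_inner (head_slice j \<xi>) \<eta>)"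
    by (rule infsum_cong_neutral) (auto simp: head_slice_prepend)
  finally show ?thesis by simp
qed

lemma id_tensor_prepend: "A (\<lambda>_. 0) = (\<lambda>_. 0) \<Longrightarrow> id_tensor A (prepend i \<xi>) = prepend i (A \<xi>)"
  by (rule ext) (auto simp: tensor_left_def unit_vector_def id_tensor_def split: list.split)

text \<open>Moving \<open>T\<close> to the basis vector on the other side of the inner product
  avoids expanding \<open>g\<close> in the basis: the entry pairs \<open>T (basis [i, k])\<close>
  with \<open>g\<close>, and their supports meet only in lists \<open>[j, l]\<close> with
  \<open>l\<close> in \<open>L\<close>.\<close>

lemma matrix_apply:
  assumes sa: "selfadjoint_on_pairs T"
    and fin: "finite L" "\<And>l. l \<notin> L \<Longrightarrow> t_coeff T j l i k = 0"
    and g: "g \<in> tensor_power 2" "\<And>j' l. j' \<noteq> j \<Longrightarrow> g [j', l] = 0"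
  shows "T g [i, k] = (\<Sum>l\<in>L. t_coeff T j l i k * g [j, l])"
proof -
  have b: "basis [a, b] \<in> tensor_power 2" for a b
    using basis_in_tensor_power[of "[a, b]"] by (simp add: numeral_2_eq_2)
  have s: "tensor_inner (T \<xi>) \<eta> = tensor_inner \<xi> (T \<eta>)" if "\<xi> \<in> tensor_power 2" "\<eta> \<in> tensor_power 2" for \<xi> \<eta>
    using sa that by (simp add: selfadjoint_on_pairs_def)
  have col: "cnj (T (basis [i, k]) [j, l]) = t_coeff T j l i k" for l
  proof -
    have "T (basis [i, k]) [j, l] = tensor_inner (T (basis [j, l])) (basis [i, k])"
      unfolding s[OF b b] by (simp add: tensor_inner_basis)
    then show ?thesis
      by (subst (asm) tensor_inner_commute) (simp add: tensor_inner_basis t_coeff_def)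
  qed
  have "T g [i, k] = tensor_inner (T (basis [i, k])) g"
    unfolding s[OF b g(1)] by (simp add: tensor_inner_basis)
  also have "\<dots> = (\<Sum>\<^sub>\<infinity>xs\<in>(\<lambda>l. [j, l]) ` L. cnj (T (basis [i, k]) xs) * g xs)"
    unfolding tensor_inner_def
  proof (rule infsum_cong_neutral)
    fix x assume x: "x \<in> UNIV - (\<lambda>l. [j, l]) ` L"
    show "cnj (T (basis [i, k]) x) * g x = 0"
    proof (cases "length x = 2")
      case True
      then obtain a l where xl: "x = [a, l]" by (auto simp: numeral_2_eq_2 length_Suc_conv)
      show ?thesis
      proof (cases "a = j")
        case True
        then have "l \<notin> L" using x xl by auto
        then show ?thesis using col[of l] fin(2) True xl by simp
      qed (simp add: xl g(2))
    qed (simp add: tensor_power_supp[OF g(1)])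
  qed auto
  also have "\<dots> = (\<Sum>l\<in>L. cnj (T (basis [i, k]) [j, l]) * g [j, l])"
    using fin(1) by (simp add: sum.reindex inj_on_def)
  finally show ?thesis by (simp add: col)
qed

text \<open>Commutation rule at the level of tensors. By \<open>R_op_Suc\<close>, R^(n+1) sends e_j
  \<otimes> \<xi> to itself plus T_1 applied to e_j \<otimes> R^(n) \<xi>; reading off the slice at
  \<open>i\<close> produces the coefficients of T.\<close>

lemma R_op_prepend:
  assumes T: "tensor_bounded 2 T" and sa: "selfadjoint_on_pairs T"
    and fin: "finite {(k, l). t_coeff T j l i k \<noteq> 0}" and \<xi>: "\<xi> \<in> tensor_power n"
  shows "head_slice i (R_op T (Suc n) (prepend j \<xi>)) =
    (\<lambda>xs. (if i = j then \<xi> xs else 0) +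
      (\<Sum>(k, l)\<in>{(k, l). t_coeff T j l i k \<noteq> 0}. t_coeff T j l i k *
        prepend k (head_slice l (R_op T n \<xi>)) xs))"
proof
  fix ys
  let ?S = "{(k, l). t_coeff T j l i k \<noteq> 0}" and ?\<eta> = "R_op T n \<xi>"
  note Rb = tensor_bounded_R_op[OF T, of n]
  have "head_slice i (R_op T (Suc n) (prepend j \<xi>)) ys =
      (if i = j then \<xi> ys else 0) + leg T (Suc 0) (prepend j ?\<eta>) (i # ys)"
    by (simp add: R_op_Suc[OF T prepend_in[OF \<xi>]] head_slice_def id_tensor_prepend[of "R_op T n", OF tensor_boundedD(5)[OF Rb]])
  also have "leg T (Suc 0) (prepend j ?\<eta>) (i # ys) =
      (\<Sum>(k, l)\<in>?S. t_coeff T j l i k * prepend k (head_slice l ?\<eta>) ys)"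
  proof (cases ys)
    case (Cons k v)
    show ?thesis
    proof (cases n)
      case 0
      then have z: "?\<eta> = (\<lambda>_. 0)" by (simp add: R_op_def)
      have "pair_slice v (prepend j ?\<eta>) = (\<lambda>_. 0)"
        by (auto simp: z pair_slice_def tensor_left_def split: list.split)
      then show ?thesis
        using Cons by (auto simp: leg_one tensor_boundedD(5)[OF T] z head_slice_def
            intro!: sum.neutral)
    next
      case (Suc m)
      let ?L = "{l. t_coeff T j l i k \<noteq> 0}"
      have "?L = snd ` (?S \<inter> {p. fst p = k})" by force
      then have finL: "finite ?L" using fin by simp
      have "leg T (Suc 0) (prepend j ?\<eta>) (i # ys) = T (pair_slice v (prepend j ?\<eta>)) [i, k]"
        using Cons by (simp add: leg_one numeral_2_eq_2)
      also have "\<dots> = (\<Sum>l\<in>?L. t_coeff T j l i k * pair_slice v (prepend j ?\<eta>) [j, l])"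
      proof (rule matrix_apply[OF sa finL])
        show "pair_slice v (prepend j ?\<eta>) \<in> tensor_power 2"
          using Suc by (intro pair_slice_in[of "Suc n"] prepend_in tensor_boundedD(1)[OF Rb] \<xi>) simp
      qed (auto simp: pair_slice_def)
      also have "\<dots> = (\<Sum>l\<in>?L. t_coeff T j l i k * ?\<eta> (l # v))"
        by (simp add: pair_slice_def)
      also have "\<dots> = (\<Sum>p\<in>Pair k ` ?L. case p of (k', l) \<Rightarrow>
          t_coeff T j l i k' * prepend k' (head_slice l ?\<eta>) ys)"
        by (subst sum.reindex) (auto simp: inj_on_def Cons head_slice_def)
      \<comment> \<open>Since \<open>ys\<close> begins with \<open>k\<close>, only pairs with first
        entry \<open>k\<close> contribute, so the sum may run over all of \<open>?S\<close>.\<close>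
      also have "\<dots> = (\<Sum>p\<in>?S. case p of (k', l) \<Rightarrow>
          t_coeff T j l i k' * prepend k' (head_slice l ?\<eta>) ys)"
        using fin by (intro sum.mono_neutral_left) (auto simp: Cons)
      finally show ?thesis .
    qed
  qed (auto simp: leg_one intro!: sum.neutral)
  finally show "head_slice i (R_op T (Suc n) (prepend j \<xi>)) ys = (if i = j then \<xi> ys else 0) +
      (\<Sum>(k, l)\<in>?S. t_coeff T j l i k * prepend k (head_slice l ?\<eta>) ys)" .
qed

section \<open>The shift on tensors and its commutation with R and P\<close>

definition unshift :: "tensor \<Rightarrow> tensor" where
  "unshift \<xi> = (\<lambda>xs. \<xi> (map (\<lambda>i. i + 1) xs))"

lemma shift_unshift: "shift (unshift \<xi>) = \<xi>" "unshift (shift \<xi>) = \<xi>"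
  by (simp_all add: shift_def unshift_def comp_def)

lemma bij_shift_index: "bij (map (\<lambda>i :: int. i - 1))"
  by (rule o_bij[of "map (\<lambda>i. i + 1)"]) (auto simp: comp_def)

lemma bij_unshift_index: "bij (map (\<lambda>i :: int. i + 1))"
  by (rule o_bij[of "map (\<lambda>i. i - 1)"]) (auto simp: comp_def)

lemma shift_in: "\<xi> \<in> tensor_power n \<Longrightarrow> shift \<xi> \<in> tensor_power n"
  using summable_on_reindex_bij_betw[OF bij_shift_index, of "\<lambda>xs. (cmod (\<xi> xs))\<^sup>2"]
  by (simp add: tensor_power_def shift_def)

lemma unshift_in: "\<xi> \<in> tensor_power n \<Longrightarrow> unshift \<xi> \<in> tensor_power n"
  using summable_on_reindex_bij_betw[OF bij_unshift_index, of "\<lambda>xs. (cmod (\<xi> xs))\<^sup>2"]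
  by (simp add: tensor_power_def unshift_def)

lemma tensor_inner_shift: "tensor_inner (shift \<xi>) (shift \<eta>) = tensor_inner \<xi> \<eta>"
  using infsum_reindex_bij_betw[OF bij_shift_index, of "\<lambda>xs. cnj (\<xi> xs) * \<eta> xs"]
  by (simp add: tensor_inner_def shift_def)

lemma head_slice_shift: "head_slice i (shift \<xi>) = shift (head_slice (i - 1) \<xi>)"
  by (simp add: head_slice_def shift_def)

lemma prepend_shift: "shift (prepend i \<xi>) = prepend (i + 1) (shift \<xi>)"
  by (auto simp: shift_def tensor_left_def unit_vector_def fun_eq_iff split: list.split)

lemma id_tensor_shift:
  assumes "\<And>\<xi>. \<xi> \<in> tensor_power n \<Longrightarrow> A (shift \<xi>) = shift (A \<xi>)" and \<xi>: "\<xi> \<in> tensor_power (Suc n)"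
  shows "id_tensor A (shift \<xi>) = shift (id_tensor A \<xi>)"
proof
  fix xs show "id_tensor A (shift \<xi>) xs = shift (id_tensor A \<xi>) xs"
    using assms(1)[OF head_slice_in[OF \<xi>]]
    by (cases xs) (auto simp: id_tensor_apply shift_def head_slice_shift[unfolded shift_def])
qed

context
  fixes T :: "tensor \<Rightarrow> tensor"
  assumes T: "tensor_bounded 2 T"
    and comm: "\<And>\<xi>. \<xi> \<in> tensor_power 2 \<Longrightarrow> T (shift \<xi>) = shift (T \<xi>)"
begin

lemma leg_one_shift:
  assumes "2 \<le> n" "\<xi> \<in> tensor_power n"
  shows "leg T (Suc 0) (shift \<xi>) = shift (leg T (Suc 0) \<xi>)"
proof
  fix xs
  have "pair_slice v (shift \<xi>) = shift (pair_slice (map (\<lambda>i. i - 1) v) \<xi>)" for v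
    by (auto simp: pair_slice_def shift_def)
  then have "T (pair_slice v (shift \<xi>)) ys = T (pair_slice (map (\<lambda>i. i - 1) v) \<xi>) (map (\<lambda>i. i - 1) ys)" for v ys
    using comm[OF pair_slice_in[OF assms]] by (simp add: shift_def)
  then show "leg T (Suc 0) (shift \<xi>) xs = shift (leg T (Suc 0) \<xi>) xs"
    by (simp add: leg_one shift_def[of "leg T (Suc 0) \<xi>"] take_map drop_map)
qed

lemma R_op_shift: "\<xi> \<in> tensor_power n \<Longrightarrow> R_op T n (shift \<xi>) = shift (R_op T n \<xi>)"
proof (induction n arbitrary: \<xi>)
  case 0
  show ?case by (simp add: R_op_def shift_def)
next
  case (Suc n)
  have eq: "id_tensor (R_op T n) (shift \<xi>) = shift (id_tensor (R_op T n) \<xi>)"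
    by (rule id_tensor_shift[of n "R_op T n", OF Suc.IH Suc.prems])
  have "leg T (Suc 0) (id_tensor (R_op T n) (shift \<xi>)) = shift (leg T (Suc 0) (id_tensor (R_op T n) \<xi>))"
  proof (cases n)
    case 0
    have "leg T (Suc 0) \<eta> = (\<lambda>_. 0)" if "\<eta> \<in> tensor_power 1" for \<eta>
    proof -
      have "pair_slice v \<eta> = (\<lambda>_. 0)" for v
        using tensor_power_supp[OF that] by (auto simp: pair_slice_def)
      then show ?thesis by (intro ext) (simp add: leg_one tensor_boundedD(5)[OF T])
    qed
    moreover have "id_tensor (R_op T n) \<eta> \<in> tensor_power 1" if "\<eta> \<in> tensor_power (Suc n)" for \<eta>
      using tensor_boundedD(1)[OF tensor_bounded_id_tensor[OF tensor_bounded_R_op[OF T]] that] 0 by simp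
    ultimately show ?thesis using Suc.prems shift_in by (simp add: shift_def[of "\<lambda>_. 0"])
  next
    case (Suc m)
    have "id_tensor (R_op T n) \<xi> \<in> tensor_power (Suc n)"
      by (rule tensor_boundedD(1)[OF tensor_bounded_id_tensor[OF tensor_bounded_R_op[OF T]] Suc.prems])
    then show ?thesis
      unfolding eq using Suc by (intro leg_one_shift[of "Suc n"]) auto
  qed
  then show ?case
    using Suc.prems shift_in[OF Suc.prems] by (simp add: R_op_Suc[OF T] shift_def)
qed

lemma P_op_shift: "\<xi> \<in> tensor_power n \<Longrightarrow> P_op T n (shift \<xi>) = shift (P_op T n \<xi>)"
proof (induction n arbitrary: \<xi>)
  case (Suc n)
  have "R_op T (Suc n) \<xi> \<in> tensor_power (Suc n)"
    by (rule tensor_boundedD(1)[OF tensor_bounded_R_op[OF T] Suc.prems])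
  from id_tensor_shift[of n "P_op T n", OF Suc.IH this] show ?case
    by (simp add: R_op_shift[OF Suc.prems])
qed simp

end

section \<open>Ladder operators on the deformed Fock space\<close>

lemma blinfun_compose_assoc: "(A o\<^sub>L B) o\<^sub>L C = A o\<^sub>L (B o\<^sub>L C)"
  by (rule blinfun_eqI) simp

lemma sum_compose_left: "(\<Sum>i\<in>I. f i) o\<^sub>L B = (\<Sum>i\<in>I. f i o\<^sub>L B)"
  by (rule blinfun_eqI) (simp add: blinfun.sum_left)

lemma add_compose_left: "(A + B) o\<^sub>L C = (A o\<^sub>L C) + (B o\<^sub>L C)"
  by (rule blinfun_eqI) (simp add: blinfun.add_left)

lemma compose_zero [simp]: "A o\<^sub>L 0 = 0"
  by (rule blinfun_eqI) (simp add: blinfun.bilinear_simps)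

locale deformed_fock =
  fixes T :: "tensor \<Rightarrow> tensor" and J :: "tensor \<Rightarrow> 'h::complex_hilbert_space"
  assumes hecke: "yang_baxter_hecke_operator T"
    and finite_coeffs: "\<And>i j. finite {(k, l). t_coeff T j l i k \<noteq> 0}"
    and T_shift: "\<And>\<xi>. \<xi> \<in> tensor_power 2 \<Longrightarrow> T (shift \<xi>) = shift (T \<xi>)"
    and fock: "deformed_fock_space T J"
begin

lemmas T_bounded = hecke_bounded[OF hecke]

lemma T_selfadjoint: "selfadjoint_on_pairs T"
  using hecke by (simp add: yang_baxter_hecke_operator_def yang_baxter_operator_def)

lemmas P_bounded = tensor_bounded_P_op[OF T_bounded]
lemmas R_bounded = tensor_bounded_R_op[OF T_bounded]
lemmas P_in = tensor_boundedD(1)[OF P_bounded]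
lemmas R_in = tensor_boundedD(1)[OF R_bounded]

lemma J_add: "\<xi> \<in> tensor_power n \<Longrightarrow> \<eta> \<in> tensor_power n \<Longrightarrow> J (\<lambda>xs. \<xi> xs + \<eta> xs) = J \<xi> + J \<eta>"
  and J_scale: "\<xi> \<in> tensor_power n \<Longrightarrow> J (\<lambda>xs. c * \<xi> xs) = c *\<^sub>C J \<xi>"
  and J_inner: "\<xi> \<in> tensor_power m \<Longrightarrow> \<eta> \<in> tensor_power n \<Longrightarrow>
    cinner (J \<xi>) (J \<eta>) = (if m = n then tensor_inner \<xi> (P_op T n \<eta>) else 0)"
  and J_dense: "closure (span (\<Union>n. J ` tensor_power n)) = UNIV"
  using fock unfolding deformed_fock_space_def by blast+

lemma J_zero: "J (\<lambda>_. 0) = 0"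
  using J_scale[OF tensor_power_zero[of 0], of 0] by simp

lemma J_sum: "(\<And>i. i \<in> I \<Longrightarrow> \<xi> i \<in> tensor_power n) \<Longrightarrow> J (\<lambda>xs. \<Sum>i\<in>I. \<xi> i xs) = (\<Sum>i\<in>I. J (\<xi> i))"
proof (induction I rule: infinite_finite_induct)
  case (insert i I)
  then have "J (\<lambda>xs. \<xi> i xs + (\<Sum>i\<in>I. \<xi> i xs)) = J (\<xi> i) + J (\<lambda>xs. \<Sum>i\<in>I. \<xi> i xs)"
    by (intro J_add[where n = n] tensor_power_sum) auto
  then show ?case using insert by simp
qed (simp_all add: J_zero)

lemma J_norm: "\<xi> \<in> tensor_power n \<Longrightarrow> (norm (J \<xi>))\<^sup>2 = Re (tensor_inner \<xi> (P_op T n \<xi>))"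
  by (simp add: Re_cinner_self[symmetric] J_inner)

text \<open>Inherited from the Fock space, where the form of \<open>P_op T n\<close> is the inner
  product of the vectors \<open>J \<xi>\<close>. Positivity is obtained in the same way.\<close>

lemma P_hermitian:
  assumes "\<xi> \<in> tensor_power n" "\<eta> \<in> tensor_power n"
  shows "tensor_inner (P_op T n \<xi>) \<eta> = tensor_inner \<xi> (P_op T n \<eta>)"
proof -
  have "tensor_inner \<xi> (P_op T n \<eta>) = cinner (J \<xi>) (J \<eta>)" using assms by (simp add: J_inner)
  also have "\<dots> = cnj (tensor_inner \<eta> (P_op T n \<xi>))"
    using assms by (subst cinner_commute) (simp add: J_inner)
  also have "\<dots> = tensor_inner (P_op T n \<xi>) \<eta>" by (rule tensor_inner_commute[symmetric])
  finally show ?thesis by simp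
qed

lemma P_positive: "\<xi> \<in> tensor_power n \<Longrightarrow> 0 \<le> Re (tensor_inner \<xi> (P_op T n \<xi>))"
  using J_norm[of \<xi> n] by (metis zero_le_power2)

text \<open>The estimate behind everything analytic. \<open>form_bound\<close> is used with I
  \<otimes> \<open>P_op T n\<close> as the form and \<open>R_op T (Suc n)\<close> as the symmetric
  operator; their composite is \<open>P_op T (Suc n)\<close>. On the tensor assembled from the
  slices \<open>\<eta> i\<close>, the form of I \<otimes> \<open>P_op T n\<close> is the sum of the
  squared norms.\<close>

lemma ex_creation_bound:
  "\<exists>C\<ge>0. \<forall>F \<eta>. finite F \<longrightarrow> (\<forall>i. \<eta> i \<in> tensor_power n) \<longrightarrow>
    (norm (J (\<lambda>xs. \<Sum>i\<in>F. prepend i (\<eta> i) xs)))\<^sup>2 \<le> C * (\<Sum>i\<in>F. (norm (J (\<eta> i)))\<^sup>2)"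
proof -
  let ?A = "id_tensor (P_op T n)" and ?R = "R_op T (Suc n)"
  have AR: "P_op T (Suc n) \<xi> = ?A (?R \<xi>)" for \<xi> by simp
  obtain C where C: "0 \<le> C" "\<And>\<zeta>. \<zeta> \<in> tensor_power (Suc n) \<Longrightarrow>
      Re (tensor_inner \<zeta> (?A (?R \<zeta>))) \<le> C * Re (tensor_inner \<zeta> (?A \<zeta>))"
  proof (rule form_bound[of "Suc n" ?A ?R])
    show "tensor_inner (?A (?R \<xi>)) \<eta> = tensor_inner \<xi> (?A (?R \<eta>))"
      if "\<xi> \<in> tensor_power (Suc n)" "\<eta> \<in> tensor_power (Suc n)" for \<xi> \<eta>
      unfolding AR[symmetric] by (rule P_hermitian[OF that])
  qed (use tensor_bounded_id_tensor[OF P_bounded] R_bounded hermitian_id_tensor[OF P_bounded P_hermitian]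
      positive_id_tensor[OF P_bounded P_positive] in auto)
  have "(norm (J (\<lambda>xs. \<Sum>i\<in>F. prepend i (\<eta> i) xs)))\<^sup>2 \<le> C * (\<Sum>i\<in>F. (norm (J (\<eta> i)))\<^sup>2)"
    if F: "finite F" and \<eta>: "\<And>i. \<eta> i \<in> tensor_power n" for F \<eta>
  proof -
    define \<zeta> where "\<zeta> = (\<lambda>xs. \<Sum>i\<in>F. prepend i (\<eta> i) xs)"
    have \<zeta>: "\<zeta> \<in> tensor_power (Suc n)"
      unfolding \<zeta>_def by (intro tensor_power_sum prepend_in \<eta>)
    have A\<zeta>: "?A \<zeta> \<in> tensor_power (Suc n)"
      by (rule tensor_boundedD(1)[OF tensor_bounded_id_tensor[OF P_bounded] \<zeta>])
    have sl: "head_slice j \<zeta> = (if j \<in> F then \<eta> j else (\<lambda>_. 0))" for j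
      using F by (auto simp: \<zeta>_def head_slice_def sum.delta' fun_eq_iff)
    have "tensor_inner \<zeta> (?A \<zeta>) = (\<Sum>\<^sub>\<infinity>j\<in>F. tensor_inner (\<eta> j) (P_op T n (\<eta> j)))"
      unfolding tensor_inner_head_slices(1)[OF \<zeta> A\<zeta>] head_slice_id_tensor
      by (rule infsum_cong_neutral) (auto simp: sl)
    also have "\<dots> = (\<Sum>j\<in>F. tensor_inner (\<eta> j) (P_op T n (\<eta> j)))" using F by simp
    finally have "Re (tensor_inner \<zeta> (?A \<zeta>)) = (\<Sum>i\<in>F. (norm (J (\<eta> i)))\<^sup>2)"
      by (simp add: J_norm[OF \<eta>])
    moreover have "(norm (J \<zeta>))\<^sup>2 = Re (tensor_inner \<zeta> (?A (?R \<zeta>)))"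
      unfolding J_norm[OF \<zeta>] AR ..
    ultimately show ?thesis using C(2)[OF \<zeta>] by (simp add: \<zeta>_def)
  qed
  then show ?thesis using C(1) by blast
qed

subsection \<open>Particle spaces\<close>

abbreviation "E \<equiv> particle_projection J"

lemma particle_space_subspace: "complex_subspace (particle_space J n)"
  unfolding particle_space_def
proof (rule complex_subspace_closure)
  have "c *\<^sub>C x \<in> J ` tensor_power n" if "x \<in> J ` tensor_power n" for c x
  proof -
    obtain \<xi> where "\<xi> \<in> tensor_power n" "x = J \<xi>" using \<open>x \<in> J ` tensor_power n\<close> by blast
    then show ?thesis using J_scale[of \<xi> n c] tensor_power_scale[of \<xi> n c] by (metis imageI)
  qed
  moreover from this have "r *\<^sub>R x \<in> J ` tensor_power n" if "x \<in> J ` tensor_power n" for r :: real and x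
    using that by (metis scaleC_of_real)
  moreover have "x + y \<in> J ` tensor_power n" if xy: "x \<in> J ` tensor_power n" "y \<in> J ` tensor_power n" for x y
  proof -
    obtain \<xi> \<eta> where "\<xi> \<in> tensor_power n" "x = J \<xi>" "\<eta> \<in> tensor_power n" "y = J \<eta>" using xy by blast
    then have "x + y = J (\<lambda>xs. \<xi> xs + \<eta> xs)" "(\<lambda>xs. \<xi> xs + \<eta> xs) \<in> tensor_power n"
      by (simp_all add: J_add[of \<xi> n] tensor_power_add)
    then show ?thesis by blast
  qed
  moreover have "0 \<in> J ` tensor_power n"
    using J_zero tensor_power_zero by (metis imageI)
  ultimately show "complex_subspace (J ` tensor_power n)"
    by (simp add: complex_subspace_def subspace_def)
qed

lemma particle_space_closed: "closed (particle_space J n)"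
  by (simp add: particle_space_def)

lemmas particle_space_props = particle_space_subspace particle_space_closed

lemma J_in_particle_space: "\<xi> \<in> tensor_power n \<Longrightarrow> J \<xi> \<in> particle_space J n"
  unfolding particle_space_def by (rule subsetD[OF closure_subset imageI])

text \<open>Resolves the definite description: for a selfadjoint idempotent with range the particle
  space, the error is orthogonal to the range, and this determines the orthogonal
  projection.\<close>

lemma particle_projection_apply: "E n x = orthogonal_projection (particle_space J n) x"
  and E_bounded: "E n \<in> bounded_operators"
  and E_adj: "adj (E n) = E n"
proof -
  let ?M = "particle_space J n"
  let ?P = "\<lambda>p. p \<in> bounded_operators \<and> p o\<^sub>L p = p \<and> adj p = p \<and> range (blinfun_apply p) = ?M"
  define p where "p = Blinfun (orthogonal_projection ?M)"
  note M = particle_space_props[of n]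
  have pa: "p x = orthogonal_projection ?M x" for x
    unfolding p_def bounded_linear_Blinfun_apply[OF bounded_linear_orthogonal_projection[OF M]] ..
  have pB: "p \<in> bounded_operators"
    by (simp add: bounded_operators_def pa orthogonal_projection_scaleC[OF M])
  have orth: "cinner x y = cinner x (orthogonal_projection ?M y)" if "x \<in> ?M" for x y
    using orthogonal_projection_orth[OF M that, of y] by (simp add: cinner_diff_right)
  have adjp: "adj p = p"
  proof (rule adj_eqI[OF pB pB])
    fix x y
    have "cinner (p x) y = cinner (p x) (p y)"
      using orth[OF orthogonal_projection_mem[OF M]] by (simp add: pa)
    also have "\<dots> = cnj (cinner (p y) (p x))" by (rule cinner_commute)
    also have "cinner (p y) (p x) = cinner (p y) x"
      using orth[OF orthogonal_projection_mem[OF M]] by (simp add: pa)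
    finally show "cinner (p x) y = cinner x (p y)" by (simp add: cinner_commute[of x])
  qed
  moreover have "range (blinfun_apply p) = ?M"
  proof (intro subset_antisym subsetI)
    fix x assume "x \<in> ?M"
    from orthogonal_projection_ident[OF M this, symmetric]
    show "x \<in> range (blinfun_apply p)" by (intro range_eqI[of _ _ x]) (simp add: pa)
  qed (auto simp: pa orthogonal_projection_mem[OF M])
  moreover have "p o\<^sub>L p = p"
    by (rule blinfun_eqI) (simp add: pa orthogonal_projection_ident[OF M orthogonal_projection_mem[OF M]])
  ultimately have "?P p" using pB adjp by blast
  moreover have "p' = p" if p': "?P p'" for p'
  proof (rule blinfun_eqI)
    fix x
    have "orthogonal_projection ?M x = p' x"
    proof (rule orthogonal_projection_eqI[OF M])
      show "p' x \<in> ?M" using p' by blast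
      fix z assume "z \<in> ?M"
      then obtain w where w: "z = p' w" using p' by blast
      have "p' (p' x) = p' x" using p' by (metis blinfun_apply_blinfun_compose)
      then have "cinner w (p' (x - p' x)) = 0" by (simp add: blinfun.diff_right)
      then show "cinner z (x - p' x) = 0" using p' w adj_left by metis
    qed
    then show "p' x = p x" by (simp add: pa)
  qed
  ultimately have "E n = p" unfolding particle_projection_def by (rule the_equality)
  then show "E n x = orthogonal_projection ?M x" "E n \<in> bounded_operators" "adj (E n) = E n"
    by (simp_all add: pa pB adjp)
qed

lemma E_in: "E n x \<in> particle_space J n"
  by (simp add: particle_projection_apply orthogonal_projection_mem[OF particle_space_props])

lemma E_ident: "x \<in> particle_space J n \<Longrightarrow> E n x = x"
  by (simp add: particle_projection_apply orthogonal_projection_ident[OF particle_space_props])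

lemma E_eq_0:
  assumes "\<And>\<xi>. \<xi> \<in> tensor_power n \<Longrightarrow> cinner (J \<xi>) z = 0" shows "E n z = 0"
  unfolding particle_projection_apply
proof (rule orthogonal_projection_eqI[OF particle_space_props])
  show "0 \<in> particle_space J n"
    using particle_space_subspace by (simp add: complex_subspace_def subspace_0)
  have "closed {x. cinner x z = 0}" by (intro closed_Collect_eq continuous_intros)
  then have "particle_space J n \<subseteq> {x. cinner x z = 0}"
    unfolding particle_space_def using assms by (intro closure_minimal) auto
  then show "cinner x (z - 0) = 0" if "x \<in> particle_space J n" for x using that by auto
qed

lemma E_J: "\<xi> \<in> tensor_power m \<Longrightarrow> E n (J \<xi>) = (if m = n then J \<xi> else 0)"
  by (cases "m = n") (simp_all add: E_ident J_in_particle_space E_eq_0 J_inner)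

lemma E_minus_E: "\<xi> \<in> tensor_power n \<Longrightarrow> cinner (J \<xi>) (x - E n x) = 0"
  unfolding particle_projection_apply
  by (rule orthogonal_projection_orth[OF particle_space_props J_in_particle_space])

lemma agree_on_particle_space:
  fixes f g :: "'h \<Rightarrow> 'b::real_normed_vector"
  assumes "continuous_on (particle_space J n) f" "continuous_on (particle_space J n) g"
    and "\<And>\<xi>. \<xi> \<in> tensor_power n \<Longrightarrow> f (J \<xi>) = g (J \<xi>)" and x: "x \<in> particle_space J n"
  shows "f x = g x"
proof -
  have "\<exists>s. (\<forall>k. s k \<in> J ` tensor_power n) \<and> s \<longlonglongrightarrow> x"
    using x by (simp only: particle_space_def closure_sequential)
  then obtain s where s: "\<forall>k. s k \<in> J ` tensor_power n" "s \<longlonglongrightarrow> x" by blast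
  have "J ` tensor_power n \<subseteq> particle_space J n" using J_in_particle_space by auto
  then have s': "\<forall>k. s k \<in> particle_space J n" using s(1) by blast
  have "(\<lambda>k. f (s k)) \<longlonglongrightarrow> f x"
    using assms(1) s' s(2) x unfolding continuous_on_sequentially by (auto simp: o_def)
  moreover have "(\<lambda>k. g (s k)) \<longlonglongrightarrow> g x"
    using assms(2) s' s(2) x unfolding continuous_on_sequentially by (auto simp: o_def)
  moreover have "f (s k) = g (s k)" for k
  proof -
    obtain \<xi> where "\<xi> \<in> tensor_power n" "s k = J \<xi>" using s(1) by blast
    then show ?thesis using assms(3) by simp
  qed
  ultimately show ?thesis by (simp add: LIMSEQ_unique)
qed

text \<open>Operators that absorb \<open>E n\<close> on the right see only the particle space, and
  there the vectors \<open>J \<xi>\<close> are dense.\<close>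

lemma block_eqI:
  assumes "A o\<^sub>L E n = A" "B o\<^sub>L E n = B"
    and "\<And>\<xi>. \<xi> \<in> tensor_power n \<Longrightarrow> blinfun_apply A (J \<xi>) = B (J \<xi>)"
  shows "A = B"
proof (rule blinfun_eqI)
  fix x
  have "A (E n x) = B (E n x)"
    by (rule agree_on_particle_space[where f = "blinfun_apply A" and g = "blinfun_apply B" and n = n])
      (intro continuous_intros assms(3) E_in; assumption)+
  then show "A x = B x" by (metis assms(1,2) blinfun_apply_blinfun_compose)
qed

lemma fock_dense_eq:
  fixes f g :: "'h \<Rightarrow> 'b::real_normed_vector"
  assumes "bounded_linear f" "bounded_linear g"
    and "\<And>n \<xi>. \<xi> \<in> tensor_power n \<Longrightarrow> f (J \<xi>) = g (J \<xi>)"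
  shows "f x = g x"
proof -
  interpret f: bounded_linear f by fact
  interpret g: bounded_linear g by fact
  have "subspace {x. f x = g x}"
    by (auto simp: subspace_def f.zero g.zero f.add g.add f.scale g.scale)
  then have "span (\<Union>n. J ` tensor_power n) \<subseteq> {x. f x = g x}"
    using assms(3) by (intro span_minimal) auto
  moreover have "closed {x. f x = g x}"
    by (intro closed_Collect_eq f.continuous_on g.continuous_on continuous_intros)
  ultimately have "closure (span (\<Union>n. J ` tensor_power n)) \<subseteq> {x. f x = g x}"
    by (rule closure_minimal)
  then show ?thesis using J_dense by auto
qed

lemma operator_eqI:
  assumes "\<And>n \<xi>. \<xi> \<in> tensor_power n \<Longrightarrow> blinfun_apply A (J \<xi>) = blinfun_apply B (J \<xi>)"
  shows "A = B"
  by (rule blinfun_eqI, rule fock_dense_eq[OF blinfun.bounded_linear_right blinfun.bounded_linear_right assms])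

lemma E_idem: "E n o\<^sub>L E n = E n"
  by (rule blinfun_eqI) (simp add: E_ident[OF E_in])

lemma E_orth: "m \<noteq> n \<Longrightarrow> E m o\<^sub>L E n = 0"
proof -
  assume "m \<noteq> n"
  have "E m o\<^sub>L E n = (0 :: 'h \<Rightarrow>\<^sub>L 'h)"
    by (rule block_eqI[of _ n]) (use \<open>m \<noteq> n\<close> in \<open>auto simp: E_J E_idem blinfun_compose_assoc\<close>)
  then show ?thesis .
qed

subsection \<open>Blocks of the ladder operators\<close>

text \<open>A creation operator cut down to a single particle space, where it is bounded. The clause
  on orthogonal vectors makes it vanish on all other degrees, so that it absorbs \<open>E n\<close>;
  together the clauses determine the operator.\<close>

definition cre :: "nat \<Rightarrow> int \<Rightarrow> 'h \<Rightarrow>\<^sub>L 'h" where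
  "cre n i = (SOME A. A \<in> bounded_operators \<and> (\<forall>\<xi>\<in>tensor_power n. A (J \<xi>) = J (prepend i \<xi>)) \<and>
     (\<forall>z. (\<forall>\<xi>\<in>tensor_power n. cinner (J \<xi>) z = 0) \<longrightarrow> A z = 0))"

lemma cre_bounded: "cre n i \<in> bounded_operators"
  and cre_J: "\<xi> \<in> tensor_power n \<Longrightarrow> cre n i (J \<xi>) = J (prepend i \<xi>)"
  and cre_orth: "(\<And>\<xi>. \<xi> \<in> tensor_power n \<Longrightarrow> cinner (J \<xi>) z = 0) \<Longrightarrow> cre n i z = 0"
proof -
  obtain C where C: "C \<ge> 0" "\<And>F \<eta>. finite F \<Longrightarrow> (\<And>i. \<eta> i \<in> tensor_power n) \<Longrightarrow>
    (norm (J (\<lambda>xs. \<Sum>i\<in>F. prepend i (\<eta> i) xs)))\<^sup>2 \<le> C * (\<Sum>i\<in>F. (norm (J (\<eta> i)))\<^sup>2)"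
    using ex_creation_bound[of n] by blast
  \<comment> \<open>\<open>J\<close> may identify tensors, so the operator is given by its graph;
    that the graph is single-valued comes out of the bound.\<close>
  let ?G = "(\<lambda>\<xi>. (J \<xi>, J (prepend i \<xi>))) ` tensor_power n"
  have cG: "(c *\<^sub>C x, c *\<^sub>C y) \<in> ?G" if "(x, y) \<in> ?G" for c x y
  proof -
    obtain \<xi> where \<xi>: "\<xi> \<in> tensor_power n" "x = J \<xi>" "y = J (prepend i \<xi>)"
      using \<open>(x, y) \<in> ?G\<close> by auto
    have "(c *\<^sub>C x, c *\<^sub>C y) = (J (\<lambda>xs. c * \<xi> xs), J (prepend i (\<lambda>xs. c * \<xi> xs)))"
      unfolding \<xi>(2,3) prepend_linear J_scale[OF \<xi>(1)] J_scale[OF prepend_in[OF \<xi>(1)]] ..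
    then show ?thesis using tensor_power_scale[OF \<xi>(1), of c] by blast
  qed
  have sub: "subspace ?G"
    unfolding subspace_def
  proof (intro conjI ballI allI)
    show "0 \<in> ?G" using cG[of "J (\<lambda>_. 0)" "J (prepend i (\<lambda>_. 0))" 0] tensor_power_zero by (auto simp: zero_prod_def)
    show "p + q \<in> ?G" if "p \<in> ?G" "q \<in> ?G" for p q
    proof -
      obtain \<xi> \<eta> where \<xi>: "\<xi> \<in> tensor_power n" "p = (J \<xi>, J (prepend i \<xi>))"
        and \<eta>: "\<eta> \<in> tensor_power n" "q = (J \<eta>, J (prepend i \<eta>))" using \<open>p \<in> ?G\<close> \<open>q \<in> ?G\<close> by blast
      have "p + q = (J (\<lambda>xs. \<xi> xs + \<eta> xs), J (prepend i (\<lambda>xs. \<xi> xs + \<eta> xs)))"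
        unfolding \<xi>(2) \<eta>(2) prepend_linear J_add[OF \<xi>(1) \<eta>(1)] J_add[OF prepend_in[OF \<xi>(1)] prepend_in[OF \<eta>(1)]]
        by simp
      then show ?thesis using tensor_power_add[OF \<xi>(1) \<eta>(1)] by blast
    qed
    show "r *\<^sub>R p \<in> ?G" if "p \<in> ?G" for r p
      using cG[of "fst p" "snd p" "of_real r"] that by (simp add: scaleC_of_real scaleR_prod_def)
  qed
  have bnd: "norm y \<le> sqrt C * norm x" if "(x, y) \<in> ?G" for x y
  proof -
    obtain \<xi> where \<xi>: "\<xi> \<in> tensor_power n" "x = J \<xi>" "y = J (prepend i \<xi>)"
      using \<open>(x, y) \<in> ?G\<close> by auto
    \<comment> \<open>The row estimate for a single index.\<close>
    have "(norm y)\<^sup>2 \<le> (sqrt C * norm x)\<^sup>2"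
      using C(2)[of "{i}" "\<lambda>_. \<xi>"] \<xi> C(1) by (simp add: power_mult_distrib)
    then show ?thesis by (rule power2_le_imp_le) (simp add: C(1))
  qed
  obtain A where A: "A \<in> bounded_operators" "\<forall>(x, y)\<in>?G. blinfun_apply A x = y"
    "\<forall>z. (\<forall>x\<in>fst ` ?G. cinner x z = 0) \<longrightarrow> A z = 0"
    using bounded_operator_extension[OF sub cG bnd real_sqrt_ge_zero[OF C(1)]] by blast
  have "\<exists>A. A \<in> bounded_operators \<and> (\<forall>\<xi>\<in>tensor_power n. A (J \<xi>) = J (prepend i \<xi>)) \<and>
     (\<forall>z. (\<forall>\<xi>\<in>tensor_power n. cinner (J \<xi>) z = 0) \<longrightarrow> A z = 0)"
  proof (intro exI[of _ A] conjI ballI allI impI)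
    show "A z = 0" if "\<forall>\<xi>\<in>tensor_power n. cinner (J \<xi>) z = 0" for z
      using A(3) that by (auto simp: image_image)
  qed (use A(1,2) in auto)
  from someI_ex[OF this]
  show "cre n i \<in> bounded_operators" "\<xi> \<in> tensor_power n \<Longrightarrow> cre n i (J \<xi>) = J (prepend i \<xi>)"
    "(\<And>\<xi>. \<xi> \<in> tensor_power n \<Longrightarrow> cinner (J \<xi>) z = 0) \<Longrightarrow> cre n i z = 0"
    unfolding cre_def by blast+
qed

lemma cre_E: "cre n i o\<^sub>L E n = cre n i"
proof (rule blinfun_eqI)
  fix x
  have "cre n i (x - E n x) = 0" by (rule cre_orth) (rule E_minus_E)
  then show "(cre n i o\<^sub>L E n) x = cre n i x" by (simp add: blinfun.diff_right)
qed

lemma E_cre: "E (Suc n) o\<^sub>L cre n i = cre n i"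
  by (rule block_eqI[of _ n]) (simp_all add: cre_E blinfun_compose_assoc cre_J E_ident J_in_particle_space prepend_in)

lemma adj_cre_E: "adj (cre n i) o\<^sub>L E (Suc n) = adj (cre n i)"
  using arg_cong[OF E_cre[of n i], of adj] by (simp add: adj_comp E_bounded cre_bounded E_adj)

lemma E_adj_cre: "E n o\<^sub>L adj (cre n i) = adj (cre n i)"
  using arg_cong[OF cre_E[of n i], of adj] by (simp add: adj_comp E_bounded cre_bounded E_adj)

text \<open>Pairing with e_i \<otimes> \<eta> in the form of \<open>P_op T (Suc n)\<close> picks the
  slice at \<open>i\<close> of I \<otimes> \<open>P_op T n\<close> applied to
  \<open>R_op T (Suc n) \<xi>\<close>, and I \<otimes> \<open>P_op T n\<close> acts on that slice as
  \<open>P_op T n\<close>.\<close>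

lemma adj_cre_J:
  assumes \<xi>: "\<xi> \<in> tensor_power (Suc n)"
  shows "adj (cre n i) (J \<xi>) = J (head_slice i (R_op T (Suc n) \<xi>))"
proof -
  let ?x = "adj (cre n i) (J \<xi>)" and ?y = "J (head_slice i (R_op T (Suc n) \<xi>))"
  have hs: "head_slice i (R_op T (Suc n) \<xi>) \<in> tensor_power n"
    by (rule head_slice_in[OF R_in[OF \<xi>]])
  \<comment> \<open>Both vectors lie in the particle space of degree \<open>n\<close>, so testing
    against the vectors \<open>J \<eta>\<close> of that degree decides equality.\<close>
  have "E n (?x - ?y) = 0"
  proof (rule E_eq_0)
    fix \<eta> assume \<eta>: "\<eta> \<in> tensor_power n"
    have "cinner (J \<eta>) ?x = tensor_inner (prepend i \<eta>) (P_op T (Suc n) \<xi>)"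
      by (simp add: adj_right cre_bounded cre_J[OF \<eta>] J_inner[OF prepend_in[OF \<eta>] \<xi>] del: P_op.simps)
    also have "\<dots> = cnj (tensor_inner (P_op T (Suc n) \<xi>) (prepend i \<eta>))" by (rule tensor_inner_commute)
    also have "\<dots> = cnj (tensor_inner (P_op T n (head_slice i (R_op T (Suc n) \<xi>))) \<eta>)"
      using tensor_inner_prepend[OF P_in[OF \<xi>] \<eta>, of i] by (simp add: head_slice_id_tensor)
    also have "\<dots> = cinner (J \<eta>) ?y"
      unfolding J_inner[OF \<eta> hs] by (simp add: tensor_inner_commute[of \<eta>])
    finally show "cinner (J \<eta>) (?x - ?y) = 0" by (simp add: cinner_diff_right)
  qed
  moreover have "E n ?x = ?x" using E_adj_cre by (metis blinfun_apply_blinfun_compose)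
  moreover have "E n ?y = ?y" by (simp add: E_J[OF hs])
  ultimately show ?thesis by (simp add: blinfun.diff_right)
qed

text \<open>The number is the degree of the source. An annihilator leaving degree
  \<open>Suc n\<close> is the adjoint of the creator that enters it, and the clause for degree 0
  kills the vacuum.\<close>

fun block :: "ladder \<Rightarrow> nat \<Rightarrow> 'h \<Rightarrow>\<^sub>L 'h" where
  "block (Create i) n = cre n i"
| "block (Annihilate i) 0 = 0"
| "block (Annihilate i) (Suc n) = adj (cre n i)"

text \<open>The truncated subtraction is harmless: annihilators vanish on the vacuum.\<close>

primrec deg :: "ladder \<Rightarrow> nat \<Rightarrow> nat" where
  "deg (Create i) n = Suc n"
| "deg (Annihilate i) n = n - 1"

lemma block_bounded: "block l n \<in> bounded_operators"
  by (cases "(l, n)" rule: block.cases) (simp_all add: cre_bounded adj_in zero_in_bounded_operators)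

lemma block_E: "block l n o\<^sub>L E n = block l n"
  by (cases "(l, n)" rule: block.cases) (simp_all add: cre_E adj_cre_E)

lemma E_block: "E (deg l n) o\<^sub>L block l n = block l n"
  by (cases "(l, n)" rule: block.cases) (simp_all add: E_cre E_adj_cre)

text \<open>\<open>R_op_prepend\<close> carried over by \<open>J\<close>, with
  \<open>adj_cre_J\<close> translating annihilation into slicing. In degree 0 the truncated
  \<open>n - 1\<close> does no harm, since the annihilator to its right is already 0.\<close>

lemma commutation_rule:
  "block (Annihilate i) (Suc n) o\<^sub>L block (Create j) n =
    (if i = j then E n else 0) +
    (\<Sum>(k, l)\<in>{(k, l). t_coeff T j l i k \<noteq> 0}.
      scale_op (t_coeff T j l i k) (block (Create k) (n - 1) o\<^sub>L block (Annihilate l) n))"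
  (is "?L = ?D + (\<Sum>(k, l)\<in>?S. ?X k l)")
proof (rule block_eqI[of _ n])
  show "?L o\<^sub>L E n = ?L" by (simp add: blinfun_compose_assoc cre_E)
  show "(?D + (\<Sum>(k, l)\<in>?S. ?X k l)) o\<^sub>L E n = ?D + (\<Sum>(k, l)\<in>?S. ?X k l)"
    by (simp add: add_compose_left sum_compose_left E_idem case_prod_unfold scale_op_comp_left
        blinfun_compose_assoc block_E)
  fix \<xi> assume \<xi>: "\<xi> \<in> tensor_power n"
  let ?\<eta> = "\<lambda>k l xs. t_coeff T j l i k * prepend k (head_slice l (R_op T n \<xi>)) xs"
  have X: "?X k l (J \<xi>) = J (?\<eta> k l) \<and> ?\<eta> k l \<in> tensor_power n" for k l
  proof (cases n)
    case 0
    then have "?\<eta> k l = (\<lambda>_. 0)"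
      by (auto simp: R_op_def head_slice_def tensor_left_def split: list.split)
    then show ?thesis using 0 by (simp add: J_zero tensor_power_zero)
  next
    case (Suc m)
    then have \<xi>': "\<xi> \<in> tensor_power (Suc m)" using \<xi> by simp
    have hs: "head_slice l (R_op T (Suc m) \<xi>) \<in> tensor_power m"
      by (rule head_slice_in[OF R_in[OF \<xi>']])
    show ?thesis
      using Suc by (simp add: adj_cre_J[OF \<xi>'] cre_J[OF hs] J_scale[OF prepend_in[OF hs]]
          tensor_power_scale prepend_in[OF hs])
  qed
  have "?L (J \<xi>) = J (head_slice i (R_op T (Suc n) (prepend j \<xi>)))"
    by (simp add: cre_J[OF \<xi>] adj_cre_J[OF prepend_in[OF \<xi>]])
  also have "\<dots> = J (\<lambda>xs. (if i = j then \<xi> xs else 0) + (\<Sum>p\<in>?S. ?\<eta> (fst p) (snd p) xs))"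
    by (simp add: R_op_prepend[OF T_bounded T_selfadjoint finite_coeffs \<xi>] case_prod_unfold)
  also have "\<dots> = J (\<lambda>xs. if i = j then \<xi> xs else 0) + J (\<lambda>xs. \<Sum>p\<in>?S. ?\<eta> (fst p) (snd p) xs)"
  proof (rule J_add[where n = n])
    show "(\<lambda>xs. if i = j then \<xi> xs else 0) \<in> tensor_power n"
      by (cases "i = j") (simp_all add: \<xi> tensor_power_zero)
  qed (use X in \<open>auto intro!: tensor_power_sum\<close>)
  also have "J (\<lambda>xs. if i = j then \<xi> xs else 0) = ?D (J \<xi>)"
    by (simp add: J_zero E_J[OF \<xi>])
  also have "J (\<lambda>xs. \<Sum>p\<in>?S. ?\<eta> (fst p) (snd p) xs) = (\<Sum>p\<in>?S. J (?\<eta> (fst p) (snd p)))"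
    by (rule J_sum) (use X in blast)
  also have "\<dots> = (\<Sum>p\<in>?S. ?X (fst p) (snd p) (J \<xi>))" using X by simp
  finally show "?L (J \<xi>) = (?D + (\<Sum>(k, l)\<in>?S. ?X k l)) (J \<xi>)"
    by (simp add: blinfun.add_left blinfun.sum_left case_prod_unfold del: block.simps)
qed

subsection \<open>Ladder operators on finite particle vectors\<close>

abbreviation "FP \<equiv> finite_particle_space J"

lemma particle_space_FP: "x \<in> particle_space J n \<Longrightarrow> x \<in> FP"
  unfolding finite_particle_space_def by (rule span_base) blast

lemma FP_subspace: "subspace FP"
  by (simp add: finite_particle_space_def)

text \<open>The span is algebraic, so only finitely many degrees occur; this is what makes the sum
  in \<open>ladder_ext\<close> finite.\<close>

lemma FP_decomp:
  assumes "x \<in> FP"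
  shows "\<exists>N. (\<forall>n\<ge>N. E n x = 0) \<and> x = (\<Sum>n<N. E n x)"  using assms unfolding finite_particle_space_def
  proof (induction rule: span_induct_alt)
    case base
    show ?case by (intro exI[of _ 0]) simp
  next
    case (step c x y)
    then obtain m where m: "x \<in> particle_space J m" by blast
    from step obtain N where N: "\<forall>n\<ge>N. E n y = 0" "y = (\<Sum>n<N. E n y)" by blast
    let ?N = "max N (Suc m)"
    have Em: "E n x = (if n = m then x else 0)" for n
      using E_ident[OF m] E_orth[of n m] by (metis blinfun.zero_left blinfun_apply_blinfun_compose)
    have "(\<Sum>n<?N. E n y) = (\<Sum>n<N. E n y)"
      using N(1) by (intro sum.mono_neutral_right) auto
    moreover have "m < ?N" by linarith
    then have "(\<Sum>n<?N. E n x) = x" by (simp add: Em)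
    ultimately have "c *\<^sub>R x + y = (\<Sum>n<?N. E n (c *\<^sub>R x + y))"
      using N(2) by (simp add: blinfun.bilinear_simps sum.distrib scaleR_sum_right[symmetric])
    moreover have "\<forall>n\<ge>?N. E n (c *\<^sub>R x + y) = 0"
      using N(1) Em by (auto simp: blinfun.bilinear_simps)
    ultimately show ?case by blast
  qed

lemma FP_sum: "(\<And>n. n \<in> I \<Longrightarrow> f n \<in> FP) \<Longrightarrow> (\<Sum>n\<in>I. f n) \<in> FP"
  using FP_subspace by (rule subspace_sum)

text \<open>\<open>span\<close> is the real span, so stability under complex scalars has to come
  from the particle components, whose spaces are complex.\<close>

lemma FP_scaleC: "x \<in> FP \<Longrightarrow> c *\<^sub>C x \<in> FP"
proof -
  assume "x \<in> FP"
  then obtain N where "x = (\<Sum>n<N. E n x)" using FP_decomp by blast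
  then have "c *\<^sub>C x = (\<Sum>n<N. c *\<^sub>C E n x)" by (metis scaleC_sum_right)
  moreover have "c *\<^sub>C E n x \<in> FP" for n
    using particle_space_subspace E_in by (intro particle_space_FP[of _ n]) (auto simp: complex_subspace_def)
  ultimately show ?thesis by (simp add: FP_sum)
qed

text \<open>Explicit candidate for the operators that \<open>creation\<close> and
  \<open>annihilation\<close> single out by description; the value 0 off \<open>FP\<close> matches
  their convention.\<close>

definition ladder_ext :: "ladder \<Rightarrow> 'h \<Rightarrow> 'h" where
  "ladder_ext l x = (if x \<in> FP then \<Sum>n | E n x \<noteq> 0. block l n x else 0)"

lemma block_E_apply: "block l n (E n x) = block l n x"
  by (metis block_E blinfun_apply_blinfun_compose)

lemma ladder_ext_sum:
  assumes "x \<in> FP" "\<forall>n\<ge>M. E n x = 0"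
  shows "ladder_ext l x = (\<Sum>n<M. block l n x)"
proof -
  have "block l n x = 0" if "E n x = 0" for n
    using block_E_apply[of l n x] that by simp
  then show ?thesis
    unfolding ladder_ext_def using assms
    by (auto intro!: sum.mono_neutral_left) (meson linorder_not_le)
qed

lemma ladder_ext_particle: "x \<in> particle_space J n \<Longrightarrow> ladder_ext l x = block l n x"
proof -
  assume x: "x \<in> particle_space J n"
  have Em: "E m x = (if m = n then x else 0)" for m
    using E_ident[OF x] E_orth[of m n] by (metis blinfun.zero_left blinfun_apply_blinfun_compose)
  have *: "block l m x = (if m = n then block l n x else 0)" for m
    using block_E_apply[of l m x] unfolding Em[of m] by (simp split: if_splits)
  have "(\<Sum>m<Suc n. block l m x) = (\<Sum>m<Suc n. if m = n then block l n x else 0)"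
    by (rule sum.cong[OF refl *])
  then have "(\<Sum>m<Suc n. block l m x) = block l n x" by simp
  moreover have "ladder_ext l x = (\<Sum>m<Suc n. block l m x)"
    by (rule ladder_ext_sum[OF particle_space_FP[OF x]]) (simp add: Em)
  ultimately show ?thesis by simp
qed

lemma ladder_ext_FP: "ladder_ext l x \<in> FP"
proof (cases "x \<in> FP")
  case True
  have "block l n x \<in> FP" for n
    by (metis E_block E_in blinfun_apply_blinfun_compose particle_space_FP)
  then show ?thesis using True by (simp add: ladder_ext_def FP_sum)
qed (simp add: ladder_ext_def subspace_0[OF FP_subspace])

lemma ladder_ext_add:
  assumes "x \<in> FP" "y \<in> FP" shows "ladder_ext l (x + y) = ladder_ext l x + ladder_ext l y"
proof -
  obtain M where M: "\<forall>n\<ge>M. E n x = 0" using FP_decomp[OF assms(1)] by blast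
  obtain N where N: "\<forall>n\<ge>N. E n y = 0" using FP_decomp[OF assms(2)] by blast
  have "x + y \<in> FP" using FP_subspace assms by (rule subspace_add)
  then show ?thesis
    using ladder_ext_sum[of x "max M N" l] ladder_ext_sum[of y "max M N" l]
      ladder_ext_sum[of "x + y" "max M N" l] assms M N
    by (simp add: blinfun.add_right sum.distrib)
qed

lemma ladder_ext_scaleC: "x \<in> FP \<Longrightarrow> ladder_ext l (c *\<^sub>C x) = c *\<^sub>C ladder_ext l x"
proof -
  assume x: "x \<in> FP"
  obtain M where M: "\<forall>n\<ge>M. E n x = 0" using FP_decomp[OF x] by blast
  show ?thesis
    using ladder_ext_sum[OF x, of M l] ladder_ext_sum[OF FP_scaleC[OF x], of M c l] M
    by (simp add: bounded_operators_scaleC[OF E_bounded] bounded_operators_scaleC[OF block_bounded] scaleC_sum_right)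
qed

text \<open>Uniqueness: continuity fixes a competitor on each particle space, where the
  \<open>J \<xi>\<close> are dense, additivity extends this to finite sums, and off
  \<open>FP\<close> both are 0.\<close>

lemma creation_eq: "creation J (unit_vector i) = ladder_ext (Create i)"
  unfolding creation_def
proof (rule the_equality)
  have "continuous_on (particle_space J n) (ladder_ext (Create i))" for n
  proof -
    have "continuous_on (particle_space J n) (blinfun_apply (block (Create i) n))"
      by (intro continuous_intros)
    then show ?thesis by (simp add: ladder_ext_particle cong: continuous_on_cong)
  qed
  moreover have "ladder_ext (Create i) (J \<xi>) = J (prepend i \<xi>)" if "\<xi> \<in> tensor_power n" for n \<xi>
    by (simp add: ladder_ext_particle[OF J_in_particle_space[OF that]] cre_J[OF that])
  ultimately show "(\<forall>x. x \<notin> FP \<longrightarrow> ladder_ext (Create i) x = 0) \<and>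
     (\<forall>x\<in>FP. \<forall>y\<in>FP. ladder_ext (Create i) (x + y) = ladder_ext (Create i) x + ladder_ext (Create i) y) \<and>
     (\<forall>x\<in>FP. \<forall>c. ladder_ext (Create i) (c *\<^sub>C x) = c *\<^sub>C ladder_ext (Create i) x) \<and>
     (\<forall>n. continuous_on (particle_space J n) (ladder_ext (Create i))) \<and>
     (\<forall>n. \<forall>\<xi>\<in>tensor_power n. ladder_ext (Create i) (J \<xi>) = J (prepend i \<xi>))"
    by (simp add: ladder_ext_add ladder_ext_scaleC) (simp add: ladder_ext_def)
next
  fix A :: "'h \<Rightarrow> 'h"
  assume A: "(\<forall>x. x \<notin> FP \<longrightarrow> A x = 0) \<and>
     (\<forall>x\<in>FP. \<forall>y\<in>FP. A (x + y) = A x + A y) \<and>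
     (\<forall>x\<in>FP. \<forall>c. A (c *\<^sub>C x) = c *\<^sub>C A x) \<and>
     (\<forall>n. continuous_on (particle_space J n) A) \<and>
     (\<forall>n. \<forall>\<xi>\<in>tensor_power n. A (J \<xi>) = J (prepend i \<xi>))"
  have A0: "A 0 = 0" using A subspace_0[OF FP_subspace] by (metis add.left_neutral add_cancel_left_left)
  have Asum: "A (\<Sum>n\<in>I. f n) = (\<Sum>n\<in>I. A (f n))" if "finite I" "\<And>n. f n \<in> FP" for I :: "nat set" and f
    using that(1)
  proof (induction I rule: finite_induct)
    case (insert n I)
    have "f n \<in> FP" "sum f I \<in> FP" using that(2) by (auto intro: FP_sum)
    then have "A (f n + sum f I) = A (f n) + A (sum f I)" using A by blast
    then show ?case using insert by simp
  qed (simp add: A0)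
  show "A = ladder_ext (Create i)"
  proof
    fix x show "A x = ladder_ext (Create i) x"
    proof (cases "x \<in> FP")
      case True
      obtain N where N: "\<forall>n\<ge>N. E n x = 0" "x = (\<Sum>n<N. E n x)" using FP_decomp[OF True] by blast
      have "A (E n x) = block (Create i) n (E n x)" for n
      proof (rule agree_on_particle_space[OF _ _ _ E_in])
        show "continuous_on (particle_space J n) A" using A by blast
        show "continuous_on (particle_space J n) (blinfun_apply (block (Create i) n))" by (intro continuous_intros)
        show "A (J \<xi>) = block (Create i) n (J \<xi>)" if "\<xi> \<in> tensor_power n" for \<xi>
          using A that by (simp add: cre_J)
      qed
      then have "A (\<Sum>n<N. E n x) = (\<Sum>n<N. block (Create i) n x)"
        by (subst Asum) (auto simp: block_E_apply simp del: block.simps intro: particle_space_FP[OF E_in])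
      then show ?thesis using ladder_ext_sum[OF True N(1)] N(2) by simp
    qed (use A in \<open>simp add: ladder_ext_def\<close>)
  qed
qed

text \<open>Uniqueness uses that annihilation maps \<open>FP\<close> into itself: the difference of
  the values of two candidates can then be paired with itself.\<close>

lemma annihilation_eq: "annihilation J (unit_vector i) = ladder_ext (Annihilate i)"
  unfolding annihilation_def creation_eq
proof (rule the_equality)
  have "cinner (ladder_ext (Annihilate i) x) y = cinner x (ladder_ext (Create i) y)"
    if x: "x \<in> FP" and y: "y \<in> FP" for x y
  proof -
    obtain N where N: "\<forall>n\<ge>N. E n x = 0" using FP_decomp[OF x] by blast
    obtain N' where N': "\<forall>n\<ge>N'. E n y = 0" using FP_decomp[OF y] by blast
    let ?M = "max N N'"
    \<comment> \<open>One more term than on the creation side: annihilator blocks are indexed by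
      their source, and the block of index 0 vanishes and is dropped in the reindexing.\<close>
    have "ladder_ext (Annihilate i) x = (\<Sum>n<Suc ?M. block (Annihilate i) n x)"
      using N by (intro ladder_ext_sum[OF x]) auto
    also have "\<dots> = (\<Sum>n<?M. adj (cre n i) x)" by (simp only: sum.lessThan_Suc_shift) simp
    finally have "cinner (ladder_ext (Annihilate i) x) y = (\<Sum>n<?M. cinner x (cre n i y))"
      by (simp add: cinner_sum_left adj_left[OF cre_bounded])
    also have "\<dots> = cinner x (\<Sum>n<?M. block (Create i) n y)" by (simp add: cinner_sum_right)
    also have "(\<Sum>n<?M. block (Create i) n y) = ladder_ext (Create i) y"
      using N' by (intro ladder_ext_sum[OF y, symmetric]) auto
    finally show ?thesis .
  qed
  then show "(\<forall>x. x \<notin> FP \<longrightarrow> ladder_ext (Annihilate i) x = 0) \<and>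
     (\<forall>x\<in>FP. ladder_ext (Annihilate i) x \<in> FP) \<and>
     (\<forall>x\<in>FP. \<forall>y\<in>FP. cinner (ladder_ext (Annihilate i) x) y = cinner x (ladder_ext (Create i) y))"
    by (simp add: ladder_ext_FP) (simp add: ladder_ext_def)
  fix B :: "'h \<Rightarrow> 'h"
  assume B: "(\<forall>x. x \<notin> FP \<longrightarrow> B x = 0) \<and> (\<forall>x\<in>FP. B x \<in> FP) \<and>
     (\<forall>x\<in>FP. \<forall>y\<in>FP. cinner (B x) y = cinner x (ladder_ext (Create i) y))"
  show "B = ladder_ext (Annihilate i)"
  proof
    fix x show "B x = ladder_ext (Annihilate i) x"
    proof (cases "x \<in> FP")
      case True
      let ?d = "B x - ladder_ext (Annihilate i) x"
      have "?d \<in> FP" using B True ladder_ext_FP FP_subspace by (simp add: subspace_diff)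
      then have "cinner ?d ?d = 0"
        using B True \<open>\<And>y x. x \<in> FP \<Longrightarrow> y \<in> FP \<Longrightarrow> cinner (ladder_ext (Annihilate i) x) y = cinner x (ladder_ext (Create i) y)\<close>
        by (simp add: cinner_diff_left[of "B x" _ ?d])
      then show ?thesis by simp
    qed (use B in \<open>simp add: ladder_ext_def\<close>)
  qed
qed

lemma ladder_op_eq: "ladder_op J l = ladder_ext l"
  by (cases l) (simp_all add: creation_eq annihilation_eq)

primrec wdeg :: "ladder list \<Rightarrow> nat \<Rightarrow> nat" where
  "wdeg [] n = n"
| "wdeg (w # ws) n = deg w (wdeg ws n)"

text \<open>A product of bounded blocks along the path of degrees that starts at \<open>n\<close>,
  so that no unbounded operator occurs. Starting from \<open>E n\<close> confines every word to one
  particle space.\<close>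

primrec word :: "ladder list \<Rightarrow> nat \<Rightarrow> 'h \<Rightarrow>\<^sub>L 'h" where
  "word [] n = E n"
| "word (w # ws) n = block w (wdeg ws n) o\<^sub>L word ws n"

lemma word_bounded: "word ws n \<in> bounded_operators"
  by (induction ws) (simp_all add: E_bounded comp_in_bounded_operators block_bounded)

lemma word_E: "word ws n o\<^sub>L E n = word ws n"
  by (induction ws) (simp_all add: E_idem blinfun_compose_assoc)

lemma E_word: "E (wdeg ws n) o\<^sub>L word ws n = word ws n"
  by (induction ws) (simp_all add: E_idem E_block blinfun_compose_assoc[symmetric])

lemma ladder_word_eq: "x \<in> particle_space J n \<Longrightarrow> ladder_word J ws x = word ws n x"
proof (induction ws)
  case (Cons w ws)
  have "word ws n x \<in> particle_space J (wdeg ws n)"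
    by (metis E_word E_in blinfun_apply_blinfun_compose)
  then show ?case using Cons by (simp add: ladder_op_eq ladder_ext_particle)
qed (simp add: E_ident)

text \<open>A word sends one particle space into another single one, so the left cut-off is either
  absorbed or gives 0 by orthogonality of the degrees.\<close>

lemma cutoff_word_eq: "cutoff_word J m ws n = (if m = wdeg ws n then word ws n else 0)"
proof -
  have "cutoff_word J m ws n = Blinfun (blinfun_apply (E m o\<^sub>L word ws n))"
    unfolding cutoff_word_def
    by (simp add: ladder_word_eq[OF E_in]) (metis word_E blinfun_apply_blinfun_compose)
  also have "\<dots> = E m o\<^sub>L word ws n" by (simp add: blinfun_apply_inverse)
  also have "\<dots> = (if m = wdeg ws n then word ws n else 0)"
  proof (cases "m = wdeg ws n")
    case False
    have "E m o\<^sub>L word ws n = (E m o\<^sub>L E (wdeg ws n)) o\<^sub>L word ws n"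
      by (simp add: blinfun_compose_assoc E_word)
    then show ?thesis using False by (simp add: E_orth)
  qed (simp add: E_word)
  finally show ?thesis .
qed

lemma wdeg_append: "wdeg (us @ vs) n = wdeg us (wdeg vs n)"
  by (induction us) simp_all

lemma word_append: "word (us @ vs) n = word us (wdeg vs n) o\<^sub>L word vs n"
  by (induction us) (simp_all add: E_word wdeg_append blinfun_compose_assoc)

subsection \<open>The shift\<close>

text \<open>Used for the shift and for its inverse. Invariance of the deformed form passes from
  tensors to the real span of the graph one argument at a time;
  \<open>bounded_operator_extension\<close> then extends the isometry and deals with the kernel of
  \<open>J\<close>.\<close>

lemma ex_isometry:
  assumes in_: "\<And>n \<xi>. \<xi> \<in> tensor_power n \<Longrightarrow> s \<xi> \<in> tensor_power n"
    and scale: "\<And>c \<xi>. s (\<lambda>xs. c * \<xi> xs) = (\<lambda>xs. c * s \<xi> xs)"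
    and inner: "\<And>n \<xi> \<eta>. \<xi> \<in> tensor_power n \<Longrightarrow> \<eta> \<in> tensor_power n \<Longrightarrow>
      tensor_inner (s \<xi>) (P_op T n (s \<eta>)) = tensor_inner \<xi> (P_op T n \<eta>)"
  shows "\<exists>A\<in>bounded_operators. \<forall>n. \<forall>\<xi>\<in>tensor_power n. blinfun_apply A (J \<xi>) = J (s \<xi>)"
proof -
  let ?g = "\<Union>n. (\<lambda>\<xi>. (J \<xi>, J (s \<xi>))) ` tensor_power n"
  let ?G = "span ?g"
  have iso: "cinner (snd p) (snd q) = cinner (fst p) (fst q)" if pq: "p \<in> ?G" "q \<in> ?G" for p q
  proof -
    have base: "cinner (snd p) (snd q) = cinner (fst p) (fst q)" if "p \<in> ?g" "q \<in> ?g" for p q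
    proof -
      obtain m \<xi> where \<xi>: "\<xi> \<in> tensor_power m" "p = (J \<xi>, J (s \<xi>))" using \<open>p \<in> ?g\<close> by blast
      obtain n \<eta> where \<eta>: "\<eta> \<in> tensor_power n" "q = (J \<eta>, J (s \<eta>))" using \<open>q \<in> ?g\<close> by blast
      show ?thesis
        using inner[of \<xi> n \<eta>] \<xi>(1) \<eta>(1) unfolding \<xi>(2) \<eta>(2)
        by (cases "m = n") (simp_all add: J_inner[OF \<xi>(1) \<eta>(1)] J_inner[OF in_[OF \<xi>(1)] in_[OF \<eta>(1)]])
    qed
    have base': "cinner (snd p) (snd q) = cinner (fst p) (fst q)" if "q \<in> ?g" for q
      using pq(1)
    proof (induction rule: span_induct_alt)
      case (step c x y)
      then show ?case using base[of x q] that by (simp add: cinner_simps)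
    qed simp
    show ?thesis
      using pq(2)
    proof (induction rule: span_induct_alt)
      case (step c x y)
      then show ?case using base'[of x] by (simp add: cinner_simps)
    qed simp
  qed
  have cG: "(c *\<^sub>C x, c *\<^sub>C y) \<in> ?G" if "(x, y) \<in> ?G" for c x y
  proof -
    have "(c *\<^sub>C fst p, c *\<^sub>C snd p) \<in> ?G" if "p \<in> ?G" for p
      using that
    proof (induction rule: span_induct_alt)
      case base
      then show ?case using span_zero[of ?g] by (simp add: zero_prod_def)
    next
      case (step r p q)
      obtain n \<xi> where \<xi>: "\<xi> \<in> tensor_power n" "p = (J \<xi>, J (s \<xi>))" using step(1) by blast
      have "(c *\<^sub>C fst p, c *\<^sub>C snd p) = (J (\<lambda>xs. c * \<xi> xs), J (s (\<lambda>xs. c * \<xi> xs)))"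
        unfolding \<xi>(2) scale J_scale[OF \<xi>(1)] J_scale[OF in_[OF \<xi>(1)]] by simp
      then have "(c *\<^sub>C fst p, c *\<^sub>C snd p) \<in> ?G"
        using tensor_power_scale[OF \<xi>(1), of c] by (intro span_base) blast
      then have "r *\<^sub>R (c *\<^sub>C fst p, c *\<^sub>C snd p) + (c *\<^sub>C fst q, c *\<^sub>C snd q) \<in> ?G"
        using step(2) by (intro span_add span_scale)
      then show ?case by (simp add: scaleC_add_right scaleC_scaleR)
    qed
    from this[OF that] show ?thesis by simp
  qed
  have "norm y \<le> 1 * norm x" if "(x, y) \<in> ?G" for x y
    using iso[OF that that] by (simp add: norm_eq_sqrt_cinner)
  from bounded_operator_extension[OF subspace_span cG this zero_le_one]
  obtain A where A: "A \<in> bounded_operators" "\<forall>(x, y)\<in>?G. blinfun_apply A x = y"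
    by blast
  have "A (J \<xi>) = J (s \<xi>)" if "\<xi> \<in> tensor_power n" for n \<xi>
  proof -
    have "(J \<xi>, J (s \<xi>)) \<in> ?G" using that by (intro span_base) blast
    from bspec[OF A(2) this] show ?thesis by simp
  qed
  then show ?thesis using A(1) by blast
qed

abbreviation "W \<equiv> fock_shift J"

text \<open>The operators induced by \<open>shift\<close> and \<open>unshift\<close> are adjoint to
  each other, since the deformed form is shift invariant, and inverse to each other; density of the
  span of the \<open>J \<xi>\<close> makes the description in \<open>fock_shift\<close>
  unique.\<close>

lemma fock_shift_props: "unitary_op W \<and> (\<forall>n. \<forall>\<xi>\<in>tensor_power n. W (J \<xi>) = J (shift \<xi>))"
  and adj_fock_shift_J: "\<xi> \<in> tensor_power n \<Longrightarrow> adj W (J \<xi>) = J (unshift \<xi>)"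
proof -
  have P_sh: "P_op T n (shift \<xi>) = shift (P_op T n \<xi>)" if "\<xi> \<in> tensor_power n" for n \<xi>
    using P_op_shift[OF T_bounded T_shift that] .
  have P_unsh: "shift (P_op T n (unshift \<xi>)) = P_op T n \<xi>" if "\<xi> \<in> tensor_power n" for n \<xi>
    using P_sh[OF unshift_in[OF that]] by (simp add: shift_unshift)
  obtain A where A: "A \<in> bounded_operators"
    "\<And>n \<xi>. \<xi> \<in> tensor_power n \<Longrightarrow> blinfun_apply A (J \<xi>) = J (shift \<xi>)"
    using ex_isometry[of shift, OF shift_in] P_sh tensor_inner_shift by (auto simp: shift_def[abs_def])
  have unsh: "tensor_inner (unshift \<xi>) \<eta> = tensor_inner \<xi> (shift \<eta>)" for \<xi> \<eta>
    using tensor_inner_shift[of "unshift \<xi>" \<eta>] by (simp add: shift_unshift)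
  have "\<exists>B\<in>bounded_operators. \<forall>n. \<forall>\<xi>\<in>tensor_power n. blinfun_apply B (J \<xi>) = J (unshift \<xi>)"
    by (rule ex_isometry) (simp_all add: unshift_in unsh P_unsh del: P_op.simps, simp add: unshift_def)
  then obtain B where B: "B \<in> bounded_operators"
    "\<And>n \<xi>. \<xi> \<in> tensor_power n \<Longrightarrow> blinfun_apply B (J \<xi>) = J (unshift \<xi>)" by blast
  have adjA: "adj A = B"
  proof (rule operator_eqI)
    fix n \<xi> assume \<xi>: "\<xi> \<in> tensor_power n"
    have "cinner (J \<xi>) (A y) = cinner (B (J \<xi>)) y" for y
    proof (rule fock_dense_eq)
      show "bounded_linear (\<lambda>y. cinner (J \<xi>) (A y))"
        by (intro bounded_linear_compose[OF bounded_linear_cinner_right] blinfun.bounded_linear_right)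
      show "bounded_linear (cinner (B (J \<xi>)))" by (rule bounded_linear_cinner_right)
      fix m \<eta> assume \<eta>: "\<eta> \<in> tensor_power m"
      show "cinner (J \<xi>) (A (J \<eta>)) = cinner (B (J \<xi>)) (J \<eta>)"
        by (cases "m = n") (use \<xi> \<eta> in \<open>simp_all add: A B J_inner[OF \<xi> shift_in[OF \<eta>]]
            J_inner[OF unshift_in[OF \<xi>] \<eta>] unsh P_sh\<close>)
    qed
    then have "cinner y (adj A (J \<xi>)) = cinner y (B (J \<xi>))" for y
      by (metis A(1) adj_right cinner_commute)
    then show "adj A (J \<xi>) = B (J \<xi>)" by (rule cinner_ext)
  qed
  have "adj A o\<^sub>L A = id_blinfun" "A o\<^sub>L adj A = id_blinfun"
    unfolding adjA
    by (rule operator_eqI,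
        simp add: A B B(2)[OF shift_in] A(2)[OF unshift_in] shift_unshift)+
  then have PA: "unitary_op A \<and> (\<forall>n. \<forall>\<xi>\<in>tensor_power n. A (J \<xi>) = J (shift \<xi>))"
    using A by (simp add: unitary_op_def)
  have "W = A"
    unfolding fock_shift_def
  proof (rule the_equality)
    show "unitary_op A \<and> (\<forall>n. \<forall>\<xi>\<in>tensor_power n. A (J \<xi>) = J (shift \<xi>))" by (rule PA)
    fix A' assume "unitary_op A' \<and> (\<forall>n. \<forall>\<xi>\<in>tensor_power n. blinfun_apply A' (J \<xi>) = J (shift \<xi>))"
    then show "A' = A" by (intro operator_eqI) (metis A(2))
  qed
  then show "unitary_op W \<and> (\<forall>n. \<forall>\<xi>\<in>tensor_power n. W (J \<xi>) = J (shift \<xi>))"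
    "\<xi> \<in> tensor_power n \<Longrightarrow> adj W (J \<xi>) = J (unshift \<xi>)"
    using PA adjA B(2) by simp_all
qed

lemma W_bounded: "W \<in> bounded_operators"
  and W_adj_W: "adj W o\<^sub>L W = id_blinfun" and W_W_adj: "W o\<^sub>L adj W = id_blinfun"
  and W_J: "\<xi> \<in> tensor_power n \<Longrightarrow> W (J \<xi>) = J (shift \<xi>)"
  using fock_shift_props by (auto simp: unitary_op_def)

abbreviation "\<alpha> \<equiv> shift_automorphism J"

lemma shift_block:
  "\<alpha> (E n) = E n" "\<alpha> (cre n i) = cre n (i + 1)"
proof -
  show "\<alpha> (E n) = E n"
  proof (rule operator_eqI)
    fix m \<xi> assume \<xi>: "\<xi> \<in> tensor_power m"
    show "\<alpha> (E n) (J \<xi>) = E n (J \<xi>)"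
      by (simp add: shift_automorphism_def adj_fock_shift_J[OF \<xi>] E_J[OF \<xi>] E_J[OF unshift_in[OF \<xi>]]
          W_J[OF unshift_in[OF \<xi>]] shift_unshift)
  qed
  have z: "cre n j (J \<eta>) = 0" if "\<eta> \<in> tensor_power m" "m \<noteq> n" for m \<eta> j
    by (rule cre_orth) (use that in \<open>simp add: J_inner\<close>)
  show "\<alpha> (cre n i) = cre n (i + 1)"
  proof (rule operator_eqI)
    fix m \<xi> assume \<xi>: "\<xi> \<in> tensor_power m"
    show "\<alpha> (cre n i) (J \<xi>) = cre n (i + 1) (J \<xi>)"
    proof (cases "m = n")
      case True
      then have \<xi>': "\<xi> \<in> tensor_power n" using \<xi> by simp
      show ?thesis
        by (simp add: shift_automorphism_def adj_fock_shift_J[OF \<xi>'] cre_J[OF \<xi>'] cre_J[OF unshift_in[OF \<xi>']]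
          W_J[OF prepend_in[OF unshift_in[OF \<xi>']]] prepend_shift shift_unshift)
    next
      case False
      then show ?thesis
        by (simp add: shift_automorphism_def adj_fock_shift_J[OF \<xi>] z[OF \<xi>] z[OF unshift_in[OF \<xi>]])
    qed
  qed
qed

lemma shift_compose: "\<alpha> (A o\<^sub>L B) = \<alpha> A o\<^sub>L \<alpha> B"
proof -
  have "adj W (W x) = x" for x using W_adj_W by (metis blinfun_apply_blinfun_compose id_blinfun.rep_eq id_apply)
  then show ?thesis by (intro blinfun_eqI) (simp add: shift_automorphism_def)
qed

lemma shift_in_bounded: "A \<in> bounded_operators \<Longrightarrow> \<alpha> A \<in> bounded_operators"
  by (simp add: shift_automorphism_def comp_in_bounded_operators W_bounded adj_in)

lemma shift_adj: "A \<in> bounded_operators \<Longrightarrow> \<alpha> (adj A) = adj (\<alpha> A)"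
  by (simp add: shift_automorphism_def adj_comp comp_in_bounded_operators W_bounded adj_in adj_adj blinfun_compose_assoc)

lemma bounded_linear_shift: "bounded_linear \<alpha>"
  unfolding shift_automorphism_def
  by (intro bounded_linear_compose[OF bounded_bilinear.bounded_linear_left[OF bounded_bilinear_blinfun_compose]]
      bounded_bilinear.bounded_linear_right[OF bounded_bilinear_blinfun_compose])

lemma shift_scale_op: "\<alpha> (scale_op c A) = scale_op c (\<alpha> A)"
  by (rule blinfun_eqI) (simp add: shift_automorphism_def bounded_operators_scaleC[OF W_bounded])

lemma norm_W: "norm W \<le> 1"
proof (rule norm_blinfun_bound)
  fix x
  have "cinner (W x) (W x) = cinner x x"
    using adj_left[OF W_bounded, of "W x" x] W_adj_W
    by (metis adj_right W_bounded blinfun_apply_blinfun_compose id_blinfun.rep_eq id_apply)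
  then show "norm (W x) \<le> 1 * norm x" by (simp add: norm_eq_sqrt_cinner)
qed simp

lemma norm_shift: "norm (\<alpha> A) \<le> norm A"
proof -
  have "norm (\<alpha> A) \<le> norm W * norm (A o\<^sub>L adj W)"
    unfolding shift_automorphism_def blinfun_compose_assoc by (rule norm_blinfun_compose)
  also have "\<dots> \<le> 1 * (norm A * norm (adj W))"
    by (intro mult_mono norm_W norm_blinfun_compose) auto
  also have "\<dots> \<le> norm A" using norm_W by (simp add: norm_adj[OF W_bounded] mult_left_le)
  finally show ?thesis .
qed

lemma shift_positive: "positive_op A \<Longrightarrow> positive_op (\<alpha> A)"
proof -
  assume A: "positive_op A"
  have "cinner x (\<alpha> A x) = cinner (adj W x) (A (adj W x))" for x
    by (simp add: shift_automorphism_def adj_left[OF W_bounded])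
  then show ?thesis using A by (simp add: positive_op_def shift_in_bounded)
qed

text \<open>The increment is a parameter because the inverse automorphism uses -1.\<close>

fun shift_ladder :: "int \<Rightarrow> ladder \<Rightarrow> ladder" where
  "shift_ladder k (Create i) = Create (i + k)"
| "shift_ladder k (Annihilate i) = Annihilate (i + k)"

lemma shift_block_eq: "\<alpha> (block l n) = block (shift_ladder 1 l) n"
  by (cases "(l, n)" rule: block.cases)
    (simp_all add: shift_block shift_adj[OF cre_bounded] linear_0[OF bounded_linear.linear[OF bounded_linear_shift]])

lemma deg_shift_ladder: "deg (shift_ladder k l) n = deg l n"
  by (cases l) simp_all

lemma wdeg_shift_ladder: "wdeg (map (shift_ladder k) ws) n = wdeg ws n"
  by (induction ws) (simp_all add: deg_shift_ladder)

lemma shift_word: "\<alpha> (word ws n) = word (map (shift_ladder 1) ws) n"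
  by (induction ws) (simp_all add: shift_block shift_compose shift_block_eq wdeg_shift_ladder)

end

section \<open>Operator algebras\<close>

lemma scaleR_scale_op: "r *\<^sub>R A = scale_op (of_real r) A"
  by (simp add: scale_op_of_real)

lemma diff_eq_add_scale_op: "A - B = A + scale_op (- 1) B"
  using scale_op_of_real[of "- 1" B] by simp

context
  fixes S :: "('h::complex_hilbert_space \<Rightarrow>\<^sub>L 'h) set"
  assumes S: "cstar_subalgebra S"
begin

lemma cstar_bounded: "A \<in> S \<Longrightarrow> A \<in> bounded_operators"
  and cstar_zero: "0 \<in> S"
  and cstar_add: "A \<in> S \<Longrightarrow> B \<in> S \<Longrightarrow> A + B \<in> S"
  and cstar_compose: "A \<in> S \<Longrightarrow> B \<in> S \<Longrightarrow> A o\<^sub>L B \<in> S"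
  and cstar_scale: "A \<in> S \<Longrightarrow> scale_op c A \<in> S"
  and cstar_adj: "A \<in> S \<Longrightarrow> adj A \<in> S"
  and cstar_closed: "closed S"
  using S by (auto simp: cstar_subalgebra_def)

lemma cstar_subspace: "subspace S"
  unfolding subspace_def by (simp add: cstar_zero cstar_add cstar_scale scaleR_scale_op)

end

lemma cstar_bounded_operators: "cstar_subalgebra bounded_operators"
  by (simp add: cstar_subalgebra_def zero_in_bounded_operators add_in_bounded_operators
      comp_in_bounded_operators scale_op_in_bounded_operators adj_in closed_bounded_operators)

lemma cstar_generated_superset: "G \<subseteq> cstar_generated G"
  by (auto simp: cstar_generated_def)

lemma cstar_generated_minimal: "cstar_subalgebra S \<Longrightarrow> G \<subseteq> S \<Longrightarrow> cstar_generated G \<subseteq> S"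
  by (auto simp: cstar_generated_def)

lemma cstar_generated_subalgebra:
  assumes "G \<subseteq> bounded_operators" shows "cstar_subalgebra (cstar_generated G)"
proof -
  have "cstar_generated G \<subseteq> bounded_operators"
    by (rule cstar_generated_minimal[OF cstar_bounded_operators assms])
  moreover have "closed (cstar_generated G)"
    unfolding cstar_generated_def by (intro closed_Inter ballI) (auto dest: cstar_closed)
  ultimately show ?thesis
    unfolding cstar_subalgebra_def cstar_generated_def
    by (auto dest: cstar_zero cstar_add cstar_compose cstar_scale cstar_adj)
qed

lemma tendsto_blinfun_compose:
  "s \<longlonglongrightarrow> A \<Longrightarrow> t \<longlonglongrightarrow> B \<Longrightarrow> (\<lambda>n. s n o\<^sub>L t n) \<longlonglongrightarrow> (A o\<^sub>L B)"
  by (rule bounded_bilinear.tendsto[OF bounded_bilinear_blinfun_compose])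

text \<open>Composition is jointly continuous and the adjoint is isometric on bounded operators, so
  all the algebraic operations pass to norm limits.\<close>

lemma cstar_closure:
  assumes bo: "S \<subseteq> bounded_operators" and sub: "subspace S"
    and comp: "\<And>A B. A \<in> S \<Longrightarrow> B \<in> S \<Longrightarrow> A o\<^sub>L B \<in> S"
    and scale: "\<And>A c. A \<in> S \<Longrightarrow> scale_op c A \<in> S"
    and adj: "\<And>A. A \<in> S \<Longrightarrow> adj A \<in> S"
  shows "cstar_subalgebra (closure S)"
proof -
  have bo': "closure S \<subseteq> bounded_operators"
    by (rule closure_minimal[OF bo closed_bounded_operators])
  have sub': "subspace (closure S)" by (rule subspace_closure[OF sub])
  have "A o\<^sub>L B \<in> closure S" if A: "A \<in> closure S" and B: "B \<in> closure S" for A B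
  proof -
    obtain s t where "\<And>n. s n \<in> S" "s \<longlonglongrightarrow> A" "\<And>n. t n \<in> S" "t \<longlonglongrightarrow> B"
      using A B unfolding closure_sequential by blast
    then show ?thesis
      unfolding closure_sequential
      by (intro exI[of _ "\<lambda>n. s n o\<^sub>L t n"] conjI allI comp tendsto_blinfun_compose)
  qed
  moreover have "adj A \<in> closure S" if A: "A \<in> closure S" for A
  proof -
    obtain s where s: "\<And>n. s n \<in> S" "s \<longlonglongrightarrow> A"
      using A unfolding closure_sequential by blast
    have "norm (adj (s n) - adj A) \<le> norm (s n - A)" for n
    proof -
      have b: "s n \<in> bounded_operators" "A \<in> bounded_operators" using s(1) bo bo' A by auto
      have "adj (s n - A) = adj (s n) - adj A"
        unfolding diff_eq_add_scale_op
        by (simp add: b adj_add scale_op_in_bounded_operators adj_scale_op)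
      then show ?thesis using norm_adj[OF diff_in_bounded_operators[OF b]] by simp
    qed
    then have "(\<lambda>n. adj (s n)) \<longlonglongrightarrow> adj A"
      using s(2) unfolding LIM_zero_iff[of _ "adj A", symmetric] LIM_zero_iff[of s A, symmetric]
      by (rule_tac Lim_null_comparison[of _ "\<lambda>n. norm (s n - A)"]) (auto intro: tendsto_norm_zero)
    then show ?thesis
      unfolding closure_sequential using s(1) by (intro exI[of _ "\<lambda>n. adj (s n)"]) (auto intro: adj)
  qed
  moreover have "scale_op c A \<in> closure S" if "A \<in> closure S" for c A
  proof -
    have "continuous_on UNIV (scale_op c :: ('a \<Rightarrow>\<^sub>L 'a) \<Rightarrow> _)"
      by (rule linear_continuous_on[OF bounded_linear_scale_op])
    then have "scale_op c ` closure S \<subseteq> closure S"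
      by (rule closed_invariant_closure) (use scale closure_subset[of S] in auto)
    then show ?thesis using that by blast
  qed
  ultimately show ?thesis
    using bo' sub' by (simp add: cstar_subalgebra_def subspace_0 subspace_add)
qed

text \<open>A set closed under products and adjoints generates nothing beyond its closed complex
  span. Since \<open>span\<close> is the real span, the complex multiples are put into the spanning
  set.\<close>

lemma cstar_generated_subset_closure:
  assumes bo: "G \<subseteq> bounded_operators"
    and comp: "\<And>A B. A \<in> G \<Longrightarrow> B \<in> G \<Longrightarrow> A o\<^sub>L B \<in> G"
    and adj: "\<And>A. A \<in> G \<Longrightarrow> adj A \<in> G"
  shows "cstar_generated G \<subseteq> closure (span {scale_op c A |c A. A \<in> G})"
proof -
  let ?g = "{scale_op c A |c A. A \<in> G}"
  let ?S = "span ?g"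
  have "?g \<subseteq> bounded_operators" using bo scale_op_in_bounded_operators by auto
  moreover have "subspace bounded_operators" by (rule cstar_subspace[OF cstar_bounded_operators])
  ultimately have bS: "?S \<subseteq> bounded_operators" by (rule span_minimal)
  have "cstar_subalgebra (closure ?S)"
  proof (rule cstar_closure[OF bS subspace_span])
    show sc: "scale_op c A \<in> ?S" if "A \<in> ?S" for A c
      using that
    proof (induction rule: span_induct_alt)
      case (step r A B)
      obtain d A' where "A' \<in> G" "A = scale_op d A'" using step(1) by blast
      then have "scale_op c A = scale_op (c * d) A'" "A' \<in> G" by (simp_all add: scale_op_scale_op)
      then have "scale_op c A \<in> ?S" by (intro span_base) blast
      then show ?case using step by (simp add: scale_op_add scale_op_scaleR span_add span_scale)
    qed (simp add: span_zero)
    have "A \<in> bounded_operators \<and> adj A \<in> ?S" if "A \<in> ?S" for A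
      using that
    proof (induction rule: span_induct_alt)
      case (step r A B)
      then obtain c A' where A': "A' \<in> G" "A = scale_op c A'" by blast
      then have "adj A = scale_op (cnj c) (adj A')" using bo by (auto simp: adj_scale_op)
      then have "adj A \<in> ?S" using adj[OF A'(1)] by (intro span_base) blast
      then have "scale_op (of_real r) (adj A) + adj B \<in> ?S" using step(2) sc by (intro span_add) auto
      moreover have "A \<in> bounded_operators" using A' bo by (auto intro: scale_op_in_bounded_operators)
      ultimately show ?case
        using step(2)
        by (simp add: scaleR_scale_op adj_add adj_scale_op scale_op_in_bounded_operators add_in_bounded_operators)
    qed (simp add: adj_zero span_zero zero_in_bounded_operators)
    then show "adj A \<in> ?S" if "A \<in> ?S" for A using that by blast
    have base: "A o\<^sub>L B \<in> ?S" if "A \<in> ?g" "B \<in> ?g" for A B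
    proof -
      obtain c A' d B' where "A' \<in> G" "A = scale_op c A'" "B' \<in> G" "B = scale_op d B'"
        using \<open>A \<in> ?g\<close> \<open>B \<in> ?g\<close> by blast
      then have "A o\<^sub>L B = scale_op (c * d) (A' o\<^sub>L B')" "A' o\<^sub>L B' \<in> G"
        using bo comp by (auto simp: scale_op_comp_left scale_op_comp_right scale_op_scale_op)
      then show ?thesis by (intro span_base) blast
    qed
    show "A o\<^sub>L B \<in> ?S" if "A \<in> ?S" "B \<in> ?S" for A B
    proof -
      have left: "A o\<^sub>L B' \<in> ?S" if "B' \<in> ?g" for B'
        using \<open>A \<in> ?S\<close>
      proof (induction rule: span_induct_alt)
        case (step r C D)
        have "(r *\<^sub>R C + D) o\<^sub>L B' = r *\<^sub>R (C o\<^sub>L B') + (D o\<^sub>L B')"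
          by (rule blinfun_eqI) (simp add: blinfun.bilinear_simps)
        then show ?case using base[OF step(1) that] step(2) by (simp add: span_add span_scale)
      qed (simp add: span_zero)
      show ?thesis
        using \<open>B \<in> ?S\<close>
      proof (induction rule: span_induct_alt)
        case (step r C D)
        have "A o\<^sub>L (r *\<^sub>R C + D) = r *\<^sub>R (A o\<^sub>L C) + (A o\<^sub>L D)"
          by (rule blinfun_eqI) (simp add: blinfun.bilinear_simps)
        then show ?case using left[OF step(1)] step(2) by (simp add: span_add span_scale)
      qed (simp add: span_zero)
    qed
  qed
  moreover have "G \<subseteq> closure ?S"
  proof
    fix A assume "A \<in> G"
    then have "A \<in> ?g" using scale_op_one[of A] by (metis (mono_tags, lifting) mem_Collect_eq)
    then show "A \<in> closure ?S" by (rule subsetD[OF closure_subset span_base])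
  qed
  ultimately show ?thesis by (rule cstar_generated_minimal)
qed

subsection \<open>Mixing\<close>

text \<open>Matrix coefficients are the functionals through which the weak limits are examined: they
  give uniqueness, contractivity, positivity and the bimodule property.\<close>

lemma dual_functional_matrix_coefficient:
  "dual_functional \<AA> (\<lambda>a. cinner x (blinfun_apply a y))"
  unfolding dual_functional_def
proof (intro conjI exI ballI allI)
  fix a assume "a \<in> \<AA>"
  have "cmod (cinner x (blinfun_apply a y)) \<le> norm x * norm (a y)" by (rule cauchy_schwarz)
  also have "\<dots> \<le> norm x * (norm a * norm y)" by (intro mult_left_mono norm_blinfun) simp
  finally show "cmod (cinner x (blinfun_apply a y)) \<le> (norm x * norm y) * norm a" by (simp add: mult_ac)
qed (simp_all add: blinfun.add_left cinner_simps)

lemma dual_functional_sum: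
  assumes "dual_functional \<AA> f" "cstar_subalgebra \<AA>" "\<And>k. k \<in> S \<Longrightarrow> X k \<in> \<AA>"
  shows "f (\<Sum>k\<in>S. scale_op (c k) (X k)) = (\<Sum>k\<in>S. c k * f (X k)) \<and> (\<Sum>k\<in>S. scale_op (c k) (X k)) \<in> \<AA>"
  using assms(3)
proof (induction S rule: infinite_finite_induct)
  case (insert k S)
  then have "scale_op (c k) (X k) \<in> \<AA>" using cstar_scale[OF assms(2)] by simp
  then show ?case
    using insert assms(1) cstar_add[OF assms(2)] by (simp add: dual_functional_def)
next
  case empty
  have "f (scale_op 0 0) = 0 * f 0"
    using assms(1) cstar_zero[OF assms(2)] by (simp add: dual_functional_def del: scale_op_zero)
  then show ?case using cstar_zero[OF assms(2)] by simp
next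
  case (infinite S)
  have "f (scale_op 0 0) = 0 * f 0"
    using assms(1) cstar_zero[OF assms(2)] by (simp add: dual_functional_def del: scale_op_zero)
  then show ?case using infinite cstar_zero[OF assms(2)] by simp
qed

text \<open>Free coefficients of modulus at most 1 allow the phases to be aligned with a functional,
  and free finite index sets allow the bad indices alone to be collected; initial segments would
  control only averages.\<close>

definition square_root_growth :: "(nat \<Rightarrow> 'h::complex_hilbert_space \<Rightarrow>\<^sub>L 'h) \<Rightarrow> bool" where
  "square_root_growth X \<longleftrightarrow> (\<exists>C. \<forall>S c. finite S \<longrightarrow> (\<forall>k. cmod (c k) \<le> 1) \<longrightarrow>
     norm (\<Sum>k\<in>S. scale_op (c k) (X k)) \<le> C * sqrt (card S))"

lemma adj_sum:
  "(\<And>k. k \<in> S \<Longrightarrow> X k \<in> bounded_operators) \<Longrightarrow>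
    (\<Sum>k\<in>S. X k) \<in> bounded_operators \<and> adj (\<Sum>k\<in>S. X k) = (\<Sum>k\<in>S. adj (X k))"
  by (induction S rule: infinite_finite_induct)
    (auto simp: adj_zero zero_in_bounded_operators adj_add add_in_bounded_operators)

lemma square_root_growth_adj:
  assumes "square_root_growth X" and X: "\<And>k. X k \<in> bounded_operators"
  shows "square_root_growth (\<lambda>k. adj (X k))"
proof -
  obtain C where C: "\<forall>S c. finite S \<longrightarrow> (\<forall>k. cmod (c k) \<le> 1) \<longrightarrow>
      norm (\<Sum>k\<in>S. scale_op (c k) (X k)) \<le> C * sqrt (card S)"
    using assms(1) unfolding square_root_growth_def by blast
  have "norm (\<Sum>k\<in>S. scale_op (c k) (adj (X k))) \<le> C * sqrt (card S)"
    if "finite S" "\<forall>k. cmod (c k) \<le> 1" for S c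
  proof -
    let ?Y = "\<Sum>k\<in>S. scale_op (cnj (c k)) (X k)"
    have Y: "?Y \<in> bounded_operators" "adj ?Y = (\<Sum>k\<in>S. adj (scale_op (cnj (c k)) (X k)))"
      using adj_sum[of S "\<lambda>k. scale_op (cnj (c k)) (X k)"] X
      by (simp_all add: scale_op_in_bounded_operators)
    have "norm (\<Sum>k\<in>S. scale_op (c k) (adj (X k))) = norm ?Y"
      using norm_adj[OF Y(1)] unfolding Y(2) by (simp add: adj_scale_op X)
    also have "\<dots> \<le> C * sqrt (card S)"
      using C[rule_format, of S "\<lambda>k. cnj (c k)"] that by simp
    finally show ?thesis .
  qed
  then show ?thesis unfolding square_root_growth_def by blast
qed

text \<open>Aligning the phases of \<open>f (X k)\<close> shows that at most \<open>(K C / e)\<^sup>2\<close> of these numbers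
  have modulus at least e.\<close>

lemma square_root_growth_imp_weakly_null:
  assumes alg: "cstar_subalgebra \<AA>" and X: "\<And>k. X k \<in> \<AA>"
    and growth: "square_root_growth X" and f: "dual_functional \<AA> f"
  shows "(\<lambda>k. f (X k)) \<longlonglongrightarrow> 0"
proof -
  obtain C where bound: "\<And>S c. finite S \<Longrightarrow> (\<And>k. cmod (c k) \<le> 1) \<Longrightarrow>
      norm (\<Sum>k\<in>S. scale_op (c k) (X k)) \<le> C * sqrt (card S)"
    using growth unfolding square_root_growth_def by blast
  obtain K0 where K0: "\<forall>a\<in>\<AA>. norm (f a) \<le> K0 * norm a"
    using f unfolding dual_functional_def by blast
  \<comment> \<open>The constant in \<open>dual_functional\<close> may be negative if the algebra is
    trivial.\<close>
  define K where "K = max K0 0"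
  have K: "0 \<le> K" "norm (f a) \<le> K * norm a" if "a \<in> \<AA>" for a
    using bspec[OF K0 that] mult_right_mono[of K0 K "norm a"] by (auto simp: K_def)
  have "finite {k. e \<le> cmod (f (X k))}" if e: "0 < e" for e
  proof (rule ccontr)
    assume inf: "infinite {k. e \<le> cmod (f (X k))}"
    define c where "c k = cnj (sgn (f (X k)))" for k
    have c: "cmod (c k) \<le> 1" "c k * f (X k) = of_real (cmod (f (X k)))" for k
      by (simp_all add: c_def cnj_sgn_mult) (simp add: norm_sgn)
    have le: "e * sqrt N \<le> K * C" if N: "0 < N" for N :: nat
    proof -
      obtain S where S: "finite S" "card S = N" "S \<subseteq> {k. e \<le> cmod (f (X k))}"
        using infinite_arbitrarily_large[OF inf] by blast
      have "e * N \<le> (\<Sum>k\<in>S. cmod (f (X k)))"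
        using sum_mono[of S "\<lambda>_. e" "\<lambda>k. cmod (f (X k))"] S by (auto simp: mult.commute)
      also have "\<dots> = cmod (of_real (\<Sum>k\<in>S. cmod (f (X k))))"
        unfolding norm_of_real by (simp add: sum_nonneg)
      also have "\<dots> = cmod (f (\<Sum>k\<in>S. scale_op (c k) (X k)))"
        using dual_functional_sum[where S = S and c = c, OF f alg X] by (simp add: c(2))
      also have "\<dots> \<le> K * norm (\<Sum>k\<in>S. scale_op (c k) (X k))"
        by (rule K(2)[OF conjunct2[OF dual_functional_sum[OF f alg X]]])
      also have "\<dots> \<le> K * (C * sqrt N)"
        using bound[OF S(1) c(1)] S(2) K(1)[OF X] by (intro mult_left_mono) auto
      finally have "(e * sqrt N) * sqrt N \<le> (K * C) * sqrt N" by (simp add: mult.assoc)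
      then show ?thesis using N by (simp add: mult_le_cancel_right)
    qed
    obtain N :: nat where N: "(K * C / e)\<^sup>2 < N" using reals_Archimedean2 by blast
    then have "0 < N" by (metis le_less_trans of_nat_0_less_iff zero_le_power2)
    have "K * C / e < sqrt N" using N by (rule real_less_rsqrt)
    then show False using le[OF \<open>0 < N\<close>] e by (simp add: field_simps)
  qed
  \<comment> \<open>On the natural numbers, failing at finitely many indices means failing only
    before some index.\<close>
  then have "eventually (\<lambda>k. cmod (f (X k)) < e) sequentially" if "0 < e" for e
    using that unfolding eventually_cofinite[symmetric] cofinite_eq_sequentially[symmetric]
    by (simp add: eventually_cofinite not_less)
  then show ?thesis by (simp add: tendsto_iff dist_norm)
qed

text \<open>Pairs an element with its prospective expectation. Fixedness of the limit is part of the
  relation, so that it is carried along with convergence through linear combinations and norm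
  limits.\<close>

definition weakly_mixes_to ::
  "('h::complex_hilbert_space \<Rightarrow>\<^sub>L 'h) set \<Rightarrow> (('h \<Rightarrow>\<^sub>L 'h) \<Rightarrow> ('h \<Rightarrow>\<^sub>L 'h)) \<Rightarrow> ('h \<Rightarrow>\<^sub>L 'h) \<Rightarrow> ('h \<Rightarrow>\<^sub>L 'h) \<Rightarrow> bool"
where
  "weakly_mixes_to \<AA> \<alpha> a b \<longleftrightarrow> a \<in> \<AA> \<and> b \<in> \<AA> \<and> \<alpha> b = b \<and>
     (\<forall>f. dual_functional \<AA> f \<longrightarrow> (\<lambda>n. f ((\<alpha> ^^ n) a)) \<longlonglongrightarrow> f b)"

section \<open>The weak limit as a conditional expectation\<close>

locale contractive_system =
  fixes \<AA> :: "('h::complex_hilbert_space \<Rightarrow>\<^sub>L 'h) set" and \<alpha> :: "('h \<Rightarrow>\<^sub>L 'h) \<Rightarrow> ('h \<Rightarrow>\<^sub>L 'h)"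
  assumes sys: "cstar_dynamical_system \<AA> \<alpha>"
    and contractive: "\<And>a. a \<in> \<AA> \<Longrightarrow> norm (\<alpha> a) \<le> norm a"
    and positive: "\<And>a. a \<in> \<AA> \<Longrightarrow> positive_op a \<Longrightarrow> positive_op (\<alpha> a)"
begin

lemma alg: "cstar_subalgebra \<AA>" using sys by (simp add: cstar_dynamical_system_def)

lemma \<alpha>_in: "a \<in> \<AA> \<Longrightarrow> \<alpha> a \<in> \<AA>"
  using sys by (auto simp: cstar_dynamical_system_def bij_betw_def)

lemma \<alpha>_add: "a \<in> \<AA> \<Longrightarrow> b \<in> \<AA> \<Longrightarrow> \<alpha> (a + b) = \<alpha> a + \<alpha> b"
  and \<alpha>_scale: "a \<in> \<AA> \<Longrightarrow> \<alpha> (scale_op c a) = scale_op c (\<alpha> a)"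
  and \<alpha>_comp: "a \<in> \<AA> \<Longrightarrow> b \<in> \<AA> \<Longrightarrow> \<alpha> (a o\<^sub>L b) = \<alpha> a o\<^sub>L \<alpha> b"
  using sys by (auto simp: cstar_dynamical_system_def linear_on_algebra_def)

lemma \<alpha>n_in: "a \<in> \<AA> \<Longrightarrow> (\<alpha> ^^ n) a \<in> \<AA>"
  by (induction n) (simp_all add: \<alpha>_in)

lemma \<alpha>n_add: "a \<in> \<AA> \<Longrightarrow> b \<in> \<AA> \<Longrightarrow> (\<alpha> ^^ n) (a + b) = (\<alpha> ^^ n) a + (\<alpha> ^^ n) b"
  by (induction n) (simp_all add: \<alpha>_add \<alpha>n_in)

lemma \<alpha>n_scale: "a \<in> \<AA> \<Longrightarrow> (\<alpha> ^^ n) (scale_op c a) = scale_op c ((\<alpha> ^^ n) a)"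
  by (induction n) (simp_all add: \<alpha>_scale \<alpha>n_in)

lemma \<alpha>n_comp: "a \<in> \<AA> \<Longrightarrow> b \<in> \<AA> \<Longrightarrow> (\<alpha> ^^ n) (a o\<^sub>L b) = (\<alpha> ^^ n) a o\<^sub>L (\<alpha> ^^ n) b"
  by (induction n) (simp_all add: \<alpha>_comp \<alpha>n_in)

lemma \<alpha>n_fixed: "\<alpha> b = b \<Longrightarrow> (\<alpha> ^^ n) b = b"
  by (induction n) simp_all

lemma \<alpha>n_norm: "a \<in> \<AA> \<Longrightarrow> norm ((\<alpha> ^^ n) a) \<le> norm a"
  by (induction n) (auto intro: order_trans[OF contractive] \<alpha>n_in)

lemma diff_in: "a \<in> \<AA> \<Longrightarrow> b \<in> \<AA> \<Longrightarrow> a - b \<in> \<AA>"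
  by (rule subspace_diff[OF cstar_subspace[OF alg]])

lemma \<alpha>_diff: "a \<in> \<AA> \<Longrightarrow> b \<in> \<AA> \<Longrightarrow> \<alpha> (a - b) = \<alpha> a - \<alpha> b"
  by (simp add: diff_eq_add_scale_op \<alpha>_add \<alpha>_scale cstar_scale[OF alg])

lemma \<alpha>n_diff: "a \<in> \<AA> \<Longrightarrow> b \<in> \<AA> \<Longrightarrow> (\<alpha> ^^ n) (a - b) = (\<alpha> ^^ n) a - (\<alpha> ^^ n) b"
  by (simp add: diff_eq_add_scale_op \<alpha>n_add \<alpha>n_scale cstar_scale[OF alg])

abbreviation "mixes \<equiv> weakly_mixes_to \<AA> \<alpha>"

lemma mixesD:
  assumes "mixes a b" shows "a \<in> \<AA>" "b \<in> \<AA>" "\<alpha> b = b"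
    "dual_functional \<AA> f \<Longrightarrow> (\<lambda>n. f ((\<alpha> ^^ n) a)) \<longlonglongrightarrow> f b"
  using assms by (auto simp: weakly_mixes_to_def)

lemma mixes_coefficient: "mixes a b \<Longrightarrow> (\<lambda>n. cinner x ((\<alpha> ^^ n) a y)) \<longlonglongrightarrow> cinner x (b y)"
  by (erule mixesD(4)) (rule dual_functional_matrix_coefficient)

text \<open>Weak lower semicontinuity of the norm, by pairing the orbit applied to \<open>y\<close>
  with the vector \<open>b y\<close>. Applied to differences, it makes the limits of a norm
  convergent sequence Cauchy.\<close>

lemma mixes_norm: assumes ab: "mixes a b" shows "norm b \<le> norm a"
proof (rule norm_blinfun_bound)
  fix y
  have "cmod (cinner (b y) (b y)) \<le> norm (b y) * (norm a * norm y)"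
  proof (rule LIMSEQ_le_const2[OF tendsto_norm[OF mixes_coefficient[OF ab]]], intro exI allI impI)
    fix n
    have "cmod (cinner (b y) ((\<alpha> ^^ n) a y)) \<le> norm (b y) * norm ((\<alpha> ^^ n) a y)" by (rule cauchy_schwarz)
    also have "\<dots> \<le> norm (b y) * (norm ((\<alpha> ^^ n) a) * norm y)" by (intro mult_left_mono norm_blinfun) simp
    also have "\<dots> \<le> norm (b y) * (norm a * norm y)"
      by (intro mult_left_mono mult_right_mono \<alpha>n_norm mixesD(1)[OF ab]) auto
    finally show "cmod (cinner (b y) ((\<alpha> ^^ n) a y)) \<le> norm (b y) * (norm a * norm y)" .
  qed
  then have "norm (b y) * norm (b y) \<le> norm (b y) * (norm a * norm y)"
    by (simp add: cinner_self power2_eq_square norm_mult)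
  then show "norm (b y) \<le> norm a * norm y"
    by (cases "norm (b y) = 0") (simp_all add: mult_le_cancel_left)
qed simp

lemma mixes_unique: assumes "mixes a b" "mixes a b'" shows "b = b'"
proof (rule blinfun_eqI, rule cinner_ext)
  show "cinner x (b y) = cinner x (b' y)" for x y
    by (rule LIMSEQ_unique[OF mixes_coefficient[OF assms(1)] mixes_coefficient[OF assms(2)]])
qed

lemma mixes_add: "mixes a b \<Longrightarrow> mixes a' b' \<Longrightarrow> mixes (a + a') (b + b')"
  unfolding weakly_mixes_to_def
proof (intro conjI allI impI; elim conjE)
  fix f assume *: "a \<in> \<AA>" "a' \<in> \<AA>" "b \<in> \<AA>" "b' \<in> \<AA>" and f: "dual_functional \<AA> f"
    and "\<forall>f. dual_functional \<AA> f \<longrightarrow> (\<lambda>n. f ((\<alpha> ^^ n) a)) \<longlonglongrightarrow> f b"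
    "\<forall>f. dual_functional \<AA> f \<longrightarrow> (\<lambda>n. f ((\<alpha> ^^ n) a')) \<longlonglongrightarrow> f b'"
  then have "(\<lambda>n. f ((\<alpha> ^^ n) a) + f ((\<alpha> ^^ n) a')) \<longlonglongrightarrow> f b + f b'" by (intro tendsto_add) auto
  then show "(\<lambda>n. f ((\<alpha> ^^ n) (a + a'))) \<longlonglongrightarrow> f (b + b')"
    using f * by (simp add: \<alpha>n_add \<alpha>n_in dual_functional_def)
qed (simp_all add: \<alpha>_add cstar_add[OF alg])

lemma mixes_scale: "mixes a b \<Longrightarrow> mixes (scale_op c a) (scale_op c b)"
  unfolding weakly_mixes_to_def
proof (intro conjI allI impI; elim conjE)
  fix f assume *: "a \<in> \<AA>" "b \<in> \<AA>" and f: "dual_functional \<AA> f"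
    and "\<forall>f. dual_functional \<AA> f \<longrightarrow> (\<lambda>n. f ((\<alpha> ^^ n) a)) \<longlonglongrightarrow> f b"
  then have "(\<lambda>n. c * f ((\<alpha> ^^ n) a)) \<longlonglongrightarrow> c * f b" by (intro tendsto_mult_left) auto
  then show "(\<lambda>n. f ((\<alpha> ^^ n) (scale_op c a))) \<longlonglongrightarrow> f (scale_op c b)"
    using f * by (simp add: \<alpha>n_scale \<alpha>n_in dual_functional_def)
qed (simp_all add: \<alpha>_scale cstar_scale[OF alg])

lemma mixes_diff: "mixes a b \<Longrightarrow> mixes a' b' \<Longrightarrow> mixes (a - a') (b - b')"
  unfolding diff_eq_add_scale_op by (intro mixes_add mixes_scale)

lemma mixes_fixed: "b \<in> \<AA> \<Longrightarrow> \<alpha> b = b \<Longrightarrow> mixes b b"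
  by (simp add: weakly_mixes_to_def \<alpha>n_fixed)

text \<open>Contractivity of the limit map makes the \<open>t k\<close> Cauchy. Powers of
  \<open>\<alpha>\<close> do not increase the distance from \<open>s k\<close> to \<open>a\<close>,
  so convergence along the orbit transfers uniformly in \<open>n\<close>.\<close>

lemma mixes_closed:
  assumes lim: "s \<longlonglongrightarrow> a" and s: "\<And>k. mixes (s k) (t k)"
  shows "\<exists>b. mixes a b"
proof -
  have st: "norm (t j - t k) \<le> norm (s j - s k)" for j k
    by (rule mixes_norm[OF mixes_diff[OF s s]])
  have "Cauchy t"
  proof (rule CauchyI)
    fix e :: real assume "0 < e"
    then obtain N where "\<forall>j\<ge>N. \<forall>k\<ge>N. norm (s j - s k) < e"
      using LIMSEQ_imp_Cauchy[OF lim] CauchyD by blast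
    then show "\<exists>N. \<forall>j\<ge>N. \<forall>k\<ge>N. norm (t j - t k) < e" using st by (meson le_less_trans)
  qed
  then obtain b where b: "t \<longlonglongrightarrow> b" unfolding Cauchy_convergent_iff convergent_def by blast
  have aA: "a \<in> \<AA>" by (rule closed_sequentially[OF cstar_closed[OF alg] mixesD(1)[OF s] lim])
  have bA: "b \<in> \<AA>" by (rule closed_sequentially[OF cstar_closed[OF alg] mixesD(2)[OF s] b])
  have sn: "(\<lambda>k. norm (s k - a)) \<longlonglongrightarrow> 0" and tn: "(\<lambda>k. norm (t k - b)) \<longlonglongrightarrow> 0"
    using lim b by (simp_all add: LIM_zero tendsto_norm_zero)
  have "t \<longlonglongrightarrow> \<alpha> b"
  proof -
    \<comment> \<open>Each \<open>t k\<close> is fixed, so this is contractivity applied to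
      \<open>t k - b\<close>.\<close>
    have "norm (t k - \<alpha> b) \<le> norm (t k - b)" for k
      using contractive[OF diff_in[OF mixesD(2)[OF s] bA], of k] mixesD(3)[OF s, of k]
      by (simp add: \<alpha>_diff[OF mixesD(2)[OF s] bA])
    then have "(\<lambda>k. t k - \<alpha> b) \<longlonglongrightarrow> 0"
      by (intro Lim_null_comparison[OF _ tn]) simp
    then show ?thesis by (simp add: LIM_zero_iff)
  qed
  then have fixed: "\<alpha> b = b" using b LIMSEQ_unique by blast
  have "(\<lambda>n. f ((\<alpha> ^^ n) a)) \<longlonglongrightarrow> f b" if f: "dual_functional \<AA> f" for f
  proof -
    obtain K0 where K0: "\<forall>a\<in>\<AA>. norm (f a) \<le> K0 * norm a"
      using f unfolding dual_functional_def by blast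
    \<comment> \<open>Positive, as it occurs in the denominator of
      \<open>e / (3 * K)\<close>.\<close>
    define K where "K = max K0 1"
    have K: "norm (f a) \<le> K * norm a" if "a \<in> \<AA>" for a
      using bspec[OF K0 that] mult_right_mono[of K0 K "norm a"] by (auto simp: K_def)
    have K1: "0 < K" by (simp add: K_def)
    have fd: "f (x - y) = f x - f y" if "x \<in> \<AA>" "y \<in> \<AA>" for x y
    proof -
      have "f (x + scale_op (- 1) y) = f x + (- 1) * f y"
        using f that cstar_scale[OF alg that(2)] unfolding dual_functional_def by metis
      then show ?thesis by (simp add: diff_eq_add_scale_op)
    qed
    show ?thesis
    proof (rule LIMSEQ_I)
      fix e :: real assume e: "0 < e"
      then have e': "0 < e / (3 * K)" using K1 by simp
      have "eventually (\<lambda>k. norm (s k - a) < e / (3 * K) \<and> norm (t k - b) < e / (3 * K)) sequentially"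
        using order_tendstoD(2)[OF sn e'] order_tendstoD(2)[OF tn e'] by eventually_elim simp
      then obtain k where k: "norm (s k - a) < e / (3 * K)" "norm (t k - b) < e / (3 * K)"
        by (auto simp: eventually_sequentially)
      obtain N where N: "\<And>n. n \<ge> N \<Longrightarrow> norm (f ((\<alpha> ^^ n) (s k)) - f (t k)) < e / 3"
        using LIMSEQ_D[OF mixesD(4)[OF s f, of k], of "e / 3"] e by auto
      have "norm (f ((\<alpha> ^^ n) a) - f b) < e" if n: "n \<ge> N" for n
      proof -
        note sA = mixesD(1)[OF s, of k] and tA = mixesD(2)[OF s, of k]
        have "norm (f ((\<alpha> ^^ n) (s k)) - f ((\<alpha> ^^ n) a)) = norm (f ((\<alpha> ^^ n) (s k - a)))"
          by (simp add: fd \<alpha>n_diff \<alpha>n_in sA aA)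
        also have "\<dots> \<le> K * norm ((\<alpha> ^^ n) (s k - a))" by (rule K[OF \<alpha>n_in[OF diff_in[OF sA aA]]])
        also have "\<dots> \<le> K * norm (s k - a)"
          using K1 by (intro mult_left_mono \<alpha>n_norm diff_in sA aA) simp
        also have "\<dots> < e / 3" using k(1) K1 by (simp add: field_simps)
        finally have 1: "norm (f ((\<alpha> ^^ n) (s k)) - f ((\<alpha> ^^ n) a)) < e / 3" .
        have "norm (f (t k) - f b) = norm (f (t k - b))" by (simp add: fd tA bA)
        also have "\<dots> \<le> K * norm (t k - b)" by (rule K[OF diff_in[OF tA bA]])
        also have "\<dots> < e / 3" using k(2) K1 by (simp add: field_simps)
        finally have 2: "norm (f (t k) - f b) < e / 3" .
        have *: "f ((\<alpha> ^^ n) a) - f b = (f ((\<alpha> ^^ n) (s k)) - f (t k)) -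
            (f ((\<alpha> ^^ n) (s k)) - f ((\<alpha> ^^ n) a)) + (f (t k) - f b)" by simp
        have "norm (f ((\<alpha> ^^ n) a) - f b) \<le> norm (f ((\<alpha> ^^ n) (s k)) - f (t k)) +
            norm (f ((\<alpha> ^^ n) (s k)) - f ((\<alpha> ^^ n) a)) + norm (f (t k) - f b)"
          unfolding * by (rule order_trans[OF norm_triangle_ineq add_right_mono[OF norm_triangle_ineq4]])
        then show ?thesis using N[OF n] 1 2 by linarith
      qed
      then show "\<exists>N. \<forall>n\<ge>N. norm (f ((\<alpha> ^^ n) a) - f b) < e" by blast
    qed
  qed
  then have "mixes a b" by (simp add: weakly_mixes_to_def aA bA fixed)
  then show ?thesis by blast
qed

text \<open>Fixed elements pass through all powers of \<open>\<alpha>\<close>; moving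
  \<open>c\<close> to the left vector by its adjoint leaves a matrix coefficient of the orbit of
  \<open>a\<close>.\<close>

lemma mixes_compose:
  assumes ab: "mixes a b" and c: "c \<in> \<AA>" "\<alpha> c = c" and d: "d \<in> \<AA>" "\<alpha> d = d"
    and ex: "mixes (c o\<^sub>L a o\<^sub>L d) e"
  shows "e = c o\<^sub>L b o\<^sub>L d"
proof (rule blinfun_eqI, rule cinner_ext)
  fix x y
  note cB = cstar_bounded[OF alg c(1)]
  have eq: "(\<alpha> ^^ n) (c o\<^sub>L a o\<^sub>L d) = c o\<^sub>L (\<alpha> ^^ n) a o\<^sub>L d" for n
    using mixesD(1)[OF ab] c d by (simp add: \<alpha>n_comp cstar_compose[OF alg] \<alpha>n_fixed)
  have "(\<lambda>n. cinner (adj c x) ((\<alpha> ^^ n) a (d y))) \<longlonglongrightarrow> cinner (adj c x) (b (d y))"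
    by (rule mixes_coefficient[OF ab])
  moreover have "(\<lambda>n. cinner x ((\<alpha> ^^ n) (c o\<^sub>L a o\<^sub>L d) y)) \<longlonglongrightarrow> cinner x (e y)"
    by (rule mixes_coefficient[OF ex])
  ultimately show "cinner x (e y) = cinner x ((c o\<^sub>L b o\<^sub>L d) y)"
    using LIMSEQ_unique by (simp add: eq adj_left[OF cB]) blast
qed

lemma mixes_positive: assumes ab: "mixes a b" and pos: "positive_op a" shows "positive_op b"
  unfolding positive_op_def
proof (intro conjI allI)
  show "b \<in> bounded_operators" by (rule cstar_bounded[OF alg mixesD(2)[OF ab]])
  fix x
  have p: "positive_op ((\<alpha> ^^ n) a)" for n
    by (induction n) (use pos mixesD(1)[OF ab] in \<open>auto intro!: positive \<alpha>n_in\<close>)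
  note lim = mixes_coefficient[OF ab, of x x]
  have "(\<lambda>n. Im (cinner x ((\<alpha> ^^ n) a x))) \<longlonglongrightarrow> Im (cinner x (b x))" by (rule tendsto_Im[OF lim])
  then have "(\<lambda>n. 0) \<longlonglongrightarrow> Im (cinner x (b x))" using p by (simp add: positive_op_def)
  then show "Im (cinner x (b x)) = 0" by (simp add: LIMSEQ_const_iff)
  show "0 \<le> Re (cinner x (b x))"
    by (rule LIMSEQ_le_const[OF tendsto_Re[OF lim]]) (use p in \<open>auto simp: positive_op_def\<close>)
qed

text \<open>Density suffices because the elements with a weak limit are norm closed; the map sending
  an element to its limit then inherits the properties of an expectation from the powers of
  \<open>\<alpha>\<close>.\<close>

lemma uniquely_mixing:
  assumes dense: "\<AA> \<subseteq> closure {a. \<exists>b. mixes a b}"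
  shows "uniquely_mixing_fixed_points \<AA> \<alpha>"
proof -
  have ex: "\<exists>b. mixes a b" if a: "a \<in> \<AA>" for a
  proof -
    obtain s where s: "\<forall>k. \<exists>b. mixes (s k) b" "s \<longlonglongrightarrow> a"
      using subsetD[OF dense a] unfolding closure_sequential by auto
    from choice[OF s(1)] show ?thesis using mixes_closed[OF s(2)] by blast
  qed
  define \<E> where "\<E> a = (SOME b. mixes a b)" for a
  have E: "mixes a (\<E> a)" if "a \<in> \<AA>" for a
    unfolding \<E>_def by (rule someI_ex[OF ex[OF that]])
  have Eeq: "\<E> a = b" if "mixes a b" for a b
    by (rule mixes_unique[OF E[OF mixesD(1)[OF that]] that])
  have "conditional_expectation_onto \<AA> (fixed_points \<AA> \<alpha>) \<E>"
    unfolding conditional_expectation_onto_def linear_on_algebra_def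
  proof (intro conjI ballI allI impI)
    show "\<E> (a + b) = \<E> a + \<E> b" if "a \<in> \<AA>" "b \<in> \<AA>" for a b
      by (rule Eeq[OF mixes_add[OF E[OF that(1)] E[OF that(2)]]])
    show "\<E> (scale_op c a) = scale_op c (\<E> a)" if "a \<in> \<AA>" for a c
      by (rule Eeq[OF mixes_scale[OF E[OF that]]])
    show "\<E> ` \<AA> \<subseteq> fixed_points \<AA> \<alpha>"
      using mixesD[OF E] by (auto simp: fixed_points_def)
    show "\<E> b = b" if "b \<in> fixed_points \<AA> \<alpha>" for b
      by (rule Eeq[OF mixes_fixed]) (use that in \<open>auto simp: fixed_points_def\<close>)
    show "norm (\<E> a) \<le> norm a" if "a \<in> \<AA>" for a by (rule mixes_norm[OF E[OF that]])
    show "positive_op (\<E> a)" if "a \<in> \<AA>" "positive_op a" for a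
      by (rule mixes_positive[OF E[OF that(1)] that(2)])
    show "\<E> (b o\<^sub>L a o\<^sub>L c) = b o\<^sub>L \<E> a o\<^sub>L c"
      if "a \<in> \<AA>" "b \<in> fixed_points \<AA> \<alpha>" "c \<in> fixed_points \<AA> \<alpha>" for a b c
      using that by (intro mixes_compose[OF E]) (auto simp: fixed_points_def intro!: E cstar_compose[OF alg])
  qed
  moreover have "\<E> (\<alpha> a) = \<E> a" if a: "a \<in> \<AA>" for a
  proof (rule Eeq)
    \<comment> \<open>The orbit of \<open>\<alpha> a\<close> is that of \<open>a\<close> without its
      first term.\<close>
    have "(\<lambda>n. f ((\<alpha> ^^ n) (\<alpha> a))) \<longlonglongrightarrow> f (\<E> a)" if "dual_functional \<AA> f" for f
      using LIMSEQ_Suc[OF mixesD(4)[OF E[OF a] that]] by (simp add: funpow_swap1)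
    then show "mixes (\<alpha> a) (\<E> a)"
      using mixesD[OF E[OF a]] by (simp add: weakly_mixes_to_def \<alpha>_in)
  qed
  ultimately show ?thesis
    unfolding uniquely_mixing_fixed_points_def using sys mixesD(4)[OF E] by blast
qed

end

section \<open>The algebra generated by the cut-off words\<close>

text \<open>The bounded operators whose conjugate lies in the algebra form a C*-algebra containing
  the generators; multiplicativity comes from \<open>adj U o\<^sub>L U = id_blinfun\<close>. It
  serves both the shift and its inverse.\<close>

lemma conjugation_preserves:
  assumes U: "U \<in> bounded_operators" "adj U o\<^sub>L U = id_blinfun" and G: "G \<subseteq> bounded_operators"
    and gen: "\<And>A. A \<in> G \<Longrightarrow> U o\<^sub>L A o\<^sub>L adj U \<in> cstar_generated G"
    and A: "A \<in> cstar_generated G"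
  shows "U o\<^sub>L A o\<^sub>L adj U \<in> cstar_generated G"
proof -
  let ?\<gamma> = "\<lambda>A. U o\<^sub>L A o\<^sub>L adj U"
  let ?\<AA> = "cstar_generated G"
  let ?S = "{A \<in> bounded_operators. ?\<gamma> A \<in> ?\<AA>}"
  note alg = cstar_generated_subalgebra[OF G]
  have bl: "bounded_linear ?\<gamma>"
    by (intro bounded_linear_compose[OF bounded_bilinear.bounded_linear_left[OF bounded_bilinear_blinfun_compose]]
      bounded_bilinear.bounded_linear_right[OF bounded_bilinear_blinfun_compose])
  interpret \<gamma>: bounded_linear ?\<gamma> by (rule bl)
  have UU: "adj U (U x) = x" for x
    using U(2) by (metis blinfun_apply_blinfun_compose id_blinfun.rep_eq id_apply)
  have "cstar_subalgebra ?S"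
    unfolding cstar_subalgebra_def
  proof (intro conjI ballI allI)
    show "0 \<in> ?S" using \<gamma>.zero cstar_zero[OF alg] zero_in_bounded_operators by simp
    show "A + B \<in> ?S" if "A \<in> ?S" "B \<in> ?S" for A B
      using that by (simp add: \<gamma>.add cstar_add[OF alg] add_in_bounded_operators)
    show "A o\<^sub>L B \<in> ?S" if "A \<in> ?S" "B \<in> ?S" for A B
    proof -
      have "?\<gamma> (A o\<^sub>L B) = ?\<gamma> A o\<^sub>L ?\<gamma> B" by (rule blinfun_eqI) (simp add: UU)
      then show ?thesis using that by (simp add: cstar_compose[OF alg] comp_in_bounded_operators)
    qed
    show "scale_op c A \<in> ?S" if "A \<in> ?S" for A c
    proof -
      have "?\<gamma> (scale_op c A) = scale_op c (?\<gamma> A)"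
        by (rule blinfun_eqI) (simp add: bounded_operators_scaleC[OF U(1)])
      then show ?thesis using that by (simp add: cstar_scale[OF alg] scale_op_in_bounded_operators)
    qed
    show "adj A \<in> ?S" if "A \<in> ?S" for A
    proof -
      have "?\<gamma> (adj A) = adj (?\<gamma> A)"
        using that U(1) by (simp add: adj_comp comp_in_bounded_operators adj_in adj_adj blinfun_compose_assoc)
      then show ?thesis using that cstar_adj[OF alg, of "?\<gamma> A"] by (simp add: adj_in)
    qed
    have "closed (?\<gamma> -` ?\<AA>)"
      by (rule closed_vimage[OF cstar_closed[OF alg] linear_continuous_on[OF bl]])
    moreover have "?S = bounded_operators \<inter> ?\<gamma> -` ?\<AA>" by auto
    ultimately show "closed ?S" using closed_bounded_operators by (metis closed_Int)
  qed auto
  then have "?\<AA> \<subseteq> ?S"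
    by (rule cstar_generated_minimal) (use G gen in auto)
  then show ?thesis using A by blast
qed

context deformed_fock
begin

text \<open>The row estimate extends from tensors by density: each \<open>z i\<close> is
  approximated by vectors \<open>J (s i k)\<close>, and for a finite family both sides
  converge.\<close>

lemma ex_creation_row_bound:
  "\<exists>C\<ge>0. \<forall>F z. finite F \<longrightarrow> (\<forall>i. z i \<in> particle_space J n) \<longrightarrow>
    (norm (\<Sum>i\<in>F. cre n i (z i)))\<^sup>2 \<le> C * (\<Sum>i\<in>F. (norm (z i))\<^sup>2)"
proof -
  obtain C where C: "C \<ge> 0" "\<And>F \<eta>. finite F \<Longrightarrow> (\<And>i. \<eta> i \<in> tensor_power n) \<Longrightarrow>
    (norm (J (\<lambda>xs. \<Sum>i\<in>F. prepend i (\<eta> i) xs)))\<^sup>2 \<le> C * (\<Sum>i\<in>F. (norm (J (\<eta> i)))\<^sup>2)"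
    using ex_creation_bound[of n] by blast
  have "(norm (\<Sum>i\<in>F. cre n i (z i)))\<^sup>2 \<le> C * (\<Sum>i\<in>F. (norm (z i))\<^sup>2)"
    if F: "finite F" and z: "\<And>i. z i \<in> particle_space J n" for F z
  proof -
    have "\<exists>s. (\<forall>k. s k \<in> tensor_power n) \<and> (\<lambda>k. J (s k)) \<longlonglongrightarrow> z i" for i
    proof -
      have "\<exists>u. (\<forall>k. u k \<in> J ` tensor_power n) \<and> u \<longlonglongrightarrow> z i"
        using z[of i] by (simp only: particle_space_def closure_sequential)
      then obtain u where u: "\<forall>k. u k \<in> J ` tensor_power n" "u \<longlonglongrightarrow> z i" by blast
      then have "\<forall>k. \<exists>\<eta>. \<eta> \<in> tensor_power n \<and> u k = J \<eta>" by blast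
      from choice[OF this] obtain s where s: "\<forall>k. s k \<in> tensor_power n \<and> u k = J (s k)" by blast
      then have "u = (\<lambda>k. J (s k))" by auto
      then show ?thesis using u(2) s by blast
    qed
    then have "\<forall>i. \<exists>s. (\<forall>k. s k \<in> tensor_power n) \<and> (\<lambda>k. J (s k)) \<longlonglongrightarrow> z i" by blast
    from choice[OF this] obtain s where
      s: "\<And>i k. s i k \<in> tensor_power n" "\<And>i. (\<lambda>k. J (s i k)) \<longlonglongrightarrow> z i" by blast
    have "(norm (\<Sum>i\<in>F. cre n i (J (s i k))))\<^sup>2 \<le> C * (\<Sum>i\<in>F. (norm (J (s i k)))\<^sup>2)" for k
      using C(2)[OF F, of "\<lambda>i. s i k"] J_sum[of F "\<lambda>i. prepend i (s i k)" "Suc n"]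
      by (simp add: s cre_J prepend_in)
    moreover have "(\<lambda>k. (norm (\<Sum>i\<in>F. cre n i (J (s i k))))\<^sup>2) \<longlonglongrightarrow> (norm (\<Sum>i\<in>F. cre n i (z i)))\<^sup>2"
      by (intro tendsto_intros s)
    moreover have "(\<lambda>k. C * (\<Sum>i\<in>F. (norm (J (s i k)))\<^sup>2)) \<longlonglongrightarrow> C * (\<Sum>i\<in>F. (norm (z i))\<^sup>2)"
      by (intro tendsto_intros s)
    ultimately show ?thesis by (intro LIMSEQ_le) auto
  qed
  then show ?thesis using C(1) by blast
qed

section \<open>Growth along orbits of the shift\<close>

lemma shift_pow_bounded: "A \<in> bounded_operators \<Longrightarrow> (\<alpha> ^^ k) A \<in> bounded_operators"
  by (induction k) (simp_all add: shift_in_bounded)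

lemma shift_pow_adj: "A \<in> bounded_operators \<Longrightarrow> (\<alpha> ^^ k) (adj A) = adj ((\<alpha> ^^ k) A)"
  by (induction k) (simp_all add: shift_adj shift_pow_bounded)

lemma shift_pow_compose: "(\<alpha> ^^ k) (A o\<^sub>L B) = (\<alpha> ^^ k) A o\<^sub>L (\<alpha> ^^ k) B"
  by (induction k) (simp_all add: shift_compose)

lemma shift_pow_E: "(\<alpha> ^^ k) (E n) = E n"
  by (induction k) (simp_all add: shift_block)

lemma shift_pow_cre: "(\<alpha> ^^ k) (cre n i) = cre n (i + int k)"
  by (induction k) (simp_all add: shift_block ac_simps)

lemma norm_shift_pow: "norm ((\<alpha> ^^ k) A) \<le> norm A"
  by (induction k) (auto intro: order_trans[OF norm_shift])

text \<open>Orbits under the shift move the leading creation operator through pairwise different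
  basis vectors, so that sums along an orbit grow only like the square root of their length.\<close>

lemma creation_orbit_growth:
  assumes Y: "Y \<in> bounded_operators" "E m o\<^sub>L Y = Y"
  shows "square_root_growth (\<lambda>k. (\<alpha> ^^ k) (cre m i o\<^sub>L Y))"
proof -
  obtain C where C: "C \<ge> 0" "\<And>F z. finite F \<Longrightarrow> (\<And>i. z i \<in> particle_space J m) \<Longrightarrow>
    (norm (\<Sum>i\<in>F. cre m i (z i)))\<^sup>2 \<le> C * (\<Sum>i\<in>F. (norm (z i))\<^sup>2)"
    using ex_creation_row_bound[of m] by blast
  have "norm (\<Sum>k\<in>S. scale_op (c k) ((\<alpha> ^^ k) (cre m i o\<^sub>L Y))) \<le> (sqrt C * norm Y) * sqrt (card S)"
    if S: "finite S" and c: "\<forall>k. cmod (c k) \<le> 1" for S c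
  proof (rule norm_blinfun_bound)
    show "0 \<le> (sqrt C * norm Y) * sqrt (card S)" using C(1) by simp
    fix x
    \<comment> \<open>\<open>j - i\<close> is the time at which the leading creator has moved to
      index \<open>j\<close>; in the sum only \<open>j = i + int k\<close> occurs, where
      \<open>nat\<close> loses nothing.\<close>
    define z where "z j = c (nat (j - i)) *\<^sub>C (\<alpha> ^^ nat (j - i)) Y x" for j
    let ?h = "\<lambda>k. i + int k"
    have zm: "z j \<in> particle_space J m" for j
    proof -
      have "(\<alpha> ^^ k) Y x = E m ((\<alpha> ^^ k) Y x)" for k
        using arg_cong[OF Y(2), of "\<alpha> ^^ k"] by (metis shift_pow_compose shift_pow_E blinfun_apply_blinfun_compose)
      then have "(\<alpha> ^^ k) Y x \<in> particle_space J m" for k by (metis E_in)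
      then show ?thesis using particle_space_subspace by (simp add: z_def complex_subspace_def)
    qed
    have zn: "norm (z j) \<le> norm Y * norm x" for j
    proof -
      have "norm (z j) \<le> 1 * norm ((\<alpha> ^^ nat (j - i)) Y x)"
        unfolding z_def norm_scaleC by (intro mult_right_mono) (simp_all add: c)
      also have "\<dots> \<le> norm ((\<alpha> ^^ nat (j - i)) Y) * norm x" by (simp add: norm_blinfun)
      also have "\<dots> \<le> norm Y * norm x" by (intro mult_right_mono norm_shift_pow) simp
      finally show ?thesis .
    qed
    have "(\<Sum>k\<in>S. scale_op (c k) ((\<alpha> ^^ k) (cre m i o\<^sub>L Y))) x = (\<Sum>k\<in>S. cre m (?h k) (z (?h k)))"
      by (simp add: blinfun.sum_left shift_pow_compose shift_pow_cre z_def bounded_operators_scaleC[OF cre_bounded])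
    \<comment> \<open>Different times give different indices, so the sum over times is a sum over
      distinct basis vectors and the row estimate applies.\<close>
    also have "\<dots> = (\<Sum>j\<in>?h ` S. cre m j (z j))" by (subst sum.reindex) (auto simp: inj_on_def)
    finally have eq: "(\<Sum>k\<in>S. scale_op (c k) ((\<alpha> ^^ k) (cre m i o\<^sub>L Y))) x = (\<Sum>j\<in>?h ` S. cre m j (z j))" .
    have "(norm (\<Sum>j\<in>?h ` S. cre m j (z j)))\<^sup>2 \<le> C * (\<Sum>j\<in>?h ` S. (norm (z j))\<^sup>2)"
      using S by (intro C(2) zm) simp
    also have "\<dots> \<le> C * (\<Sum>j\<in>?h ` S. (norm Y * norm x)\<^sup>2)"
      using C(1) zn by (intro mult_left_mono sum_mono power_mono) auto
    also have "\<dots> = (((sqrt C * norm Y) * sqrt (card S)) * norm x)\<^sup>2"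
      using C(1) by (simp add: card_image inj_on_def power_mult_distrib)
    finally show "norm ((\<Sum>k\<in>S. scale_op (c k) ((\<alpha> ^^ k) (cre m i o\<^sub>L Y))) x) \<le>
        ((sqrt C * norm Y) * sqrt (card S)) * norm x"
      unfolding eq by (rule power2_le_imp_le) (use C(1) in simp)
  qed
  then show ?thesis unfolding square_root_growth_def by blast
qed

section \<open>Normal ordering of words\<close>

lemma word_commute:
  "word (us @ Annihilate i # Create j # vs) n = (if i = j then word (us @ vs) n else 0) +
    (\<Sum>(k, l)\<in>{(k, l). t_coeff T j l i k \<noteq> 0}.
      scale_op (t_coeff T j l i k) (word (us @ Create k # Annihilate l # vs) n))"
  (is "_ = _ + (\<Sum>(k, l)\<in>?S. ?t k l (word (us @ Create k # Annihilate l # vs) n))")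
proof -
  let ?d = "wdeg vs n"
  \<comment> \<open>In degree 0 the degrees assigned to \<open>us\<close> differ on the two sides,
    but there the annihilator block makes both sides 0.\<close>
  have w: "word (us @ Create k # Annihilate l # vs) n =
      word us ?d o\<^sub>L (block (Create k) (?d - 1) o\<^sub>L block (Annihilate l) ?d) o\<^sub>L word vs n" for k l
    by (cases ?d) (simp_all add: word_append blinfun_compose_assoc)
  have "word (us @ Annihilate i # Create j # vs) n =
      word us ?d o\<^sub>L (block (Annihilate i) (Suc ?d) o\<^sub>L block (Create j) ?d) o\<^sub>L word vs n"
    by (simp add: word_append blinfun_compose_assoc)
  also have "\<dots> = (word us ?d o\<^sub>L (if i = j then E ?d else 0) o\<^sub>L word vs n) +
      (\<Sum>(k, l)\<in>?S. ?t k l (word us ?d o\<^sub>L (block (Create k) (?d - 1) o\<^sub>L block (Annihilate l) ?d) o\<^sub>L word vs n))"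
    unfolding commutation_rule
    by (rule blinfun_eqI) (simp add: blinfun.add_left blinfun.add_right blinfun.sum_left blinfun.sum_right
        case_prod_unfold bounded_operators_scaleC[OF word_bounded] del: block.simps)
  also have "word us ?d o\<^sub>L (if i = j then E ?d else 0) o\<^sub>L word vs n = (if i = j then word (us @ vs) n else 0)"
    by (simp add: word_append word_E)
  finally show ?thesis unfolding w .
qed

text \<open>Writing such a word as the adjoint of an operator with a leading creator lets the growth
  estimate for creators be reused.\<close>

lemma word_snoc_Annihilate:
  "word (vs @ [Annihilate i]) n = (case n of 0 \<Rightarrow> 0 | Suc m \<Rightarrow> adj (cre m i o\<^sub>L adj (word vs m)))"
proof (cases n)
  case (Suc m)
  then have "word (vs @ [Annihilate i]) n = word vs m o\<^sub>L adj (cre m i)"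
    by (simp add: word_append adj_cre_E)
  then show ?thesis
    using Suc by (simp add: adj_comp cre_bounded adj_in word_bounded adj_adj)
qed (simp add: word_append)

section \<open>The Fock algebra and its automorphism\<close>

lemma cutoff_generators_bounded:
  "insert id_blinfun {cutoff_word J m ws n |m ws n. True} \<subseteq> bounded_operators"
  by (auto simp: cutoff_word_eq id_in_bounded_operators word_bounded zero_in_bounded_operators)

lemma fock_algebra_subalgebra: "cstar_subalgebra (fock_algebra J)"
  unfolding fock_algebra_def by (rule cstar_generated_subalgebra[OF cutoff_generators_bounded])

lemma word_in_fock_algebra: "word ws n \<in> fock_algebra J"
  and id_in_fock_algebra: "id_blinfun \<in> fock_algebra J"
proof -
  have "word ws n = cutoff_word J (wdeg ws n) ws n" by (simp add: cutoff_word_eq)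
  then show "word ws n \<in> fock_algebra J" "id_blinfun \<in> fock_algebra J"
    unfolding fock_algebra_def by (auto intro!: subsetD[OF cstar_generated_superset])
qed

text \<open>Arranged to be closed under products and adjoints: 0 absorbs products with mismatched
  degrees, and the identity is added because a word lives on one particle space.\<close>

definition words :: "('h \<Rightarrow>\<^sub>L 'h) set" where
  "words = insert id_blinfun (insert 0 {word ws n |ws n. True})"

lemma words_compose: "A \<in> words \<Longrightarrow> B \<in> words \<Longrightarrow> A o\<^sub>L B \<in> words"
proof -
  have ww: "word us m o\<^sub>L word vs n \<in> words" for us m vs n
  proof (cases "m = wdeg vs n")
    case True
    then show ?thesis by (auto simp: words_def word_append[symmetric])
  next
    case False
    have "word us m o\<^sub>L word vs n = word us m o\<^sub>L (E m o\<^sub>L E (wdeg vs n)) o\<^sub>L word vs n"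
      by (metis E_word word_E blinfun_compose_assoc)
    then show ?thesis using False by (simp add: E_orth words_def)
  qed
  have id: "id_blinfun o\<^sub>L X = X" "X o\<^sub>L id_blinfun = X" for X :: "'h \<Rightarrow>\<^sub>L 'h"
    by (rule blinfun_eqI, simp)+
  have cases: "X = id_blinfun \<or> X = 0 \<or> (\<exists>ws n. X = word ws n)" if "X \<in> words" for X
    using that by (auto simp: words_def)
  assume AB: "A \<in> words" "B \<in> words"
  have "0 \<in> words" by (simp add: words_def)
  with cases[OF AB(1)] cases[OF AB(2)] AB ww show "A o\<^sub>L B \<in> words"
    by (elim disjE exE) (simp_all add: id)
qed

lemma words_adj: "A \<in> words \<Longrightarrow> adj A \<in> words"
proof -
  have w: "word ws n \<in> words" for ws n by (auto simp: words_def)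
  have 0: "0 \<in> words" by (simp add: words_def)
  have "adj (block l n) \<in> words" for l n
  proof (cases "(l, n)" rule: block.cases)
    case (1 i m)
    then show ?thesis using w[of "[Annihilate i]" "Suc m"] by (simp add: adj_cre_E)
  next
    case (2 i)
    then show ?thesis by (simp add: adj_zero 0)
  next
    case (3 i m)
    then show ?thesis using w[of "[Create i]" m] by (simp add: adj_adj cre_bounded cre_E)
  qed
  then have "adj (word ws n) \<in> words" for ws n
    using w[of "[]"]
    by (induction ws) (simp_all add: E_adj adj_comp block_bounded word_bounded words_compose del: block.simps)
  then show "A \<in> words \<Longrightarrow> adj A \<in> words"
    by (auto simp: words_def adj_zero adj_id)
qed

lemma fock_algebra_subset_closure: "fock_algebra J \<subseteq> closure (span {scale_op c A |c A. A \<in> words})"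
proof -
  have b: "words \<subseteq> bounded_operators"
    by (auto simp: words_def id_in_bounded_operators zero_in_bounded_operators word_bounded)
  have "insert id_blinfun {cutoff_word J m ws n |m ws n. True} \<subseteq> words"
    by (auto simp: words_def cutoff_word_eq)
  also have "\<dots> \<subseteq> cstar_generated words" by (rule cstar_generated_superset)
  finally have "fock_algebra J \<subseteq> cstar_generated words"
    unfolding fock_algebra_def by (rule cstar_generated_minimal[OF cstar_generated_subalgebra[OF b]])
  also have "\<dots> \<subseteq> closure (span {scale_op c A |c A. A \<in> words})"
    by (rule cstar_generated_subset_closure[OF b words_compose words_adj])
  finally show ?thesis .
qed

lemma shift_id: "\<alpha> id_blinfun = id_blinfun"
proof -
  have "W (adj W x) = x" for x
    using W_W_adj by (metis blinfun_apply_blinfun_compose id_blinfun.rep_eq id_apply)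
  then show ?thesis by (intro blinfun_eqI) (simp add: shift_automorphism_def)
qed

text \<open>Bijectivity comes from the explicit inverse, conjugation by \<open>adj W\<close>; both
  conjugations preserve the algebra because they send words to words, with indices moved by 1 and by
  -1.\<close>

lemma shift_dynamical_system: "cstar_dynamical_system (fock_algebra J) \<alpha>"
proof -
  let ?G = "insert id_blinfun {cutoff_word J m ws n |m ws n. True}"
  let ?\<beta> = "\<lambda>A. adj W o\<^sub>L A o\<^sub>L adj (adj W)"
  have WW: "adj W (W x) = x" "W (adj W x) = x" for x
    using W_adj_W W_W_adj by (metis blinfun_apply_blinfun_compose id_blinfun.rep_eq id_apply)+
  have \<beta>\<alpha>: "?\<beta> (\<alpha> A) = A" and \<alpha>\<beta>: "\<alpha> (?\<beta> A) = A" for A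
    by (rule blinfun_eqI, simp add: shift_automorphism_def adj_adj W_bounded WW)+
  have \<alpha>G: "\<alpha> A \<in> fock_algebra J" if "A \<in> ?G" for A
  proof -
    have "\<alpha> 0 = 0" by (simp add: shift_automorphism_def)
    then show ?thesis
      using that by (auto simp: cutoff_word_eq shift_id shift_word word_in_fock_algebra id_in_fock_algebra
          cstar_zero[OF fock_algebra_subalgebra])
  qed
  have \<beta>G: "?\<beta> A \<in> fock_algebra J" if "A \<in> ?G" for A
  proof -
    have "?\<beta> id_blinfun = id_blinfun"
      by (rule blinfun_eqI) (simp add: adj_adj W_bounded WW)
    moreover have "?\<beta> (word ws n) = word (map (shift_ladder (- 1)) ws) n" for ws n
    proof -
      have "shift_ladder 1 (shift_ladder (- 1) l) = l" for l by (cases l) simp_all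
      then have "word ws n = \<alpha> (word (map (shift_ladder (- 1)) ws) n)"
        by (simp add: shift_word comp_def)
      then show ?thesis by (metis \<beta>\<alpha>)
    qed
    ultimately show ?thesis
      using that by (auto simp: cutoff_word_eq word_in_fock_algebra id_in_fock_algebra
          cstar_zero[OF fock_algebra_subalgebra])
  qed
  have \<alpha>A: "\<alpha> A \<in> fock_algebra J" if "A \<in> fock_algebra J" for A
    using conjugation_preserves[OF W_bounded W_adj_W cutoff_generators_bounded] \<alpha>G that
    by (simp add: shift_automorphism_def fock_algebra_def)
  have \<beta>A: "?\<beta> A \<in> fock_algebra J" if "A \<in> fock_algebra J" for A
    using conjugation_preserves[OF adj_in[OF W_bounded] _ cutoff_generators_bounded] \<beta>G that
    by (simp add: fock_algebra_def adj_adj W_bounded W_W_adj)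
  have "bij_betw \<alpha> (fock_algebra J) (fock_algebra J)"
    by (rule bij_betw_byWitness[where f' = ?\<beta>]) (use \<beta>\<alpha> \<alpha>\<beta> \<alpha>A \<beta>A in auto)
  moreover have "\<alpha> (A + B) = \<alpha> A + \<alpha> B" for A B
    using bounded_linear_shift by (simp add: linear_add bounded_linear.linear)
  ultimately show ?thesis
    unfolding cstar_dynamical_system_def linear_on_algebra_def
    using cstar_bounded[OF fock_algebra_subalgebra]
    by (simp add: fock_algebra_subalgebra id_in_fock_algebra shift_scale_op shift_compose shift_adj)
qed

sublocale mixing: contractive_system "fock_algebra J" \<alpha>
  by unfold_locales (simp_all add: shift_dynamical_system norm_shift shift_positive)

section \<open>Mixing of words\<close>

lemma mixes_zeroI:
  assumes "X \<in> fock_algebra J"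
    and "square_root_growth (\<lambda>k. (\<alpha> ^^ k) X)"
  shows "mixing.mixes X 0"
  unfolding weakly_mixes_to_def
proof (intro conjI allI impI)
  note z = cstar_zero[OF fock_algebra_subalgebra]
  show "X \<in> fock_algebra J" "0 \<in> fock_algebra J" by (simp_all add: assms(1) z)
  show "\<alpha> 0 = 0" by (simp add: shift_automorphism_def)
  fix f assume f: "dual_functional (fock_algebra J) f"
  then have "f (scale_op 0 0) = 0 * f 0" using z by (simp add: dual_functional_def del: scale_op_zero)
  then show "(\<lambda>n. f ((\<alpha> ^^ n) X)) \<longlonglongrightarrow> f 0"
    using square_root_growth_imp_weakly_null[OF fock_algebra_subalgebra mixing.\<alpha>n_in[OF assms(1)] assms(2) f]
    by simp
qed

lemma mixes_Create: "mixing.mixes (word (Create i # vs) n) 0"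
  by (rule mixes_zeroI[OF word_in_fock_algebra])
    (simp add: creation_orbit_growth[OF word_bounded E_word])

text \<open>Square-root growth is invariant under adjoints, and taking adjoints along the orbit
  gives the orbit of an operator with a leading creator. In degree 0 the word is 0.\<close>

lemma mixes_Annihilate: "mixing.mixes (word (vs @ [Annihilate i]) n) 0"
proof (cases n)
  case 0
  then show ?thesis
    using mixing.mixes_fixed[OF cstar_zero[OF fock_algebra_subalgebra]]
    by (simp add: word_snoc_Annihilate shift_automorphism_def)
next
  case (Suc m)
  let ?X = "cre m i o\<^sub>L adj (word vs m)"
  have XB: "?X \<in> bounded_operators" by (simp add: comp_in_bounded_operators cre_bounded adj_in word_bounded)
  have "E m o\<^sub>L adj (word vs m) = adj (word vs m)"
    using arg_cong[OF word_E[of vs m], of adj] by (simp add: adj_comp word_bounded E_bounded E_adj)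
  then have "square_root_growth (\<lambda>k. (\<alpha> ^^ k) ?X)"
    by (rule creation_orbit_growth[OF adj_in[OF word_bounded]])
  then have "square_root_growth (\<lambda>k. adj ((\<alpha> ^^ k) ?X))"
    by (rule square_root_growth_adj) (rule shift_pow_bounded[OF XB])
  moreover have "(\<alpha> ^^ k) (word (vs @ [Annihilate i]) n) = adj ((\<alpha> ^^ k) ?X)" for k
    using Suc by (simp add: word_snoc_Annihilate shift_pow_adj[OF XB])
  ultimately show ?thesis
    by (intro mixes_zeroI[OF word_in_fock_algebra]) simp
qed

lemma ex_mixes_sum: "(\<And>p. p \<in> I \<Longrightarrow> \<exists>b. mixing.mixes (X p) b) \<Longrightarrow> \<exists>b. mixing.mixes (\<Sum>p\<in>I. X p) b"
proof (induction I rule: infinite_finite_induct)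
  case (insert p I)
  then obtain b b' where "mixing.mixes (X p) b" "mixing.mixes (\<Sum>p\<in>I. X p) b'" by blast
  from mixing.mixes_add[OF this] show ?case using insert by auto
qed (use mixing.mixes_fixed[OF cstar_zero[OF fock_algebra_subalgebra]] in
    \<open>auto simp: shift_automorphism_def\<close>)

text \<open>A word that begins with a creator or ends with an annihilator mixes to 0. In any other
  nonempty word the first creator can be moved to the left by the commutation rule; every step
  also produces a shorter word.\<close>

lemma ex_mixes_word: "\<exists>b. mixing.mixes (word ws n) b"
proof (induction "length ws" arbitrary: ws rule: less_induct)
  case less
  \<comment> \<open>\<open>j\<close> and \<open>vs\<close> are general because an exchange replaces
    the creator index by \<open>k\<close> and puts an annihilator in front of \<open>vs\<close>; the
    length stays the same while one annihilator fewer precedes the creator.\<close>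
  have push: "\<exists>b. mixing.mixes (word (us @ Create j # vs) n) b"
    if "length us + length vs + 1 = length ws" "set us \<subseteq> range Annihilate" for us j vs
    using that
  proof (induction us arbitrary: j vs rule: rev_induct)
    case Nil
    then show ?case using mixes_Create by auto
  next
    case (snoc l us)
    then obtain i where l: "l = Annihilate i" by auto
    \<comment> \<open>The contraction removes two letters, so the outer induction applies.\<close>
    have 1: "\<exists>b. mixing.mixes (word (us @ vs) n) b"
      using snoc.prems by (intro less) simp
    \<comment> \<open>The zero operator is handled as an empty sum.\<close>
    have "\<exists>b. mixing.mixes (if i = j then word (us @ vs) n else 0) b"
      using 1 ex_mixes_sum[of "{}"] by auto
    moreover have "\<exists>b. mixing.mixes (\<Sum>p\<in>{(k, l). t_coeff T j l i k \<noteq> 0}. case p of (k, l) \<Rightarrow>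
        scale_op (t_coeff T j l i k) (word (us @ Create k # Annihilate l # vs) n)) b"
    proof (rule ex_mixes_sum)
      fix p :: "int \<times> int"
      obtain k m where p: "p = (k, m)" by fastforce
      obtain b where "mixing.mixes (word (us @ Create k # Annihilate m # vs) n) b"
        using snoc.IH[of "Annihilate m # vs" k] snoc.prems by auto
      from mixing.mixes_scale[OF this]
      show "\<exists>b. mixing.mixes (case p of (k, l) \<Rightarrow>
        scale_op (t_coeff T j l i k) (word (us @ Create k # Annihilate l # vs) n)) b"
        by (auto simp: p)
    qed
    ultimately obtain b b' where "mixing.mixes (if i = j then word (us @ vs) n else 0) b"
      "mixing.mixes (\<Sum>p\<in>{(k, l). t_coeff T j l i k \<noteq> 0}. case p of (k, l) \<Rightarrow>
        scale_op (t_coeff T j l i k) (word (us @ Create k # Annihilate l # vs) n)) b'" by blast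
    from mixing.mixes_add[OF this] show ?case
      by (intro exI) (simp only: l append_assoc append_Cons append_Nil word_commute)
  qed
  show ?case
  proof (cases "\<exists>l\<in>set ws. l \<in> range Create")
    case True
    from split_list_first_prop[OF this] obtain us l vs where
      ws: "ws = us @ l # vs" "l \<in> range Create" "\<forall>y\<in>set us. y \<notin> range Create" by blast
    have "y \<in> range Annihilate" if "y \<in> set us" for y
      using ws(3) that by (cases y) auto
    then have "set us \<subseteq> range Annihilate" by blast
    then show ?thesis using push[of us vs] ws by auto
  next
    case False
    \<comment> \<open>Without creators, a nonempty word ends with an annihilator; the empty word is
      \<open>E n\<close>, which is fixed.\<close>
    show ?thesis
    proof (cases ws rule: rev_cases)
      case Nil
      then show ?thesis
        using mixing.mixes_fixed[OF word_in_fock_algebra[of "[]" n]] by (auto simp: shift_block)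
    next
      case (snoc vs l)
      then show ?thesis using False mixes_Annihilate by (cases l) auto
    qed
  qed
qed

lemma shift_uniquely_mixing: "uniquely_mixing_fixed_points (fock_algebra J) \<alpha>"
proof (rule mixing.uniquely_mixing)
  have base: "\<exists>b. mixing.mixes A b" if "A \<in> words" for A
    using that ex_mixes_word ex_mixes_sum[of "{}"]
      mixing.mixes_fixed[OF id_in_fock_algebra shift_id]
    by (auto simp: words_def)
  have "\<exists>b. mixing.mixes A b" if "A \<in> span {scale_op c A |c A. A \<in> words}" for A
    using that
  proof (induction rule: span_induct_alt)
    case base
    show ?case using ex_mixes_sum[of "{}"] by simp
  next
    case (step r A B)
    then obtain c A' b b' where A': "A = scale_op c A'" "mixing.mixes A' b" "mixing.mixes B b'"
      using \<open>\<And>A. A \<in> words \<Longrightarrow> \<exists>b. mixing.mixes A b\<close> by blast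
    \<comment> \<open>The span is real, so its scalar \<open>r\<close> is applied as a complex one
      on top of \<open>c\<close>.\<close>
    from mixing.mixes_add[OF mixing.mixes_scale[OF mixing.mixes_scale[OF A'(2), of c], of "of_real r"] A'(3)]
    show ?case by (auto simp: scaleR_scale_op A'(1))
  qed
  then have "span {scale_op c A |c A. A \<in> words} \<subseteq> {a. \<exists>b. mixing.mixes a b}" by blast
  then show "fock_algebra J \<subseteq> closure {a. \<exists>b. mixing.mixes a b}"
    using fock_algebra_subset_closure closure_mono by blast
qed

end

theorem proposition6p1:
  fixes T :: "tensor \<Rightarrow> tensor"
    and J :: "tensor \<Rightarrow> 'h::complex_hilbert_space"
  assumes "yang_baxter_hecke_operator T"
    and "\<And>i j. finite {(k, l). t_coeff T j l i k \<noteq> 0}"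
    and "\<And>\<xi>. \<xi> \<in> tensor_power 2 \<Longrightarrow> T (shift \<xi>) = shift (T \<xi>)"
    and "deformed_fock_space T J"
  shows "uniquely_mixing_fixed_points (fock_algebra J) (shift_automorphism J)"
proof -
  interpret deformed_fock T J by unfold_locales (fact assms)+
  show ?thesis by (rule shift_uniquely_mixing)
qed

end
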